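(* Consider the income fluctuation (precautionary savings) problem described in the context, with asset policy function $x^+=f(x,e)$, and let $\hat x\ge\underline{x}$ be such that $f(x,e)<x$ for all $x>\hat x$ and all $e\in E$. Let the assets evolve by $x_{t+1}=f(x_t,e_t)$. Then there exists a unique probability distribution $\pi$ on $[\underline{x},\hat x]$ such that the distributions of $x_t$ converge to $\pi$ in the uniform metric as $t\to\infty$ for any initial value $x_0\in[\underline{x},\hat x]$.
   Context: Model. An agent maximizes $\mathbf{E}\bigl[\sum_{t=0}^\infty\beta^t u(c_t)\bigr]$, where $c_t\ge 0$ is consumption, $u(c)=c^{1-\gamma}/(1-\gamma)$ with $\gamma>1$, and $\beta\in(0,1)$, subject at each date to the budget constraint $c+R^{-1}x^+\le x+e$ and the borrowing constraint $x^+\ge\underline{x}$, where $e$ is the current endowment, $x$ current assets, $x^+$ next-period assets, and $R^{-1}>\beta$ is the (fixed) price of next-period assets. The endowment $e_t$ takes values in $E=[\underline{e},\bar e]$, $0<\underline{e}<\bar e<\infty$, and is a time-homogeneous aperiodic positive recurrent Markov chain with an atom: there is a point (the atom) such that from every starting point the hitting time of the atom is almost surely finite, the return time from the atom to itself (at times $t\ge 1$) has finite mean, and the distribution of this return time is aperiodic (the g.c.d. of its support is 1). Its transition function $Q:E\times\mathcal{E}\to[0,1]$ ($\mathcal{E}$ the Borel sets of $E$) satisfies the Feller property. The borrowing constraint satisfies $\underline{x}<0$ and $\underline{x}+\underline{e}-\underline{x}R^{-1}>0$. The initial values $e_0\in E$, $x_0\ge\underline{x}$ are given. The problem is represented by the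 functional equation $$v(x,e)=\max_{(c,x^+)\in\Gamma(x,e)}u(c)+\beta\,\mathbf{E}[v(x^+,e^+)\mid e],$$ $$\Gamma(x,e)=\{(c,x^+): c+R^{-1}x^+\le x+e,\ x^+\ge\underline{x},\ c\ge 0\},$$ where $\mathbf{E}$ is expectation over next-period endowment $e^+$ given $e$. It has a unique bounded continuous solution $v$, which is increasing, strictly concave and continuously differentiable in $x$; the resulting policy functions are $c=c(x,e)$ and $x^+=f(x,e)$, where $f$ is continuous and nondecreasing in $x$, and strictly increasing in $x$ whenever $f(x,e)>\underline{x}$. Uniform metric between distributions on the real line with distribution functions $F,G$: $d(F,G)=\sup_x|F(x)-G(x)|$. *)

theory Defs
  imports "HOL-Probability.Probability"
begin

abbreviation state_space :: "real set \<Rightarrow> real measure" where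
  "state_space E \<equiv> restrict_space borel E"

definition transition_function :: "real set \<Rightarrow> (real \<Rightarrow> real measure) \<Rightarrow> bool" where
  "transition_function E Q \<longleftrightarrow> Q \<in> state_space E \<rightarrow>\<^sub>M prob_algebra (state_space E)"

definition feller :: "real set \<Rightarrow> (real \<Rightarrow> real measure) \<Rightarrow> bool" where
  "feller E Q \<longleftrightarrow>
    (\<forall>g :: real \<Rightarrow> real. continuous_on E g \<and> bounded (g ` E) \<longrightarrow>
       continuous_on E (\<lambda>e. \<integral>y. g y \<partial>Q e))"

text \<open>
  The law on path space of the time-homogeneous chain with transition function \<open>Q\<close> started
  at \<open>e0\<close>, obtained from the Ionescu-Tulcea theorem: coordinate \<open>0\<close> is \<open>e0\<close>, and
  coordinate \<open>t + 1\<close> has conditional law \<open>Q\<close> of coordinate \<open>t\<close> given the past.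
\<close>

definition chain_step ::
    "real set \<Rightarrow> (real \<Rightarrow> real measure) \<Rightarrow> real \<Rightarrow> nat \<Rightarrow> (nat \<Rightarrow> real) \<Rightarrow> real measure" where
  "chain_step E Q e0 t \<omega> = (case t of 0 \<Rightarrow> return (state_space E) e0 | Suc s \<Rightarrow> Q (\<omega> s))"

definition chain_law ::
    "real set \<Rightarrow> (real \<Rightarrow> real measure) \<Rightarrow> real \<Rightarrow> (nat \<Rightarrow> real) measure" where
  "chain_law E Q e0 =
     projective_family.lim UNIV
       (Ionescu_Tulcea.CI (chain_step E Q e0) (\<lambda>_. state_space E)) (\<lambda>_. state_space E)"

lemma Ionescu_Tulcea_chain_step:
  assumes Q: "transition_function E Q" and e0: "e0 \<in> E"
  shows "Ionescu_Tulcea (chain_step E Q e0) (\<lambda>_. state_space E)"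
proof -
  have Q': "Q \<in> state_space E \<rightarrow>\<^sub>M prob_algebra (state_space E)"
    using Q by (simp add: transition_function_def)
  have r: "return (state_space E) e0 \<in> space (prob_algebra (state_space E))"
    using e0 by (auto simp: space_prob_algebra space_restrict_space intro!: prob_space_return)
  have step: "chain_step E Q e0 t \<in>
      (PiM {0..<t} (\<lambda>_. state_space E)) \<rightarrow>\<^sub>M prob_algebra (state_space E)" for t
  proof (cases t)
    case 0
    then show ?thesis
      using r by (simp add: chain_step_def[abs_def] measurable_const)
  next
    case (Suc s)
    have "(\<lambda>\<omega>. \<omega> s) \<in> PiM {0..<Suc s} (\<lambda>_. state_space E) \<rightarrow>\<^sub>M state_space E"
      by (rule measurable_component_singleton) simp
    from measurable_compose[OF this Q'] show ?thesis
      using Suc by (simp add: chain_step_def[abs_def])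
  qed
  show ?thesis
  proof (rule Ionescu_Tulcea.intro)
    fix t :: nat
    show "chain_step E Q e0 t \<in>
        (PiM {0..<t} (\<lambda>_. state_space E)) \<rightarrow>\<^sub>M subprob_algebra (state_space E)"
      by (rule measurable_prob_algebraD[OF step])
  next
    fix t :: nat and \<omega> :: "nat \<Rightarrow> real"
    assume "\<omega> \<in> space (PiM {0..<t} (\<lambda>_. state_space E))"
    from measurable_space[OF step this] show "prob_space (chain_step E Q e0 t \<omega>)"
      by (simp add: space_prob_algebra)
  qed
qed

definition hitting_time :: "real \<Rightarrow> (nat \<Rightarrow> real) \<Rightarrow> enat" where
  "hitting_time a \<omega> = Inf (enat ` {t. \<omega> t = a})"

definition return_time :: "real \<Rightarrow> (nat \<Rightarrow> real) \<Rightarrow> enat" where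
  "return_time a \<omega> = Inf (enat ` {t. 1 \<le> t \<and> \<omega> t = a})"

definition aperiodic_positive_recurrent_atom ::
    "real set \<Rightarrow> (real \<Rightarrow> real measure) \<Rightarrow> real \<Rightarrow> bool" where
  "aperiodic_positive_recurrent_atom E Q a \<longleftrightarrow>
     a \<in> E \<and>
     (\<forall>e\<in>E. AE \<omega> in chain_law E Q e. hitting_time a \<omega> < \<infinity>) \<and>
     (\<integral>\<^sup>+\<omega>. ennreal_of_enat (return_time a \<omega>) \<partial>chain_law E Q a) < \<infinity> \<and>
     Gcd {n :: nat. measure (chain_law E Q a)
           {\<omega> \<in> space (chain_law E Q a). return_time a \<omega> = enat n} > 0} = 1"

text \<open>
  Since \<open>\<gamma> > 1\<close>, utility is \<open>-\<infinity>\<close> at zero consumption; this must be stated because the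
  library sets \<open>0 powr a = 0\<close>.  Only \<open>c \<ge> 0\<close> is ever used.
\<close>

definition utility :: "real \<Rightarrow> real \<Rightarrow> ereal" where
  "utility \<gamma> c = (if c \<le> 0 then -\<infinity> else ereal (c powr (1 - \<gamma>) / (1 - \<gamma>)))"

definition feasible :: "real \<Rightarrow> real \<Rightarrow> real \<Rightarrow> real \<Rightarrow> (real \<times> real) set" where
  "feasible R xlow x e = {(c, x'). c + inverse R * x' \<le> x + e \<and> x' \<ge> xlow \<and> c \<ge> 0}"

definition objective ::
    "real \<Rightarrow> real \<Rightarrow> (real \<Rightarrow> real measure) \<Rightarrow> (real \<Rightarrow> real \<Rightarrow> real) \<Rightarrow> real \<Rightarrow> real \<times> real \<Rightarrow> ereal" where
  "objective \<gamma> \<beta> Q v e = (\<lambda>(c, x'). utility \<gamma> c + ereal (\<beta> * (\<integral>e'. v x' e' \<partial>Q e)))"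

definition optimal_choice ::
    "real \<Rightarrow> real \<Rightarrow> real \<Rightarrow> real \<Rightarrow> (real \<Rightarrow> real measure) \<Rightarrow> (real \<Rightarrow> real \<Rightarrow> real) \<Rightarrow>
     real \<Rightarrow> real \<Rightarrow> real \<times> real \<Rightarrow> bool" where
  "optimal_choice \<gamma> \<beta> R xlow Q v x e =
     is_arg_max (objective \<gamma> \<beta> Q v e) (\<lambda>p. p \<in> feasible R xlow x e)"

definition value_function ::
    "real \<Rightarrow> real \<Rightarrow> real \<Rightarrow> real \<Rightarrow> real set \<Rightarrow> (real \<Rightarrow> real measure) \<Rightarrow> (real \<Rightarrow> real \<Rightarrow> real) \<Rightarrow> bool" where
  "value_function \<gamma> \<beta> R xlow E Q v \<longleftrightarrow>
     continuous_on ({xlow..} \<times> E) (\<lambda>(x, e). v x e) \<and>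
     bounded ((\<lambda>(x, e). v x e) ` ({xlow..} \<times> E)) \<and>
     (\<forall>x\<ge>xlow. \<forall>e\<in>E. \<exists>p. optimal_choice \<gamma> \<beta> R xlow Q v x e p \<and>
        ereal (v x e) = objective \<gamma> \<beta> Q v e p)"

definition policy_functions ::
    "real \<Rightarrow> real \<Rightarrow> real \<Rightarrow> real \<Rightarrow> real set \<Rightarrow> (real \<Rightarrow> real measure) \<Rightarrow> (real \<Rightarrow> real \<Rightarrow> real) \<Rightarrow>
     (real \<Rightarrow> real \<Rightarrow> real) \<Rightarrow> (real \<Rightarrow> real \<Rightarrow> real) \<Rightarrow> bool" where
  "policy_functions \<gamma> \<beta> R xlow E Q v c f \<longleftrightarrow>
     (\<forall>x\<ge>xlow. \<forall>e\<in>E. optimal_choice \<gamma> \<beta> R xlow Q v x e (c x e, f x e))"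

primrec assets :: "(real \<Rightarrow> real \<Rightarrow> real) \<Rightarrow> real \<Rightarrow> nat \<Rightarrow> (nat \<Rightarrow> real) \<Rightarrow> real" where
  "assets f x0 0 \<omega> = x0"
| "assets f x0 (Suc t) \<omega> = f (assets f x0 t \<omega>) (\<omega> t)"

definition asset_distribution ::
    "real set \<Rightarrow> (real \<Rightarrow> real measure) \<Rightarrow> (real \<Rightarrow> real \<Rightarrow> real) \<Rightarrow> real \<Rightarrow> real \<Rightarrow> nat \<Rightarrow> real measure" where
  "asset_distribution E Q f x0 e0 t = distr (chain_law E Q e0) borel (assets f x0 t)"

definition uniform_metric :: "real measure \<Rightarrow> real measure \<Rightarrow> real" where
  "uniform_metric \<mu> \<nu> = (SUP x. \<bar>cdf \<mu> x - cdf \<nu> x\<bar>)"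

end

theory Submission
  imports Defs
begin

text \<open>
  The assets of two agents who face the same endowment path keep their order, because \<open>f\<close> is
  nondecreasing in \<open>x\<close>. So if an agent who starts at the top \<open>xhat\<close> ever reaches the borrowing
  limit \<open>xlow\<close>, all agents with that endowment path have the same assets from then on. The proof
  shows that this happens almost surely; assets then forget their initial value, and what remains
  is that the endowment chain forgets its initial value.

  \<^emph>\<open>The borrowing limit is reached.\<close> As long as the borrowing constraint is slack, the Euler
  inequality \<open>u'(c) \<le> \<beta> R E u'(c\<^sup>+)\<close> holds (lemma \<open>euler\<close>). With \<open>\<beta> R < 1\<close>, an agent who never
  meets the constraint would have expected marginal utility growing geometrically. But marginal
  utility is bounded: a bounded value function forces consumption to stay above a positive
  constant (lemma \<open>c_ge_cmin\<close>). Hence from the top, with the endowment at the atom, the limit is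
  reached with positive probability in finitely many periods (lemma \<open>marginal_utility_le_away\<close>).
  Every visit to the atom gives such a chance, uniformly in the current assets by monotonicity, so
  the limit is reached almost surely (lemma \<open>never_zero\<close>).

  \<^emph>\<open>The chain forgets its start.\<close> Splitting at the visits to the atom turns the expectation of a
  function of the endowment at time \<open>n\<close> into the convolution of its expectation over one excursion
  with the probabilities of being at the atom. These probabilities converge by the renewal
  theorem, proved here for finite mean by a limsup argument: along a subsequence that attains the
  limsup, all shifts by large numbers attain it too, and the identity for the ages of the renewal
  process identifies the value. Convergence is uniform over all test functions with values in
  \<open>[0, 1]\<close> (theorem \<open>avg_pow_mixing\<close>).

  \<^emph>\<open>Combination.\<close> After a burn-in of \<open>s\<close> periods the endowment is nearly in equilibrium whatever
  the start; after \<open>t\<close> more periods the assets are, with high probability, those of an agent who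
  stood at \<open>xlow\<close> at time \<open>s\<close>. This compares the distribution of \<open>x\<^sub>s\<^sub>+\<^sub>t\<close> with a number that depends
  only on \<open>t\<close> and the test function, uniformly in the test function
  (theorem \<open>step_pow_uniform_limit\<close>). The distribution functions are thus uniformly Cauchy, with a
  common limit for all initial values, and a uniform limit of distribution functions supported on
  \<open>[xlow, xhat]\<close> is again one.

  That \<open>f\<close> is monotone and measurable is derived from the Bellman equation: a swap of the choices of
  two agents gives monotonicity, and concavity of \<open>v\<close> makes the optimal choice unique, so that the
  graph of \<open>f\<close> is closed.
\<close>

section \<open>Renewal sequences\<close>

text \<open>
  The least positive difference \<open>d\<close> of two elements divides every element, for a remainder modulo
  \<open>d\<close> would be a smaller difference. So \<open>d = 1\<close>, and two consecutive numbers \<open>g\<close>, \<open>g + 1\<close> generate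
  everything from \<open>g * g\<close> on.
\<close>

lemma numeric_semigroup_eventually_all:
  fixes G :: "nat set"
  assumes zero: "0 \<in> G" and add: "\<And>m n. m \<in> G \<Longrightarrow> n \<in> G \<Longrightarrow> m + n \<in> G"
    and gcd: "Gcd G = 1"
  shows "\<exists>K. \<forall>n\<ge>K. n \<in> G"
proof -
  have mult: "k * m \<in> G" if "m \<in> G" for k m
    by (induction k) (use that zero add in auto)
  define P where "P d \<longleftrightarrow> d > 0 \<and> (\<exists>g. g \<in> G \<and> g + d \<in> G)" for d
  have "\<exists>n\<in>G. n \<noteq> 0"
    using gcd Gcd_0_iff[of G] by (metis singletonI subsetI zero_neq_one)
  then obtain n0 where "n0 \<in> G" "n0 \<noteq> 0" by blast
  then have "P n0" unfolding P_def using zero by auto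
  define d where "d = (LEAST d. P d)"
  have Pd: "P d" unfolding d_def using \<open>P n0\<close> by (rule LeastI)
  then obtain g where g: "g \<in> G" "g + d \<in> G" "d > 0" unfolding P_def by blast
  have "d dvd n" if n: "n \<in> G" for n
  proof (rule ccontr)
    assume "\<not> d dvd n"
    then have pos: "n mod d > 0" by (simp add: dvd_eq_mod_eq_0)
    have "(n div d) * (g + d) + n mod d = n + (n div d) * g"
      by (simp add: algebra_simps)
    then have "P (n mod d)"
      unfolding P_def using pos mult[OF g(2), of "n div d"] add[OF n mult[OF g(1), of "n div d"]]
      by auto
    then have "d \<le> n mod d" unfolding d_def by (rule Least_le)
    then show False using mod_less_divisor[OF g(3), of n] by linarith
  qed
  then have "d dvd Gcd G" by (rule Gcd_greatest)
  then have d1: "d = 1" using gcd by simp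
  show ?thesis
  proof (intro exI[of _ "g * g"] allI impI)
    fix n assume n: "n \<ge> g * g"
    show "n \<in> G"
    proof (cases "g = 0")
      case True
      then have "1 \<in> G" using g d1 by simp
      from mult[OF this, of n] show ?thesis by simp
    next
      case False
      have "n mod g < g" "g \<le> n div g"
        using False n by (auto simp: less_eq_div_iff_mult_less_eq)
      then have "(n div g - n mod g) * g + (n mod g) * (g + d) = n"
        using d1 by (simp add: algebra_simps diff_mult_distrib)
      then show ?thesis
        using add[OF mult[OF g(1), of "n div g - n mod g"] mult[OF g(2), of "n mod g"]] by simp
    qed
  qed
qed

text \<open>
  Dominated convergence for convolutions, along a subsequence of times: only finitely many terms
  \<open>j\<close> matter up to an error bounded by the tail of \<open>r\<close>. Truncated subtraction is harmless because
  the index \<open>\<sigma> i - j\<close> is eventually exact for each fixed \<open>j\<close>.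
\<close>

lemma convolution_tendsto_suminf:
  fixes r d :: "nat \<Rightarrow> real"
  assumes r: "summable r" "\<And>j. 0 \<le> r j"
    and B: "\<And>n. \<bar>d n\<bar> \<le> B"
    and \<sigma>: "filterlim \<sigma> at_top sequentially"
    and d: "\<And>j. (\<lambda>i. d (\<sigma> i - j)) \<longlonglongrightarrow> \<eta>"
  shows "(\<lambda>i. \<Sum>j\<le>\<sigma> i. r j * d (\<sigma> i - j)) \<longlonglongrightarrow> \<eta> * suminf r"
proof -
  define g where "g j i = (if j \<le> \<sigma> i then r j * d (\<sigma> i - j) else 0)" for i j
  have lim: "(\<lambda>i. g j i) \<longlonglongrightarrow> r j * \<eta>" for j
  proof -
    have "(\<lambda>i. r j * d (\<sigma> i - j)) \<longlonglongrightarrow> r j * \<eta>"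
      by (intro tendsto_intros d)
    moreover have "\<forall>\<^sub>F i in sequentially. r j * d (\<sigma> i - j) = g j i"
      using \<sigma>[unfolded filterlim_at_top, rule_format, of j]
      by eventually_elim (simp add: g_def)
    ultimately show ?thesis
      by (rule Lim_transform_eventually)
  qed
  have bnd: "norm (g j i) \<le> r j * B" for i j
    using B[of "\<sigma> i - j"] r(2)[of j] B[of 0]
    by (auto simp: g_def abs_mult intro!: mult_left_mono)
  have "(\<lambda>i. suminf (\<lambda>j. g j i)) \<longlonglongrightarrow> suminf (\<lambda>j. r j * \<eta>)"
    using tannerys_theorem[where a = g and b = "\<lambda>j. r j * \<eta>" and M = "\<lambda>j. r j * B" and F = sequentially,
        OF lim always_eventually summable_mult2[OF r(1)]] bnd by auto
  moreover have "suminf (\<lambda>j. g j i) = (\<Sum>j\<le>\<sigma> i. r j * d (\<sigma> i - j))" for i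
    by (subst suminf_finite[of "{..\<sigma> i}"]) (auto simp: g_def)
  moreover have "suminf (\<lambda>j. r j * \<eta>) = \<eta> * suminf r"
    using suminf_mult2[OF r(1), of \<eta>] by (simp add: mult.commute)
  ultimately show ?thesis by simp
qed

lemma convolution_tendsto_0:
  fixes r d :: "nat \<Rightarrow> real"
  assumes r: "summable r" "\<And>j. 0 \<le> r j" and d: "d \<longlonglongrightarrow> 0"
  shows "(\<lambda>n. \<Sum>j\<le>n. r j * d (n - j)) \<longlonglongrightarrow> 0"
proof -
  obtain B where B: "\<And>n. norm (d n) \<le> B"
    using convergent_imp_Bseq[of d] d unfolding Bseq_def convergent_def by blast
  have "(\<lambda>i. d (i - j)) \<longlonglongrightarrow> 0" for j
    by (rule filterlim_compose[OF d filterlim_minus_const_nat_at_top])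
  from convolution_tendsto_suminf[OF r B[unfolded real_norm_def] filterlim_ident this]
  show ?thesis by simp
qed

lemma bounded_limsup_subseq:
  fixes w :: "nat \<Rightarrow> real"
  assumes B: "\<And>n. \<bar>w n\<bar> \<le> B"
  shows "\<exists>\<eta> \<sigma>. strict_mono \<sigma> \<and> (\<lambda>i. w (\<sigma> i)) \<longlonglongrightarrow> \<eta>
    \<and> (\<forall>\<epsilon>>0. \<forall>\<^sub>F n in sequentially. w n < \<eta> + \<epsilon>)"
proof -
  define X where "X n = ereal (w n)" for n
  obtain \<sigma> where \<sigma>: "strict_mono \<sigma>" "(X \<circ> \<sigma>) \<longlonglongrightarrow> limsup X"
    using limsup_subseq_lim[of X] by blast
  have "limsup X \<le> ereal B"
    by (rule Limsup_bounded) (use B in \<open>auto simp: X_def abs_le_iff\<close>)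
  moreover have "ereal (-B) \<le> limsup X"
  proof (rule Lim_bounded2[OF \<sigma>(2)])
    show "\<forall>n\<ge>0. ereal (- B) \<le> (X \<circ> \<sigma>) n"
      using B by (auto simp: X_def abs_le_iff minus_le_iff)
  qed
  ultimately obtain \<eta> where \<eta>: "limsup X = ereal \<eta>"
    by (cases "limsup X") auto
  show ?thesis
  proof (intro exI conjI allI impI)
    show "strict_mono \<sigma>" by fact
    show "(\<lambda>i. w (\<sigma> i)) \<longlonglongrightarrow> \<eta>"
      using \<sigma>(2) \<eta> by (simp add: X_def o_def)
    show "\<forall>\<^sub>F n in sequentially. w n < \<eta> + \<epsilon>" if "\<epsilon> > 0" for \<epsilon>
    proof -
      have "limsup X < ereal (\<eta> + \<epsilon>)" using \<eta> that by simp
      from Limsup_lessD[OF this] show ?thesis by (simp add: X_def)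
    qed
  qed
qed

text \<open>
  In the limit, \<open>w (\<tau> i)\<close> is an average of earlier values that are at most \<open>\<eta>\<close>. An average can only
  attain the upper bound if every term with positive weight attains it.
\<close>

lemma renewal_shift_limit:
  fixes \<phi> w :: "nat \<Rightarrow> real"
  assumes \<phi>: "\<And>j. 0 \<le> \<phi> j" "\<phi> sums 1"
    and B: "\<And>n. \<bar>w n\<bar> \<le> B"
    and eq: "\<And>n. n \<ge> 1 \<Longrightarrow> w n = (\<Sum>j\<le>n. \<phi> j * w (n - j))"
    and sup: "\<And>\<epsilon>. \<epsilon> > 0 \<Longrightarrow> \<forall>\<^sub>F n in sequentially. w n < \<eta> + \<epsilon>"
    and \<tau>: "filterlim \<tau> at_top sequentially" and lim: "(\<lambda>i. w (\<tau> i)) \<longlonglongrightarrow> \<eta>"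
    and k: "\<phi> k > 0"
  shows "(\<lambda>i. w (\<tau> i - k)) \<longlonglongrightarrow> \<eta>"
proof -
  \<comment> \<open>the excess over \<open>\<eta>\<close>; it vanishes in the limit, so it may be ignored in the average\<close>
  define e where "e n = max (w n - \<eta>) 0" for n
  have e0: "e \<longlonglongrightarrow> 0"
  proof (rule LIMSEQ_I)
    fix \<epsilon> :: real assume \<epsilon>: "\<epsilon> > 0"
    from sup[OF \<epsilon>] obtain N where "\<And>n. n \<ge> N \<Longrightarrow> w n < \<eta> + \<epsilon>"
      by (auto simp: eventually_sequentially)
    then have "norm (e n - 0) < \<epsilon>" if "n \<ge> N" for n
      using \<epsilon> that unfolding e_def real_norm_def by (smt (verit))
    then show "\<exists>N. \<forall>n\<ge>N. norm (e n - 0) < \<epsilon>" by blast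
  qed
  define cv where "cv n = (\<Sum>j\<le>n. \<phi> j * e (n - j))" for n
  have cv0: "cv \<longlonglongrightarrow> 0"
    unfolding cv_def by (rule convolution_tendsto_0) (use \<phi> e0 sums_summable in auto)
  define s where "s n = (\<Sum>j\<le>n. \<phi> j)" for n
  have s1: "s \<longlonglongrightarrow> 1"
    using \<phi>(2) unfolding s_def sums_def_le .
  have lower: "w n - \<eta> * s n - cv n \<le> \<phi> k * (w (n - k) - \<eta>)" if n: "n \<ge> 1" "n \<ge> k" for n
  proof -
    have "w n - \<eta> * s n = (\<Sum>j\<le>n. \<phi> j * (w (n - j) - \<eta>))"
      by (subst eq[OF n(1)]) (simp add: s_def sum_distrib_left sum_subtractf algebra_simps)
    also have "\<dots> = \<phi> k * (w (n - k) - \<eta>) + (\<Sum>j\<in>{..n}-{k}. \<phi> j * (w (n - j) - \<eta>))"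
      using n by (subst sum.remove[of _ k]) auto
    also have "(\<Sum>j\<in>{..n}-{k}. \<phi> j * (w (n - j) - \<eta>)) \<le> (\<Sum>j\<in>{..n}-{k}. \<phi> j * e (n - j))"
      by (intro sum_mono mult_left_mono) (auto simp: e_def \<phi>)
    also have "\<dots> \<le> cv n"
      unfolding cv_def by (intro sum_mono2) (auto simp: e_def \<phi>)
    finally show ?thesis by simp
  qed
  have upper: "\<phi> k * (w (n - k) - \<eta>) \<le> \<phi> k * e (n - k)" for n
    using k by (auto simp: e_def)
  have \<tau>k: "filterlim (\<lambda>i. \<tau> i - k) at_top sequentially"
    by (rule filterlim_compose[OF filterlim_minus_const_nat_at_top \<tau>])
  have "(\<lambda>i. \<phi> k * (w (\<tau> i - k) - \<eta>)) \<longlonglongrightarrow> 0"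
  proof (rule tendsto_sandwich)
    show "\<forall>\<^sub>F i in sequentially. w (\<tau> i) - \<eta> * s (\<tau> i) - cv (\<tau> i) \<le> \<phi> k * (w (\<tau> i - k) - \<eta>)"
      using \<tau>[unfolded filterlim_at_top, rule_format, of "max 1 k"]
      by eventually_elim (intro lower, auto)
    show "\<forall>\<^sub>F i in sequentially. \<phi> k * (w (\<tau> i - k) - \<eta>) \<le> \<phi> k * e (\<tau> i - k)"
      using upper by simp
    have "(\<lambda>i. w (\<tau> i) - \<eta> * s (\<tau> i) - cv (\<tau> i)) \<longlonglongrightarrow> \<eta> - \<eta> * 1 - 0"
      by (intro tendsto_intros lim filterlim_compose[OF s1 \<tau>] filterlim_compose[OF cv0 \<tau>])
    then show "(\<lambda>i. w (\<tau> i) - \<eta> * s (\<tau> i) - cv (\<tau> i)) \<longlonglongrightarrow> 0" by simp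
    have "(\<lambda>i. \<phi> k * e (\<tau> i - k)) \<longlonglongrightarrow> \<phi> k * 0"
      by (intro tendsto_intros filterlim_compose[OF e0 \<tau>k])
    then show "(\<lambda>i. \<phi> k * e (\<tau> i - k)) \<longlonglongrightarrow> 0" by simp
  qed
  then have "(\<lambda>i. inverse (\<phi> k) * (\<phi> k * (w (\<tau> i - k) - \<eta>))) \<longlonglongrightarrow> inverse (\<phi> k) * 0"
    by (intro tendsto_intros)
  then have "(\<lambda>i. w (\<tau> i - k) - \<eta>) \<longlonglongrightarrow> 0" using k by simp
  then show ?thesis by (simp add: LIM_zero_cancel)
qed

text \<open>
  By the preceding lemma the shifts \<open>k\<close> that preserve \<open>w (\<tau> i) \<longlonglongrightarrow> \<eta>\<close> form a semigroup that contains
  the support of \<open>\<phi>\<close>, hence all large numbers. Shifting the limsup-attaining subsequence by a fixed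
  \<open>K\<close>, the conserved quantity \<open>\<kappa>\<close> becomes \<open>\<eta> * suminf r\<close> in the limit, which determines \<open>\<eta>\<close>.
\<close>

lemma renewal_limsup:
  fixes \<phi> w r :: "nat \<Rightarrow> real"
  assumes \<phi>: "\<And>j. 0 \<le> \<phi> j" "\<phi> sums 1" and gcd: "Gcd {n. \<phi> n > 0} = 1"
    and r: "summable r" "\<And>j. 0 \<le> r j"
    and B: "\<And>n. \<bar>w n\<bar> \<le> B"
    and eq: "\<And>n. n \<ge> 1 \<Longrightarrow> w n = (\<Sum>j\<le>n. \<phi> j * w (n - j))"
    and tot: "\<And>n. (\<Sum>j\<le>n. r j * w (n - j)) = \<kappa>"
    and \<epsilon>: "\<epsilon> > 0" and r0: "suminf r > 0"
  shows "\<forall>\<^sub>F n in sequentially. w n < \<kappa> / suminf r + \<epsilon>"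
proof -
  obtain \<eta> \<sigma> where \<sigma>: "strict_mono \<sigma>" "(\<lambda>i. w (\<sigma> i)) \<longlonglongrightarrow> \<eta>"
    and sup: "\<And>\<epsilon>. \<epsilon> > 0 \<Longrightarrow> \<forall>\<^sub>F n in sequentially. w n < \<eta> + \<epsilon>"
    using bounded_limsup_subseq[of w B, OF B] by (elim exE conjE) simp
  have \<sigma>_top: "filterlim \<sigma> at_top sequentially"
    by (rule filterlim_subseq[OF \<sigma>(1)])
  define G where "G = {k. \<forall>\<tau>. filterlim \<tau> at_top sequentially \<longrightarrow> (\<lambda>i. w (\<tau> i)) \<longlonglongrightarrow> \<eta>
      \<longrightarrow> (\<lambda>i. w (\<tau> i - k)) \<longlonglongrightarrow> \<eta>}"
  have "\<exists>K. \<forall>n\<ge>K. n \<in> G"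
  proof (rule numeric_semigroup_eventually_all)
    show "0 \<in> G" by (simp add: G_def)
    show "m + n \<in> G" if "m \<in> G" "n \<in> G" for m n
      unfolding G_def
    proof safe
      fix \<tau> :: "nat \<Rightarrow> nat"
      assume \<tau>: "filterlim \<tau> at_top sequentially" "(\<lambda>i. w (\<tau> i)) \<longlonglongrightarrow> \<eta>"
      have "(\<lambda>i. w (\<tau> i - m)) \<longlonglongrightarrow> \<eta>"
        using \<open>m \<in> G\<close> \<tau> by (simp add: G_def)
      moreover have "filterlim (\<lambda>i. \<tau> i - m) at_top sequentially"
        by (rule filterlim_compose[OF filterlim_minus_const_nat_at_top \<tau>(1)])
      ultimately have "(\<lambda>i. w (\<tau> i - m - n)) \<longlonglongrightarrow> \<eta>"
        using \<open>n \<in> G\<close>[unfolded G_def mem_Collect_eq, rule_format, of "\<lambda>i. \<tau> i - m"] by blast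
      then show "(\<lambda>i. w (\<tau> i - (m + n))) \<longlonglongrightarrow> \<eta>" by simp
    qed
    have "{n. \<phi> n > 0} \<subseteq> G"
      unfolding G_def using renewal_shift_limit[OF \<phi> B eq sup] by blast
    then have "Gcd G dvd Gcd {n. \<phi> n > 0}"
      by (intro Gcd_greatest Gcd_dvd) blast
    then show "Gcd G = 1" using gcd by simp
  qed
  then obtain K where K: "\<And>n. n \<ge> K \<Longrightarrow> n \<in> G" by blast
  have "(\<lambda>i. \<Sum>j\<le>\<sigma> i - K. r j * w (\<sigma> i - K - j)) \<longlonglongrightarrow> \<eta> * suminf r"
  proof (rule convolution_tendsto_suminf[OF r B])
    show "filterlim (\<lambda>i. \<sigma> i - K) at_top sequentially"
      by (rule filterlim_compose[OF filterlim_minus_const_nat_at_top \<sigma>_top])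
    show "(\<lambda>i. w (\<sigma> i - K - j)) \<longlonglongrightarrow> \<eta>" for j
      using K[of "K + j", unfolded G_def mem_Collect_eq, rule_format, OF _ \<sigma>_top \<sigma>(2)] by simp
  qed
  then have "\<kappa> = \<eta> * suminf r"
    unfolding tot LIMSEQ_const_iff .
  then show ?thesis using sup[OF \<epsilon>] r0 by simp
qed

text \<open>
  The renewal theorem of Erdos, Feller and Pollard for finite mean: \<open>\<phi>\<close> is the waiting time
  distribution, \<open>u n\<close> the probability of a renewal at time \<open>n\<close>, \<open>r\<close> the tail of \<open>\<phi>\<close>, whose sum is the
  mean. Applying the limsup bound to \<open>u\<close> and to \<open>- u\<close> gives the limit.
\<close>

theorem renewal_theorem:
  fixes \<phi> u r :: "nat \<Rightarrow> real"
  assumes \<phi>: "\<And>j. 0 \<le> \<phi> j" "\<phi> sums 1" and gcd: "Gcd {n. \<phi> n > 0} = 1"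
    and r: "summable r" "\<And>j. 0 \<le> r j" and r0: "suminf r > 0"
    and B: "\<And>n. \<bar>u n\<bar> \<le> B"
    and eq: "\<And>n. n \<ge> 1 \<Longrightarrow> u n = (\<Sum>j\<le>n. \<phi> j * u (n - j))"
    and tot: "\<And>n. (\<Sum>j\<le>n. r j * u (n - j)) = 1"
  shows "u \<longlonglongrightarrow> 1 / suminf r"
proof (rule LIMSEQ_I)
  fix \<epsilon> :: real assume \<epsilon>: "\<epsilon> > 0"
  have "\<forall>\<^sub>F n in sequentially. u n < 1 / suminf r + \<epsilon>"
    by (rule renewal_limsup[OF \<phi> gcd r B eq tot \<epsilon> r0])
  moreover have "\<forall>\<^sub>F n in sequentially. - u n < - 1 / suminf r + \<epsilon>"
  proof (rule renewal_limsup[where w = "\<lambda>n. - u n", OF \<phi> gcd r _ _ _ \<epsilon> r0])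
    show "\<bar>- u n\<bar> \<le> B" for n using B by simp
    show "- u n = (\<Sum>j\<le>n. \<phi> j * - u (n - j))" if "n \<ge> 1" for n
      using eq[OF that] by (simp add: sum_negf)
    show "(\<Sum>j\<le>n. r j * - u (n - j)) = - 1" for n
      using tot[of n] by (simp add: sum_negf)
  qed
  ultimately have "\<forall>\<^sub>F n in sequentially. norm (u n - 1 / suminf r) < \<epsilon>"
    by eventually_elim (auto simp: abs_less_iff)
  then show "\<exists>N. \<forall>n\<ge>N. norm (u n - 1 / suminf r) < \<epsilon>"
    by (simp add: eventually_sequentially)
qed

section \<open>Mixing of a Markov kernel with a recurrent atom\<close>

text \<open>
  Test functions with values in the unit interval suffice for distances between distributions, and
  all integrability conditions hold for them automatically.
\<close>

definition unit_valued :: "'a measure \<Rightarrow> ('a \<Rightarrow> real) \<Rightarrow> bool" where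
  "unit_valued M g \<longleftrightarrow> g \<in> borel_measurable M \<and> (\<forall>e\<in>space M. 0 \<le> g e \<and> g e \<le> 1)"

lemma unit_valued_const: "0 \<le> c \<Longrightarrow> c \<le> 1 \<Longrightarrow> unit_valued M (\<lambda>_. c)"
  by (simp add: unit_valued_def)

lemma unit_valued_mult: "unit_valued M g \<Longrightarrow> unit_valued M h \<Longrightarrow> unit_valued M (\<lambda>e. g e * h e)"
  by (auto simp: unit_valued_def mult_le_one)

locale markov_kernel =
  fixes M :: "'a measure" and Q :: "'a \<Rightarrow> 'a measure"
  assumes kernel: "Q \<in> M \<rightarrow>\<^sub>M prob_algebra M"
begin

lemma prob_space_Q: "e \<in> space M \<Longrightarrow> prob_space (Q e)"
  and sets_Q: "e \<in> space M \<Longrightarrow> sets (Q e) = sets M"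
  and space_Q: "e \<in> space M \<Longrightarrow> space (Q e) = space M"
  using measurable_space[OF kernel] by (auto simp: space_prob_algebra dest: sets_eq_imp_space_eq)

definition avg :: "('a \<Rightarrow> real) \<Rightarrow> 'a \<Rightarrow> real" where
  "avg g e = (\<integral>y. g y \<partial>Q e)"

lemma integrable_unit:
  assumes "unit_valued M g" "e \<in> space M" shows "integrable (Q e) g"
proof -
  interpret prob_space "Q e" using assms(2) by (rule prob_space_Q)
  show ?thesis
    by (rule integrable_const_bound[where B = 1])
       (use assms in \<open>auto simp: unit_valued_def space_Q measurable_cong_sets[OF sets_Q refl]\<close>)
qed

lemma integral_Q_unit:
  assumes "unit_valued M g" "e \<in> space M" shows "0 \<le> (\<integral>y. g y \<partial>Q e)" "(\<integral>y. g y \<partial>Q e) \<le> 1"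
proof -
  interpret prob_space "Q e" using assms(2) by (rule prob_space_Q)
  show "0 \<le> (\<integral>y. g y \<partial>Q e)"
    by (rule integral_nonneg_AE) (use assms in \<open>auto simp: unit_valued_def space_Q\<close>)
  show "(\<integral>y. g y \<partial>Q e) \<le> 1"
    by (rule integral_le_const[OF integrable_unit[OF assms]])
       (use assms in \<open>auto simp: unit_valued_def space_Q\<close>)
qed

lemma measurable_integral_Q:
  fixes g :: "'c \<Rightarrow> 'a \<Rightarrow> real"
  assumes k: "k \<in> N \<rightarrow>\<^sub>M M" and g: "(\<lambda>(z, y). g z y) \<in> borel_measurable (N \<Otimes>\<^sub>M M)"
    and nn: "\<And>z y. z \<in> space N \<Longrightarrow> y \<in> space M \<Longrightarrow> 0 \<le> g z y"
  shows "(\<lambda>z. \<integral>y. g z y \<partial>Q (k z)) \<in> borel_measurable N"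
proof -
  have "(\<lambda>z. \<integral>\<^sup>+y. ennreal (g z y) \<partial>Q (k z)) \<in> borel_measurable N"
  proof (rule nn_integral_measurable_subprob_algebra2)
    show "(\<lambda>(z, y). ennreal (g z y)) \<in> borel_measurable (N \<Otimes>\<^sub>M M)"
      using measurable_compose[OF g measurable_ennreal] by (simp add: case_prod_beta)
    show "(\<lambda>z. Q (k z)) \<in> N \<rightarrow>\<^sub>M subprob_algebra M"
      by (rule measurable_compose[OF k measurable_prob_algebraD[OF kernel]])
  qed
  then have "(\<lambda>z. enn2real (\<integral>\<^sup>+y. ennreal (g z y) \<partial>Q (k z))) \<in> borel_measurable N"
    by (rule borel_measurable_enn2real)
  then show ?thesis
  proof (rule measurable_cong[THEN iffD1, rotated])
    fix z assume z: "z \<in> space N"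
    then have kz: "k z \<in> space M" by (rule measurable_space[OF k])
    have "g z \<in> borel_measurable (Q (k z))"
      using measurable_Pair2[OF g z] by (simp add: measurable_cong_sets[OF sets_Q[OF kz] refl])
    then show "enn2real (\<integral>\<^sup>+y. ennreal (g z y) \<partial>Q (k z)) = (\<integral>y. g z y \<partial>Q (k z))"
      by (intro integral_eq_nn_integral[symmetric]) (use nn z in \<open>auto simp: space_Q[OF kz]\<close>)
  qed
qed

lemma unit_valued_avg:
  assumes g: "unit_valued M g" shows "unit_valued M (avg g)"
proof -
  have m: "g \<in> borel_measurable M" using g by (simp add: unit_valued_def)
  have "(\<lambda>e. \<integral>y. g y \<partial>Q e) \<in> borel_measurable M"
  proof (rule measurable_integral_Q[where g = "\<lambda>_. g" and k = "\<lambda>e. e", OF measurable_ident_sets[OF refl]])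
    show "(\<lambda>(z, y). g y) \<in> borel_measurable (M \<Otimes>\<^sub>M M)"
      using measurable_compose[OF measurable_snd m, of M] by (simp add: case_prod_beta)
  qed (use g in \<open>simp add: unit_valued_def\<close>)
  then show ?thesis
    using integral_Q_unit[OF g] by (simp add: unit_valued_def avg_def[abs_def])
qed

lemma avg_add:
  assumes "unit_valued M g" "unit_valued M h" "e \<in> space M"
  shows "avg (\<lambda>y. g y + h y) e = avg g e + avg h e"
  unfolding avg_def by (rule Bochner_Integration.integral_add) (use assms integrable_unit in auto)

lemma avg_sum_mult:
  assumes "\<And>k. unit_valued M (g k)" "e \<in> space M"
  shows "avg (\<lambda>y. \<Sum>k\<in>I. g k y * c k) e = (\<Sum>k\<in>I. avg (g k) e * c k)"
  unfolding avg_def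
  by (subst Bochner_Integration.integral_sum) (use assms integrable_unit in \<open>auto\<close>)

lemma avg_const: "e \<in> space M \<Longrightarrow> avg (\<lambda>_. c) e = c"
  using prob_space.prob_space[OF prob_space_Q] by (simp add: avg_def)

lemma avg_mono:
  assumes "unit_valued M g" "unit_valued M h" "e \<in> space M" "\<And>y. y \<in> space M \<Longrightarrow> g y \<le> h y"
  shows "avg g e \<le> avg h e"
  unfolding avg_def
  by (rule integral_mono) (use assms integrable_unit in \<open>auto simp: space_Q\<close>)

lemma avg_cong:
  assumes "e \<in> space M" "\<And>y. y \<in> space M \<Longrightarrow> g y = h y"
  shows "avg g e = avg h e"
  unfolding avg_def by (rule Bochner_Integration.integral_cong) (use assms in \<open>auto simp: space_Q\<close>)

lemma unit_valued_avg_pow: "unit_valued M g \<Longrightarrow> unit_valued M ((avg ^^ n) g)"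
  by (induction n) (auto intro: unit_valued_avg)

end

locale kernel_with_atom = markov_kernel +
  fixes a :: 'a
  assumes a_space: "a \<in> space M" and a_sets: "{a} \<in> sets M"
begin

definition off :: "'a \<Rightarrow> real" where "off e = of_bool (e \<noteq> a)"

text \<open>
  \<open>taboo n g e\<close> is the expectation of \<open>g\<close> at time \<open>n\<close> on the event that the chain started at \<open>e\<close> avoids
  the atom at all times \<open>0, \<dots>, n\<close>.
\<close>

primrec taboo :: "nat \<Rightarrow> ('a \<Rightarrow> real) \<Rightarrow> 'a \<Rightarrow> real" where
  "taboo 0 g e = off e * g e"
| "taboo (Suc n) g e = off e * avg (taboo n g) e"

text \<open>
  The probability that the first visit to the atom, time \<open>0\<close> included, is at time \<open>n\<close>.
\<close>

primrec hit :: "nat \<Rightarrow> 'a \<Rightarrow> real" where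
  "hit 0 e = of_bool (e = a)"
| "hit (Suc n) e = off e * avg (hit n) e"

text \<open>
  The distribution of the return time to the atom; returns at time \<open>0\<close> do not count.
\<close>

definition ret_prob :: "nat \<Rightarrow> real" where
  "ret_prob n = (case n of 0 \<Rightarrow> 0 | Suc k \<Rightarrow> avg (hit k) a)"

text \<open>
  The expectation of \<open>g\<close> at time \<open>n\<close> for the chain started at the atom, on the event of no return up
  to time \<open>n\<close>.
\<close>

definition excursion :: "('a \<Rightarrow> real) \<Rightarrow> nat \<Rightarrow> real" where
  "excursion g n = (case n of 0 \<Rightarrow> g a | Suc k \<Rightarrow> avg (taboo k g) a)"

definition ret_tail :: "nat \<Rightarrow> real" where
  "ret_tail = excursion (\<lambda>_. 1)"

lemma unit_valued_at: "unit_valued M (\<lambda>e. of_bool (e = a))"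
proof -
  have "(\<lambda>e. if e = a then 1 else (0::real)) \<in> borel_measurable M"
    by (rule measurable_If) (use a_sets a_space in \<open>auto simp: Int_def Collect_conv_if conj_commute\<close>)
  also have "(\<lambda>e. if e = a then 1 else (0::real)) = (\<lambda>e. of_bool (e = a))"
    by (simp add: of_bool_def)
  finally show ?thesis by (simp add: unit_valued_def)
qed

lemma unit_valued_off: "unit_valued M off"
proof -
  have "off = (\<lambda>e. 1 - of_bool (e = a))" by (auto simp: off_def)
  then show ?thesis using unit_valued_at by (auto simp: unit_valued_def)
qed

lemma unit_valued_taboo: "unit_valued M g \<Longrightarrow> unit_valued M (taboo n g)"
proof (induction n)
  case 0 then show ?case
    using unit_valued_mult[OF unit_valued_off 0] by simp
next
  case (Suc n) then show ?case
    using unit_valued_mult[OF unit_valued_off unit_valued_avg[OF Suc.IH]] by simp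
qed

lemma unit_valued_hit: "unit_valued M (hit n)"
proof (induction n)
  case 0 then show ?case
    using unit_valued_at by simp
next
  case (Suc n) then show ?case
    using unit_valued_mult[OF unit_valued_off unit_valued_avg[OF Suc.IH]] by simp
qed

lemma taboo_mono:
  assumes "unit_valued M g" "unit_valued M h" "\<And>y. y \<in> space M \<Longrightarrow> g y \<le> h y"
  shows "e \<in> space M \<Longrightarrow> taboo n g e \<le> taboo n h e"
proof (induction n arbitrary: e)
  case 0 then show ?case using assms by (auto simp: off_def)
next
  case (Suc n)
  have "avg (taboo n g) e \<le> avg (taboo n h) e"
    by (rule avg_mono) (use Suc assms unit_valued_taboo in auto)
  then show ?case by (auto simp: off_def)
qed

text \<open>
  Decomposition at the first visit to the atom.
\<close>

lemma avg_pow_first_hit: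
  assumes g: "unit_valued M g"
  shows "e \<in> space M \<Longrightarrow> (avg ^^ n) g e = taboo n g e + (\<Sum>k\<le>n. hit k e * (avg ^^ (n - k)) g a)"
proof (induction n arbitrary: e)
  case 0 then show ?case by (simp add: off_def)
next
  case (Suc n)
  have sumeq: "(\<Sum>k\<le>Suc n. hit k e * (avg ^^ (Suc n - k)) g a)
    = hit 0 e * (avg ^^ Suc n) g a + (\<Sum>k\<le>n. hit (Suc k) e * (avg ^^ (n - k)) g a)"
    by (simp only: sum.atMost_Suc_shift diff_Suc_Suc diff_zero)
  show ?case
  proof (cases "e = a")
    case True
    then show ?thesis unfolding sumeq by (simp add: off_def)
  next
    case False
    have "(avg ^^ Suc n) g e = avg ((avg ^^ n) g) e" by simp
    also have "\<dots> = avg (\<lambda>y. taboo n g y + (\<Sum>k\<le>n. hit k y * (avg ^^ (n - k)) g a)) e"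
      by (rule avg_cong) (use Suc in auto)
    also have "\<dots> = avg (taboo n g) e + avg (\<lambda>y. \<Sum>k\<le>n. hit k y * (avg ^^ (n - k)) g a) e"
      unfolding avg_def
      by (rule Bochner_Integration.integral_add)
         (use Suc.prems integrable_unit unit_valued_taboo[OF g] unit_valued_hit in auto)
    also have "\<dots> = avg (taboo n g) e + (\<Sum>k\<le>n. avg (hit k) e * (avg ^^ (n - k)) g a)"
      by (subst avg_sum_mult) (use Suc.prems unit_valued_hit in auto)
    finally show ?thesis using False
      by (simp add: sumeq off_def del: sum.atMost_Suc)
  qed
qed

text \<open>
  The first-visit decomposition from the second period on is a renewal equation with the return
  time as waiting time.
\<close>

lemma avg_pow_renewal:
  assumes g: "unit_valued M g"
  shows "(avg ^^ n) g a = excursion g n + (\<Sum>j\<le>n. ret_prob j * (avg ^^ (n - j)) g a)"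
proof (cases n)
  case 0 then show ?thesis by (simp add: excursion_def ret_prob_def)
next
  case (Suc n')
  have "(avg ^^ Suc n') g a = avg (\<lambda>y. taboo n' g y + (\<Sum>k\<le>n'. hit k y * (avg ^^ (n' - k)) g a)) a"
    using avg_cong[OF a_space avg_pow_first_hit[OF g]] by simp
  also have "\<dots> = avg (taboo n' g) a + avg (\<lambda>y. \<Sum>k\<le>n'. hit k y * (avg ^^ (n' - k)) g a) a"
    unfolding avg_def
    by (rule Bochner_Integration.integral_add)
       (use a_space integrable_unit unit_valued_taboo[OF g] unit_valued_hit in auto)
  also have "\<dots> = avg (taboo n' g) a + (\<Sum>k\<le>n'. avg (hit k) a * (avg ^^ (n' - k)) g a)"
    by (subst avg_sum_mult) (use a_space unit_valued_hit in auto)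
  also have "\<dots> = excursion g (Suc n') + (\<Sum>j\<le>Suc n'. ret_prob j * (avg ^^ (Suc n' - j)) g a)"
    by (simp add: sum.atMost_Suc_shift excursion_def ret_prob_def del: sum.atMost_Suc)
  finally show ?thesis using Suc by simp
qed

text \<open>
  The renewal sequence: the probability of being at the atom at time \<open>n\<close> after a start there.
\<close>

definition visit :: "nat \<Rightarrow> real" where
  "visit n = (avg ^^ n) (\<lambda>e. of_bool (e = a)) a"

lemma taboo_at_zero: "e \<in> space M \<Longrightarrow> taboo n (\<lambda>e. of_bool (e = a)) e = 0"
proof (induction n arbitrary: e)
  case (Suc n)
  have "avg (taboo n (\<lambda>e. of_bool (e = a))) e = avg (\<lambda>_. 0) e"
    by (rule avg_cong) (use Suc in auto)
  then show ?case using Suc.prems by (simp add: avg_const)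
qed (simp add: off_def)

lemma visit_renewal: "visit n = of_bool (n = 0) + (\<Sum>j\<le>n. ret_prob j * visit (n - j))"
proof -
  have "excursion (\<lambda>e. of_bool (e = a)) n = of_bool (n = 0)"
  proof (cases n)
    case (Suc k)
    have "avg (taboo k (\<lambda>e. of_bool (e = a))) a = avg (\<lambda>_. 0) a"
      by (rule avg_cong) (use a_space taboo_at_zero in auto)
    then show ?thesis using Suc by (simp add: excursion_def avg_const a_space)
  qed (simp add: excursion_def)
  then show ?thesis
    unfolding visit_def by (subst avg_pow_renewal[OF unit_valued_at]) simp
qed

text \<open>
  Decomposition at the last visit to the atom. As power series, both \<open>W = B + \<Phi> * W\<close> and
  \<open>U = 1 + \<Phi> * U\<close>, so \<open>U\<close> inverts \<open>1 - \<Phi>\<close> and \<open>W = B * U\<close>.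
\<close>

lemma avg_pow_last_exit:
  assumes g: "unit_valued M g"
  shows "(avg ^^ n) g a = (\<Sum>j\<le>n. excursion g j * visit (n - j))"
proof -
  define W U \<Phi> B where "W = Abs_fps (\<lambda>n. (avg ^^ n) g a)" and "U = Abs_fps visit"
    and "\<Phi> = Abs_fps ret_prob" and "B = Abs_fps (excursion g)"
  have "W = B + \<Phi> * W"
    by (rule fps_ext) (simp add: W_def B_def \<Phi>_def fps_mult_nth atLeast0AtMost avg_pow_renewal[OF g, symmetric])
  then have W: "(1 - \<Phi>) * W = B" unfolding left_diff_distrib diff_eq_eq mult_1 .
  have "U = 1 + \<Phi> * U"
  proof (rule fps_ext)
    show "fps_nth U n = fps_nth (1 + \<Phi> * U) n" for n
      using visit_renewal[of n] by (simp add: U_def \<Phi>_def fps_mult_nth atLeast0AtMost of_bool_def)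
  qed
  then have U: "(1 - \<Phi>) * U = 1" unfolding left_diff_distrib diff_eq_eq mult_1 .
  have "W = ((1 - \<Phi>) * U) * W" using U by simp
  also have "\<dots> = B * U" using W by (simp add: ac_simps)
  finally have "fps_nth W n = fps_nth (B * U) n" by simp
  then show ?thesis by (simp add: W_def B_def U_def fps_mult_nth atLeast0AtMost)
qed

lemma avg_pow_one: "e \<in> space M \<Longrightarrow> (avg ^^ n) (\<lambda>_. 1) e = 1"
proof (induction n arbitrary: e)
  case (Suc n)
  have "avg ((avg ^^ n) (\<lambda>_. 1)) e = avg (\<lambda>_. 1) e" by (rule avg_cong) (use Suc in auto)
  then show ?case using Suc.prems by (simp add: avg_const)
qed simp

lemma excursion_bounds:
  assumes g: "unit_valued M g"
  shows "0 \<le> excursion g n" "excursion g n \<le> ret_tail n"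
proof -
  show "0 \<le> excursion g n"
    using a_space g unit_valued_avg[OF unit_valued_taboo[OF g]]
    by (auto simp: excursion_def unit_valued_def split: nat.split)
  have 1: "unit_valued M (\<lambda>_. 1)" by (simp add: unit_valued_const)
  have "avg (taboo k g) a \<le> avg (taboo k (\<lambda>_. 1)) a" for k
    by (rule avg_mono[OF unit_valued_taboo[OF g] unit_valued_taboo[OF 1] a_space])
       (rule taboo_mono[OF g 1], use g in \<open>auto simp: unit_valued_def\<close>)
  then show "excursion g n \<le> ret_tail n"
    using g a_space by (auto simp: ret_tail_def excursion_def unit_valued_def split: nat.split)
qed

lemma ret_tail_nonneg: "0 \<le> ret_tail n"
  unfolding ret_tail_def by (rule excursion_bounds) (simp add: unit_valued_const)

lemma ret_prob_nonneg: "0 \<le> ret_prob n"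
  using a_space unit_valued_avg[OF unit_valued_hit] by (auto simp: ret_prob_def unit_valued_def split: nat.split)

lemma visit_bounds: "0 \<le> visit n" "visit n \<le> 1"
  using unit_valued_avg_pow[OF unit_valued_at, of n] a_space by (auto simp: visit_def unit_valued_def)

end

locale ergodic_kernel = kernel_with_atom +
  assumes recurrent: "\<And>e. e \<in> space M \<Longrightarrow> (\<lambda>n. taboo n (\<lambda>_. 1) e) \<longlonglongrightarrow> 0"
    and positive: "summable ret_tail"
    and aperiodic: "Gcd {n. ret_prob n > 0} = 1"
begin

text \<open>
  The mean under the invariant distribution, as the expected sum of \<open>g\<close> over one excursion from the
  atom divided by the expected length of the excursion.
\<close>

definition limit_mean :: "('a \<Rightarrow> real) \<Rightarrow> real" where
  "limit_mean g = suminf (excursion g) / suminf ret_tail"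

lemma mean_return_pos: "suminf ret_tail > 0"
proof (rule suminf_pos2[OF positive ret_tail_nonneg])
  show "0 < ret_tail 0" by (simp add: ret_tail_def excursion_def)
qed

lemma ret_prob_sums: "ret_prob sums 1"
proof -
  have "(\<Sum>j\<le>n. ret_prob j) = 1 - ret_tail n" for n
    using avg_pow_renewal[of "\<lambda>_. 1" n]
    by (simp add: unit_valued_const avg_pow_one a_space ret_tail_def)
  moreover have "(\<lambda>n. 1 - ret_tail n) \<longlonglongrightarrow> 1 - 0"
    by (intro tendsto_intros summable_LIMSEQ_zero positive)
  ultimately show ?thesis by (simp add: sums_def_le)
qed

lemma visit_tendsto: "visit \<longlonglongrightarrow> 1 / suminf ret_tail"
proof (rule renewal_theorem[where \<phi> = ret_prob and r = ret_tail and B = 1])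
  show "visit n = (\<Sum>j\<le>n. ret_prob j * visit (n - j))" if "n \<ge> 1" for n
    using that by (subst visit_renewal) simp
  show "(\<Sum>j\<le>n. ret_tail j * visit (n - j)) = 1" for n
    using avg_pow_last_exit[of "\<lambda>_. 1" n]
    by (simp add: unit_valued_const avg_pow_one a_space ret_tail_def)
  show "\<bar>visit n\<bar> \<le> 1" for n using visit_bounds[of n] by simp
qed (use ret_prob_nonneg ret_prob_sums aperiodic positive ret_tail_nonneg mean_return_pos in auto)

lemma excursion_summable:
  assumes "unit_valued M g" shows "summable (excursion g)"
  by (rule summable_comparison_test'[OF positive]) (use excursion_bounds[OF assms] in auto)

lemma limit_mean_bounds:
  assumes g: "unit_valued M g" shows "0 \<le> limit_mean g" "limit_mean g \<le> 1"
  using mean_return_pos suminf_nonneg[OF excursion_summable[OF g] excursion_bounds(1)[OF g]]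
    suminf_le[OF excursion_bounds(2)[OF g] excursion_summable[OF g] positive]
  by (auto simp: limit_mean_def)

text \<open>
  A bound, common to all test functions, for the distance from equilibrium after \<open>n\<close> periods from a
  start at the atom. The second summand is the part of the excursions that has not been seen.
\<close>

definition atom_error :: "nat \<Rightarrow> real" where
  "atom_error n = (\<Sum>j\<le>n. ret_tail j * \<bar>visit (n - j) - 1 / suminf ret_tail\<bar>)
     + (suminf ret_tail - (\<Sum>j\<le>n. ret_tail j)) / suminf ret_tail"

lemma atom_error_tendsto: "atom_error \<longlonglongrightarrow> 0"
proof -
  have "(\<lambda>n. \<bar>visit n - 1 / suminf ret_tail\<bar>) \<longlonglongrightarrow> \<bar>1 / suminf ret_tail - 1 / suminf ret_tail\<bar>"
    by (intro tendsto_intros visit_tendsto)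
  then have "(\<lambda>n. \<Sum>j\<le>n. ret_tail j * \<bar>visit (n - j) - 1 / suminf ret_tail\<bar>) \<longlonglongrightarrow> 0"
    by (intro convolution_tendsto_0 positive ret_tail_nonneg) simp
  moreover have "(\<lambda>n. (suminf ret_tail - (\<Sum>j\<le>n. ret_tail j)) / suminf ret_tail)
      \<longlonglongrightarrow> (suminf ret_tail - suminf ret_tail) / suminf ret_tail"
    by (intro tendsto_intros summable_LIMSEQ' positive) (use mean_return_pos in auto)
  ultimately show ?thesis
    unfolding atom_error_def[abs_def] using tendsto_add by fastforce
qed

lemma avg_pow_atom_error:
  assumes g: "unit_valued M g"
  shows "\<bar>(avg ^^ n) g a - limit_mean g\<bar> \<le> atom_error n"
proof -
  define m where "m = suminf ret_tail"
  have m: "m > 0" using mean_return_pos by (simp add: m_def)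
  let ?b = "excursion g"
  have split: "suminf f = (\<Sum>j\<le>n. f j) + (\<Sum>j. f (j + Suc n))" if "summable f" for f :: "nat \<Rightarrow> real"
    using suminf_split_initial_segment[OF that, of "Suc n"] by (simp add: lessThan_Suc_atMost)
  have tail: "(\<Sum>j. ?b (j + Suc n)) \<le> (\<Sum>j. ret_tail (j + Suc n))" "0 \<le> (\<Sum>j. ?b (j + Suc n))"
    by (rule suminf_le suminf_nonneg;
        use excursion_bounds[OF g] excursion_summable[OF g] positive in \<open>auto simp: summable_ignore_initial_segment simp del: add_Suc_right\<close>)+
  have decomp: "(avg ^^ n) g a - limit_mean g
      = (\<Sum>j\<le>n. ?b j * (visit (n - j) - 1 / m)) - (\<Sum>j. ?b (j + Suc n)) / m"
    unfolding avg_pow_last_exit[OF g] limit_mean_def m_def[symmetric] split[OF excursion_summable[OF g]]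
    by (simp add: sum_subtractf right_diff_distrib sum_divide_distrib add_divide_distrib)
  have "\<bar>(avg ^^ n) g a - limit_mean g\<bar> \<le> \<bar>\<Sum>j\<le>n. ?b j * (visit (n - j) - 1 / m)\<bar> + \<bar>(\<Sum>j. ?b (j + Suc n)) / m\<bar>"
    unfolding decomp by (rule abs_triangle_ineq4)
  also have "\<dots> \<le> (\<Sum>j\<le>n. ret_tail j * \<bar>visit (n - j) - 1 / m\<bar>) + (\<Sum>j. ret_tail (j + Suc n)) / m"
  proof (rule add_mono)
    have "\<bar>\<Sum>j\<le>n. ?b j * (visit (n - j) - 1 / m)\<bar> \<le> (\<Sum>j\<le>n. \<bar>?b j * (visit (n - j) - 1 / m)\<bar>)"
      by (rule sum_abs)
    also have "\<dots> \<le> (\<Sum>j\<le>n. ret_tail j * \<bar>visit (n - j) - 1 / m\<bar>)"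
      by (intro sum_mono) (use excursion_bounds[OF g] in \<open>auto simp: abs_mult intro!: mult_right_mono\<close>)
    finally show "\<bar>\<Sum>j\<le>n. ?b j * (visit (n - j) - 1 / m)\<bar> \<le> \<dots>" .
    show "\<bar>(\<Sum>j. ?b (j + Suc n)) / m\<bar> \<le> (\<Sum>j. ret_tail (j + Suc n)) / m"
      using tail m by (simp add: divide_right_mono)
  qed
  also have "\<dots> = atom_error n"
    using split[OF positive] by (simp add: atom_error_def m_def)
  finally show ?thesis .
qed

definition mixing_error :: "'a \<Rightarrow> nat \<Rightarrow> real" where
  "mixing_error e n = taboo n (\<lambda>_. 1) e + (\<Sum>k\<le>n. hit k e * atom_error (n - k))"

lemma hit_sum: "e \<in> space M \<Longrightarrow> (\<Sum>k\<le>n. hit k e) = 1 - taboo n (\<lambda>_. 1) e"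
  using avg_pow_first_hit[of "\<lambda>_. 1" e n] by (simp add: unit_valued_const avg_pow_one a_space)

lemma mixing_error_tendsto:
  assumes e: "e \<in> space M" shows "mixing_error e \<longlonglongrightarrow> 0"
proof -
  have "(\<lambda>n. \<Sum>k\<le>n. hit k e) \<longlonglongrightarrow> 1 - 0"
    unfolding hit_sum[OF e] by (intro tendsto_intros recurrent e)
  then have "summable (\<lambda>k. hit k e)" unfolding summable_def sums_def_le by blast
  moreover have "0 \<le> hit k e" for k using unit_valued_hit[of k] e by (simp add: unit_valued_def)
  ultimately have "(\<lambda>n. \<Sum>k\<le>n. hit k e * atom_error (n - k)) \<longlonglongrightarrow> 0"
    by (intro convolution_tendsto_0 atom_error_tendsto)
  then show ?thesis
    unfolding mixing_error_def[abs_def] using tendsto_add[OF recurrent[OF e]] by fastforce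
qed

text \<open>
  Convergence to equilibrium in total variation: the error bound does not depend on \<open>g\<close>.
\<close>

theorem avg_pow_mixing:
  assumes g: "unit_valued M g" and e: "e \<in> space M"
  shows "\<bar>(avg ^^ n) g e - limit_mean g\<bar> \<le> mixing_error e n"
proof -
  let ?L = "limit_mean g" and ?T = "taboo n (\<lambda>_. 1) e"
  have 1: "unit_valued M (\<lambda>_. 1)" by (simp add: unit_valued_const)
  have hit0: "0 \<le> hit k e" for k using unit_valued_hit[of k] e by (simp add: unit_valued_def)
  have T: "0 \<le> taboo n g e" "taboo n g e \<le> ?T" "0 \<le> ?T"
    using unit_valued_taboo[OF g, of n] unit_valued_taboo[OF 1, of n] e g taboo_mono[OF g 1 _ e, of n]
    by (auto simp: unit_valued_def)
  have L: "0 \<le> ?L" "?L \<le> 1" using limit_mean_bounds[OF g] by auto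
  have "(\<Sum>k\<le>n. hit k e * ((avg ^^ (n - k)) g a - ?L))
      = (\<Sum>k\<le>n. hit k e * (avg ^^ (n - k)) g a) - (\<Sum>k\<le>n. hit k e) * ?L"
    by (simp only: right_diff_distrib sum_subtractf sum_distrib_right)
  then have hs: "(\<Sum>k\<le>n. hit k e * ((avg ^^ (n - k)) g a - ?L))
      = (\<Sum>k\<le>n. hit k e * (avg ^^ (n - k)) g a) - (1 - ?T) * ?L"
    by (simp only: hit_sum[OF e])
  have decomp: "(avg ^^ n) g e - ?L = (taboo n g e - ?T * ?L) + (\<Sum>k\<le>n. hit k e * ((avg ^^ (n - k)) g a - ?L))"
    unfolding avg_pow_first_hit[OF g e] hs by (simp add: left_diff_distrib)
  have "\<bar>(avg ^^ n) g e - ?L\<bar> \<le> \<bar>taboo n g e - ?T * ?L\<bar> + \<bar>\<Sum>k\<le>n. hit k e * ((avg ^^ (n - k)) g a - ?L)\<bar>"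
    unfolding decomp by (rule abs_triangle_ineq)
  also have "\<dots> \<le> ?T + (\<Sum>k\<le>n. hit k e * atom_error (n - k))"
  proof (rule add_mono)
    have "0 \<le> ?T * ?L" "?T * ?L \<le> ?T"
      using mult_nonneg_nonneg[OF T(3) L(1)] mult_left_le[OF L(2) T(3)] by auto
    then show "\<bar>taboo n g e - ?T * ?L\<bar> \<le> ?T" using T by linarith
    have "\<bar>\<Sum>k\<le>n. hit k e * ((avg ^^ (n - k)) g a - ?L)\<bar> \<le> (\<Sum>k\<le>n. \<bar>hit k e * ((avg ^^ (n - k)) g a - ?L)\<bar>)"
      by (rule sum_abs)
    also have "\<dots> \<le> (\<Sum>k\<le>n. hit k e * atom_error (n - k))"
      by (intro sum_mono) (use hit0 avg_pow_atom_error[OF g] in \<open>auto simp: abs_mult intro!: mult_left_mono\<close>)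
    finally show "\<bar>\<Sum>k\<le>n. hit k e * ((avg ^^ (n - k)) g a - ?L)\<bar> \<le> \<dots>" .
  qed
  finally show ?thesis by (simp add: mixing_error_def)
qed

end

section \<open>Monotone recursions driven by the chain\<close>

abbreviation asset_space :: "real \<Rightarrow> real \<Rightarrow> real measure" where
  "asset_space lo hi \<equiv> restrict_space borel {lo..hi}"

definition unit_valued2 :: "real set \<Rightarrow> 'a measure \<Rightarrow> (real \<Rightarrow> 'a \<Rightarrow> real) \<Rightarrow> bool" where
  "unit_valued2 X M g \<longleftrightarrow>
     unit_valued (restrict_space borel X \<Otimes>\<^sub>M M) (\<lambda>(x, e). g x e)"

locale monotone_recursion = ergodic_kernel +
  fixes F :: "real \<Rightarrow> 'a \<Rightarrow> real" and lo hi :: real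
  assumes F_meas: "(\<lambda>(x, e). F x e) \<in> asset_space lo hi \<Otimes>\<^sub>M M \<rightarrow>\<^sub>M asset_space lo hi"
    and F_mono: "\<And>x y e. \<lbrakk>lo \<le> x; x \<le> y; y \<le> hi; e \<in> space M\<rbrakk> \<Longrightarrow> F x e \<le> F y e"
    and lo_hi: "lo \<le> hi"
begin

abbreviation "X \<equiv> {lo..hi}"
abbreviation "unit2 \<equiv> unit_valued2 {lo..hi} M"

lemma F_range: "x \<in> X \<Longrightarrow> e \<in> space M \<Longrightarrow> F x e \<in> X"
  using measurable_space[OF F_meas, of "(x, e)"] by (simp add: space_pair_measure space_restrict_space)

lemma unit2_bounds: "unit2 g \<Longrightarrow> x \<in> X \<Longrightarrow> e \<in> space M \<Longrightarrow> 0 \<le> g x e \<and> g x e \<le> 1"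
  by (auto simp: unit_valued2_def unit_valued_def space_pair_measure space_restrict_space)

lemma unit2_section:
  assumes g: "unit2 g" and x: "x \<in> X" shows "unit_valued M (g x)"
proof -
  have "(\<lambda>(x, e). g x e) \<in> borel_measurable (asset_space lo hi \<Otimes>\<^sub>M M)"
    using g by (simp add: unit_valued2_def unit_valued_def)
  then have "(\<lambda>e. (\<lambda>(x, e). g x e) (x, e)) \<in> borel_measurable M"
    by (rule measurable_compose[rotated, OF _ ]) (use x in \<open>auto simp: space_restrict_space intro!: measurable_Pair1'\<close>)
  then show ?thesis using unit2_bounds[OF g x] by (simp add: unit_valued_def)
qed

text \<open>
  The transition operator of the joint chain of state and driving variable.
\<close>

definition step :: "(real \<Rightarrow> 'a \<Rightarrow> real) \<Rightarrow> real \<Rightarrow> 'a \<Rightarrow> real" where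
  "step g x e = avg (g (F x e)) e"

lemma unit2_step:
  assumes g: "unit2 g" shows "unit2 (step g)"
proof -
  let ?N = "asset_space lo hi \<Otimes>\<^sub>M M"
  have m: "(\<lambda>(x, e). g x e) \<in> borel_measurable ?N"
    using g by (simp add: unit_valued2_def unit_valued_def)
  have spN: "space ?N = X \<times> space M" by (simp add: space_pair_measure space_restrict_space)
  have "(\<lambda>z. \<integral>y. g (F (fst z) (snd z)) y \<partial>Q (snd z)) \<in> borel_measurable ?N"
  proof (rule measurable_integral_Q[where g = "\<lambda>z. g (F (fst z) (snd z))" and k = snd])
    have "(\<lambda>p. ((\<lambda>(x, e). F x e) (fst p), snd p)) \<in> ?N \<Otimes>\<^sub>M M \<rightarrow>\<^sub>M ?N"
      by (intro measurable_Pair measurable_compose[OF measurable_fst F_meas] measurable_snd)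
    from measurable_compose[OF this m]
    show "(\<lambda>(z, y). g (F (fst z) (snd z)) y) \<in> borel_measurable (?N \<Otimes>\<^sub>M M)"
      by (simp add: case_prod_beta)
    show "0 \<le> g (F (fst z) (snd z)) y" if "z \<in> space ?N" "y \<in> space M" for z y
      using that unit2_bounds[OF g F_range] by (auto simp: spN)
  qed simp
  moreover have "0 \<le> step g x e \<and> step g x e \<le> 1" if "x \<in> X" "e \<in> space M" for x e
    using unit_valued_avg[OF unit2_section[OF g F_range[OF that]]] that
    by (simp add: step_def unit_valued_def)
  ultimately show ?thesis
    by (auto simp: unit_valued2_def unit_valued_def spN case_prod_beta step_def[abs_def] avg_def[abs_def])
qed

lemma unit2_step_pow: "unit2 g \<Longrightarrow> unit2 ((step ^^ n) g)"
  by (induction n) (auto intro: unit2_step)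

lemma unit2_fst:
  assumes "g \<in> borel_measurable (asset_space lo hi)" "\<And>x. x \<in> X \<Longrightarrow> 0 \<le> g x \<and> g x \<le> 1"
  shows "unit2 (\<lambda>x e. g x)"
  using measurable_compose[OF measurable_fst assms(1), of M] assms(2)
  by (auto simp: unit_valued2_def unit_valued_def case_prod_beta space_pair_measure space_restrict_space)

lemma unit2_snd:
  assumes "unit_valued M h" shows "unit2 (\<lambda>x e. h e)"
  using assms measurable_compose[OF measurable_snd, of h M borel "asset_space lo hi"]
  by (auto simp: unit_valued2_def unit_valued_def case_prod_beta space_pair_measure)

lemma unit2_mult: "unit2 g \<Longrightarrow> unit2 h \<Longrightarrow> unit2 (\<lambda>x e. g x e * h x e)"
  using unit_valued_mult[of "asset_space lo hi \<Otimes>\<^sub>M M" "\<lambda>z. g (fst z) (snd z)" "\<lambda>z. h (fst z) (snd z)"]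
  by (simp add: unit_valued2_def case_prod_unfold)

text \<open>
  The probability that the state, started at \<open>x\<close> with driving variable \<open>e\<close>, is different from \<open>lo\<close> at
  all times \<open>0, \<dots>, t\<close>.
\<close>

primrec away :: "nat \<Rightarrow> real \<Rightarrow> 'a \<Rightarrow> real" where
  "away 0 x e = of_bool (x \<noteq> lo)"
| "away (Suc t) x e = of_bool (x \<noteq> lo) * step (away t) x e"

lemma unit2_neq: "unit2 (\<lambda>x e. of_bool (x \<noteq> lo))"
proof (rule unit2_fst)
  have "(\<lambda>x. of_bool (x \<noteq> lo) :: real) = (\<lambda>x. indicator (- {lo}) x)"
    by (auto simp: indicator_def)
  moreover have "(indicator (- {lo}) :: real \<Rightarrow> real) \<in> borel_measurable borel" by simp
  ultimately show "(\<lambda>x. of_bool (x \<noteq> lo) :: real) \<in> borel_measurable (asset_space lo hi)"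
    by (auto intro: measurable_restrict_space1)
qed auto

lemma unit2_away: "unit2 (away t)"
proof (induction t)
  case 0 then show ?case using unit2_neq by (simp add: away.simps(1)[abs_def])
next
  case (Suc t)
  have "away (Suc t) = (\<lambda>x e. of_bool (x \<noteq> lo) * step (away t) x e)" by (intro ext) simp
  then show ?case using unit2_mult[OF unit2_neq unit2_step[OF Suc]] by simp
qed

lemma away_bounds: "x \<in> X \<Longrightarrow> e \<in> space M \<Longrightarrow> 0 \<le> away t x e \<and> away t x e \<le> 1"
  by (rule unit2_bounds[OF unit2_away])

lemma step_mono:
  assumes "unit2 g" "unit2 h" "x \<in> X" "y \<in> X" "e \<in> space M"
    "\<And>e'. e' \<in> space M \<Longrightarrow> g (F x e) e' \<le> h (F y e) e'"
  shows "step g x e \<le> step h y e"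
  unfolding step_def
  by (rule avg_mono) (use assms unit2_section F_range in auto)

lemma away_mono:
  "\<lbrakk>lo \<le> x; x \<le> y; y \<le> hi; e \<in> space M\<rbrakk> \<Longrightarrow> away t x e \<le> away t y e"
proof (induction t arbitrary: x y e)
  case (Suc t)
  have "step (away t) x e \<le> step (away t) y e"
    by (rule step_mono[OF unit2_away unit2_away])
       (use Suc F_mono[of x y e] F_range[of x e] F_range[of y e] in auto)
  moreover have "0 \<le> step (away t) y e"
    using unit2_bounds[OF unit2_step[OF unit2_away], of y e t] Suc.prems by auto
  ultimately show ?case using Suc.prems by auto
qed auto

lemma away_decseq: "x \<in> X \<Longrightarrow> e \<in> space M \<Longrightarrow> away (Suc t) x e \<le> away t x e"
proof (induction t arbitrary: x e)
  case 0
  then show ?case using unit2_bounds[OF unit2_step[OF unit2_away], of x e 0] by auto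
next
  case (Suc t)
  have "step (away (Suc t)) x e \<le> step (away t) x e"
    by (rule step_mono[OF unit2_away unit2_away]) (use Suc F_range in auto)
  then show ?case by auto
qed

lemma avg_dist_le:
  assumes "unit_valued M g" "unit_valued M h" "unit_valued M k" "e \<in> space M"
    "\<And>y. y \<in> space M \<Longrightarrow> \<bar>g y - h y\<bar> \<le> k y"
  shows "\<bar>avg g e - avg h e\<bar> \<le> avg k e"
proof -
  have "avg g e - avg h e = (\<integral>y. g y - h y \<partial>Q e)"
    unfolding avg_def
    by (rule Bochner_Integration.integral_diff[symmetric]) (use assms integrable_unit in auto)
  also have "\<bar>(\<integral>y. g y - h y \<partial>Q e)\<bar> \<le> (\<integral>y. \<bar>g y - h y\<bar> \<partial>Q e)"
    by (rule integral_abs_bound)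
  also have "\<dots> \<le> avg k e"
    unfolding avg_def
    by (rule integral_mono) (use assms integrable_unit in \<open>auto simp: space_Q\<close>)
  finally show ?thesis .
qed

text \<open>
  The two states are driven by the same path and stay ordered. Once the upper one is at \<open>lo\<close> they
  have merged, so their distributions differ by at most the probability that this has not happened.
\<close>

lemma step_pow_coalesce:
  assumes g: "unit2 g"
  shows "\<lbrakk>lo \<le> x; x \<le> y; y \<le> hi; e \<in> space M\<rbrakk>
    \<Longrightarrow> \<bar>(step ^^ t) g x e - (step ^^ t) g y e\<bar> \<le> away t y e"
proof (induction t arbitrary: x y e)
  case 0
  then show ?case
    using unit2_bounds[OF g, of x e] unit2_bounds[OF g, of y e]
    by (cases "y = lo") auto
next
  case (Suc t)
  show ?case
  proof (cases "y = lo")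
    case True
    then have "x = y" using Suc.prems by simp
    then show ?thesis
      using unit2_bounds[OF unit2_away[of "Suc t"], of y e] Suc.prems by simp
  next
    case False
    have "\<bar>step ((step ^^ t) g) x e - step ((step ^^ t) g) y e\<bar> \<le> step (away t) y e"
      unfolding step_def[of "(step ^^ t) g"] step_def[of "away t"]
      by (rule avg_dist_le)
         (use Suc F_mono[of x y e] F_range[of x e] F_range[of y e] unit2_section[OF unit2_step_pow[OF g]]
            unit2_section[OF unit2_away] in auto)
    then show ?thesis using False by simp
  qed
qed

lemma step_pow_snd: "(step ^^ n) (\<lambda>x e. h e) = (\<lambda>x e. (avg ^^ n) h e)"
  by (induction n) (auto simp: step_def[abs_def])

lemma step_pow_dist_le:
  assumes g: "unit2 g" and g': "unit2 g'" and h: "unit_valued M h"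
    and le: "\<And>x e. x \<in> X \<Longrightarrow> e \<in> space M \<Longrightarrow> \<bar>g x e - g' x e\<bar> \<le> h e"
  shows "\<lbrakk>x \<in> X; e \<in> space M\<rbrakk> \<Longrightarrow> \<bar>(step ^^ n) g x e - (step ^^ n) g' x e\<bar> \<le> (avg ^^ n) h e"
proof (induction n arbitrary: x e)
  case (Suc n)
  have "\<bar>step ((step ^^ n) g) x e - step ((step ^^ n) g') x e\<bar> \<le> avg ((avg ^^ n) h) e"
    unfolding step_def[of "(step ^^ n) g"] step_def[of "(step ^^ n) g'"]
    by (rule avg_dist_le)
       (use Suc F_range unit2_section[OF unit2_step_pow[OF g]] unit2_section[OF unit2_step_pow[OF g']]
         unit_valued_avg_pow[OF h] in auto)
  then show ?case by simp
qed (use le in auto)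

lemma away_le_top: "x \<in> X \<Longrightarrow> e \<in> space M \<Longrightarrow> away t x e \<le> away t hi e"
  by (rule away_mono) auto

definition never :: "real \<Rightarrow> 'a \<Rightarrow> real" where
  "never x e = lim (\<lambda>t. away t x e)"

lemma away_tendsto:
  assumes "x \<in> X" "e \<in> space M" shows "(\<lambda>t. away t x e) \<longlonglongrightarrow> never x e"
proof -
  have "decseq (\<lambda>t. away t x e)" by (rule decseq_SucI) (rule away_decseq[OF assms])
  then have "convergent (\<lambda>t. away t x e)"
    using decseq_convergent[of "\<lambda>t. away t x e" 0] away_bounds[OF assms]
    by (metis convergent_def)
  then show ?thesis unfolding never_def by (simp add: convergent_LIMSEQ_iff)
qed

lemma avg_tendsto:
  assumes u: "\<And>t. unit_valued M (u t)" and w: "w \<in> borel_measurable M" and e: "e \<in> space M"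
    and lim: "\<And>y. y \<in> space M \<Longrightarrow> (\<lambda>t. u t y) \<longlonglongrightarrow> w y"
  shows "(\<lambda>t. avg (u t) e) \<longlonglongrightarrow> avg w e"
proof -
  interpret prob_space "Q e" using e by (rule prob_space_Q)
  show ?thesis
    unfolding avg_def
  proof (rule integral_dominated_convergence[where w = "\<lambda>_. 1"])
    show "AE y in Q e. norm (u t y) \<le> 1" for t
      using u[of t] e by (auto simp: unit_valued_def space_Q)
  qed (use u w lim e in \<open>auto simp: unit_valued_def space_Q measurable_cong_sets[OF sets_Q[OF e] refl]\<close>)
qed

lemma unit2_never: "unit2 never"
proof -
  let ?N = "asset_space lo hi \<Otimes>\<^sub>M M"
  have spN: "space ?N = X \<times> space M" by (simp add: space_pair_measure space_restrict_space)
  have "(\<lambda>z. never (fst z) (snd z)) \<in> borel_measurable ?N"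
  proof (rule borel_measurable_LIMSEQ_real)
    show "(\<lambda>z. away t (fst z) (snd z)) \<in> borel_measurable ?N" for t
      using unit2_away[of t] by (simp add: unit_valued2_def unit_valued_def case_prod_unfold)
    show "(\<lambda>t. away t (fst z) (snd z)) \<longlonglongrightarrow> never (fst z) (snd z)" if "z \<in> space ?N" for z
      using that by (intro away_tendsto) (auto simp: spN)
  qed
  moreover have "0 \<le> never x e \<and> never x e \<le> 1" if "x \<in> X" "e \<in> space M" for x e
    using LIMSEQ_le_const[OF away_tendsto[OF that], of 0] LIMSEQ_le_const2[OF away_tendsto[OF that], of 1]
      away_bounds[OF that] by auto
  ultimately show ?thesis
    by (auto simp: unit_valued2_def unit_valued_def spN case_prod_beta)
qed

lemma never_step:
  assumes "x \<in> X" "e \<in> space M" shows "never x e = of_bool (x \<noteq> lo) * step never x e"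
proof (rule LIMSEQ_unique)
  show "(\<lambda>t. away (Suc t) x e) \<longlonglongrightarrow> never x e"
    using away_tendsto[OF assms] by (rule LIMSEQ_Suc)
  show "(\<lambda>t. away (Suc t) x e) \<longlonglongrightarrow> of_bool (x \<noteq> lo) * step never x e"
    unfolding away.simps step_def
    by (intro tendsto_intros avg_tendsto)
       (use assms F_range unit2_section[OF unit2_away] unit2_section[OF unit2_never] away_tendsto
         in \<open>auto simp: unit_valued_def\<close>)
qed

lemma never_mono: "x \<in> X \<Longrightarrow> e \<in> space M \<Longrightarrow> never x e \<le> never hi e"
  using away_le_top by (intro LIMSEQ_le[OF away_tendsto away_tendsto]) (use lo_hi in auto)

lemma never_le_atom_taboo:
  "e \<in> space M \<Longrightarrow> never hi e \<le> never hi a + taboo n (\<lambda>_. 1) e"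
proof (induction n arbitrary: e)
  case 0
  then show ?case
    using unit2_bounds[OF unit2_never, of hi e] unit2_bounds[OF unit2_never, of hi a] lo_hi a_space
    by (auto simp: off_def)
next
  case (Suc n)
  show ?case
  proof (cases "e = a")
    case True then show ?thesis by (simp add: off_def)
  next
    case False
    have hi: "hi \<in> X" using lo_hi by simp
    have "never hi e \<le> step never hi e"
      using never_step[OF hi Suc.prems] unit2_bounds[OF unit2_step[OF unit2_never] hi Suc.prems]
      by auto
    also have "\<dots> \<le> avg (never hi) e"
      unfolding step_def
      by (rule avg_mono) (use hi Suc.prems F_range unit2_section[OF unit2_never] never_mono in auto)
    also have "\<dots> \<le> (\<integral>y. never hi a + taboo n (\<lambda>_. 1) y \<partial>Q e)"
      unfolding avg_def
      by (rule integral_mono)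
         (use Suc hi unit2_section[OF unit2_never hi] unit_valued_taboo[of "\<lambda>_. 1" n] prob_space_Q[OF Suc.prems]
           in \<open>auto simp: space_Q unit_valued_const intro!: integrable_unit Bochner_Integration.integrable_add finite_measure.integrable_const prob_space.finite_measure\<close>)
    also have "\<dots> = never hi a + avg (taboo n (\<lambda>_. 1)) e"
      using avg_add[of "\<lambda>_. never hi a" "taboo n (\<lambda>_. 1)" e] unit2_bounds[OF unit2_never hi a_space]
        Suc.prems unit_valued_taboo[of "\<lambda>_. 1" n] avg_const[OF Suc.prems]
      by (simp add: avg_def unit_valued_const)
    finally show ?thesis using False by (simp add: off_def)
  qed
qed

text \<open>
  Until the chain visits the atom the state can only fall below \<open>hi\<close>, and the visit happens almost
  surely. So escaping \<open>lo\<close> is most likely from \<open>hi\<close> and the atom.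
\<close>

lemma never_le_atom: "e \<in> space M \<Longrightarrow> never hi e \<le> never hi a"
proof -
  assume e: "e \<in> space M"
  have "(\<lambda>n. never hi a + taboo n (\<lambda>_. 1) e) \<longlonglongrightarrow> never hi a + 0"
    by (intro tendsto_intros recurrent e)
  then show ?thesis
    using never_le_atom_taboo[OF e] by (intro LIMSEQ_le_const) auto
qed

text \<open>
  Escaping \<open>lo\<close> forever means escaping it for \<open>n\<close> periods and then forever, the latter from a
  position that is no better than \<open>hi\<close> and the atom.
\<close>

lemma never_le_away: "\<lbrakk>x \<in> X; e \<in> space M\<rbrakk> \<Longrightarrow> never x e \<le> never hi a * away n x e"
proof (induction n arbitrary: x e)
  case 0
  then show ?case
    using never_mono[OF 0] never_le_atom[OF 0(2)] never_step[OF 0] by auto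
next
  case (Suc n)
  have pos: "0 \<le> never hi a" "never hi a \<le> 1"
    using unit2_bounds[OF unit2_never _ a_space, of hi] lo_hi by auto
  have "step never x e \<le> step (\<lambda>x e. never hi a * away n x e) x e"
    by (rule step_mono[OF unit2_never unit2_mult[OF _ unit2_away]])
       (use Suc F_range pos in \<open>auto intro!: unit2_fst\<close>)
  also have "\<dots> = never hi a * step (away n) x e"
    by (simp add: step_def avg_def)
  finally show ?case
    using never_step[OF Suc.prems] by auto
qed

end

locale resetting_recursion = monotone_recursion +
  assumes reset: "\<exists>n. away n hi a < 1"
begin

text \<open>
  With \<open>q < 1\<close> the probability of avoiding \<open>lo\<close> for \<open>n\<close> periods, the lemma \<open>never_le_away\<close> gives
  \<open>never hi a \<le> never hi a * q\<close>.
\<close>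

lemma never_zero: "e \<in> space M \<Longrightarrow> never hi e = 0"
proof -
  assume e: "e \<in> space M"
  have hi: "hi \<in> X" using lo_hi by simp
  obtain n where n: "away n hi a < 1" using reset by blast
  have nn: "0 \<le> never hi a" "0 \<le> never hi e"
    using unit2_bounds[OF unit2_never hi] a_space e by auto
  have "never hi a \<le> never hi a * away n hi a"
    by (rule never_le_away[OF hi a_space])
  then have "never hi a = 0"
    using n nn mult_less_cancel_left2[of "never hi a" "away n hi a"] by linarith
  then show ?thesis using never_le_atom[OF e] nn by simp
qed

text \<open>
  Since \<open>limit_mean\<close> is a limit, the interchange with \<open>t \<longlonglongrightarrow> \<infinity>\<close> needs uniformity in \<open>t\<close>; the mixing bound
  replaces it by the expectation at one fixed time \<open>s\<close>, where dominated convergence applies.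
\<close>

lemma limit_mean_away_tendsto: "(\<lambda>t. limit_mean (away t hi)) \<longlonglongrightarrow> 0"
proof (rule LIMSEQ_I)
  fix \<epsilon> :: real assume \<epsilon>: "\<epsilon> > 0"
  have hi: "hi \<in> X" using lo_hi by simp
  have "\<forall>\<^sub>F s in sequentially. mixing_error a s < \<epsilon> / 2"
    using order_tendstoD(2)[OF mixing_error_tendsto[OF a_space], of "\<epsilon> / 2"] \<epsilon> by simp
  then obtain s where s: "mixing_error a s < \<epsilon> / 2"
    by (auto simp: eventually_sequentially)
  have lim: "e \<in> space M \<Longrightarrow> (\<lambda>t. (avg ^^ n) (away t hi) e) \<longlonglongrightarrow> 0" for n e
  proof (induction n arbitrary: e)
    case 0 then show ?case using away_tendsto[OF hi] never_zero by auto
  next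
    case (Suc n)
    have "(\<lambda>t. avg ((avg ^^ n) (away t hi)) e) \<longlonglongrightarrow> avg (\<lambda>_. 0) e"
      by (rule avg_tendsto) (use Suc unit_valued_avg_pow[OF unit2_section[OF unit2_away hi]] in auto)
    then show ?case using Suc.prems by (simp add: avg_const)
  qed
  have "\<forall>\<^sub>F t in sequentially. (avg ^^ s) (away t hi) a < \<epsilon> / 2"
    using order_tendstoD(2)[OF lim[OF a_space, of s], of "\<epsilon> / 2"] \<epsilon> by simp
  then have "\<forall>\<^sub>F t in sequentially. norm (limit_mean (away t hi) - 0) < \<epsilon>"
  proof eventually_elim
    case (elim t)
    have u: "unit_valued M (away t hi)" by (rule unit2_section[OF unit2_away hi])
    show ?case
      using elim s avg_pow_mixing[OF u a_space, of s] limit_mean_bounds[OF u] by simp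
  qed
  then show "\<exists>no. \<forall>t\<ge>no. norm (limit_mean (away t hi) - 0) < \<epsilon>"
    by (simp add: eventually_sequentially)
qed

text \<open>
  For times \<open>n = s + t\<close> with \<open>t\<close> fixed: restarting at \<open>lo\<close> at time \<open>s\<close> costs at most the probability of
  not having reached \<open>lo\<close> from \<open>hi\<close> in \<open>t\<close> periods, and after the restart the distribution depends on
  the past only through the driving chain, which mixes as \<open>s \<longlonglongrightarrow> \<infinity>\<close>. The order of quantifiers matters:
  \<open>\<Lambda>\<close> serves all initial values, and \<open>N\<close> all test functions.
\<close>

theorem step_pow_uniform_limit:
  assumes \<epsilon>: "\<epsilon> > 0"
  shows "\<exists>\<Lambda>. \<forall>x\<in>X. \<forall>e\<in>space M. \<exists>N. \<forall>n\<ge>N. \<forall>g. unit2 g \<longrightarrow> \<bar>(step ^^ n) g x e - \<Lambda> g\<bar> < \<epsilon>"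
proof -
  have hi: "hi \<in> X" and lo: "lo \<in> X" using lo_hi by auto
  have "\<forall>\<^sub>F t in sequentially. limit_mean (away t hi) < \<epsilon> / 2"
    using order_tendstoD(2)[OF limit_mean_away_tendsto, of "\<epsilon> / 2"] \<epsilon> by simp
  then obtain t where t: "limit_mean (away t hi) < \<epsilon> / 2"
    by (auto simp: eventually_sequentially)
  have ut: "unit_valued M (away t hi)" by (rule unit2_section[OF unit2_away hi])
  show ?thesis
  proof (intro exI[of _ "\<lambda>g. limit_mean ((step ^^ t) g lo)"] ballI)
    fix x e assume x: "x \<in> X" and e: "e \<in> space M"
    have "\<forall>\<^sub>F s in sequentially. mixing_error e s < \<epsilon> / 4"
      using order_tendstoD(2)[OF mixing_error_tendsto[OF e], of "\<epsilon> / 4"] \<epsilon> by simp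
    then obtain S where S: "\<And>s. s \<ge> S \<Longrightarrow> mixing_error e s < \<epsilon> / 4"
      by (auto simp: eventually_sequentially)
    show "\<exists>N. \<forall>n\<ge>N. \<forall>g. unit2 g \<longrightarrow> \<bar>(step ^^ n) g x e - limit_mean ((step ^^ t) g lo)\<bar> < \<epsilon>"
    proof (intro exI[of _ "S + t"] allI impI)
      fix n g assume n: "n \<ge> S + t" and g: "unit2 g"
      define s where "s = n - t"
      have s: "s \<ge> S" "n = s + t" using n by (auto simp: s_def)
      let ?G = "(step ^^ t) g lo"
      have uG: "unit_valued M ?G" by (rule unit2_section[OF unit2_step_pow[OF g] lo])
      have "\<bar>(step ^^ s) ((step ^^ t) g) x e - (step ^^ s) (\<lambda>x. ?G) x e\<bar> \<le> (avg ^^ s) (away t hi) e"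
      proof (rule step_pow_dist_le[OF unit2_step_pow[OF g] unit2_snd[OF uG] ut _ x e])
        fix x' e' assume x': "x' \<in> X" and e': "e' \<in> space M"
        have "\<bar>(step ^^ t) g lo e' - (step ^^ t) g x' e'\<bar> \<le> away t x' e'"
          by (rule step_pow_coalesce[OF g]) (use x' e' in auto)
        also have "\<dots> \<le> away t hi e'" by (rule away_le_top[OF x' e'])
        finally show "\<bar>(step ^^ t) g x' e' - ?G e'\<bar> \<le> away t hi e'" by simp
      qed
      then have "\<bar>(step ^^ n) g x e - (avg ^^ s) ?G e\<bar> \<le> (avg ^^ s) (away t hi) e"
        by (simp add: s(2) funpow_add step_pow_snd)
      moreover have "\<bar>(avg ^^ s) ?G e - limit_mean ?G\<bar> \<le> mixing_error e s"
        by (rule avg_pow_mixing[OF uG e])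
      moreover have "\<bar>(avg ^^ s) (away t hi) e - limit_mean (away t hi)\<bar> \<le> mixing_error e s"
        by (rule avg_pow_mixing[OF ut e])
      ultimately show "\<bar>(step ^^ n) g x e - limit_mean ?G\<bar> < \<epsilon>"
        using S[OF s(1)] t by linarith
    qed
  qed
qed

end

section \<open>The chain on path space\<close>

locale endowment_chain =
  fixes E :: "real set" and Q :: "real \<Rightarrow> real measure"
  assumes tf: "transition_function E Q"
begin

abbreviation "S \<equiv> state_space E"
abbreviation "hist n \<equiv> PiM {0..<n} (\<lambda>_::nat. S)"

sublocale markov_kernel S Q
  by unfold_locales (use tf in \<open>simp add: transition_function_def\<close>)

lemma space_S: "space S = E"
  by (simp add: space_restrict_space)

lemma sets_chain_law: "e0 \<in> E \<Longrightarrow> sets (chain_law E Q e0) = sets (PiM UNIV (\<lambda>_. S))"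
proof -
  assume "e0 \<in> E"
  then interpret IT: Ionescu_Tulcea "chain_step E Q e0" "\<lambda>_. S"
    by (rule Ionescu_Tulcea_chain_step[OF tf])
  show ?thesis unfolding chain_law_def by simp
qed

lemma space_chain_law: "e0 \<in> E \<Longrightarrow> space (chain_law E Q e0) = space (PiM UNIV (\<lambda>_. S))"
  by (rule sets_eq_imp_space_eq[OF sets_chain_law])

lemma path_in_E: "e0 \<in> E \<Longrightarrow> \<omega> \<in> space (chain_law E Q e0) \<Longrightarrow> \<omega> n \<in> E"
  by (auto simp: space_chain_law space_PiM space_restrict_space PiE_iff)

lemma coord_measurable: "e0 \<in> E \<Longrightarrow> (\<lambda>\<omega>. \<omega> n) \<in> chain_law E Q e0 \<rightarrow>\<^sub>M S"
  by (simp add: measurable_cong_sets[OF sets_chain_law refl])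

lemma restrict_measurable:
  "e0 \<in> E \<Longrightarrow> (\<lambda>\<omega>. restrict \<omega> {0..<n}) \<in> chain_law E Q e0 \<rightarrow>\<^sub>M hist n"
  by (simp add: measurable_cong_sets[OF sets_chain_law refl] measurable_restrict_subset)

lemma prob_space_chain_law: "e0 \<in> E \<Longrightarrow> prob_space (chain_law E Q e0)"
proof -
  assume e0: "e0 \<in> E"
  then interpret IT: Ionescu_Tulcea "chain_step E Q e0" "\<lambda>_. S"
    by (rule Ionescu_Tulcea_chain_step[OF tf])
  show ?thesis
  proof (rule prob_spaceI)
    have "emeasure IT.PF.lim (IT.PF.emb UNIV {} (space (PiM {} (\<lambda>_. S)))) = emeasure (IT.CI {}) (space (PiM {} (\<lambda>_. S)))"
      by (rule IT.lim) auto
    moreover have "IT.PF.emb UNIV {} (space (PiM {} (\<lambda>_. S))) = space IT.PF.lim"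
      by (auto simp: prod_emb_def space_PiM restrict_def)
    moreover have "emeasure (IT.CI {}) (space (PiM {} (\<lambda>_. S))) = 1"
      using prob_space.emeasure_space_1[OF IT.PF.prob_space_P[of "{}"]] IT.PF.space_P[of "{}"] by simp
    ultimately show "emeasure (chain_law E Q e0) (space (chain_law E Q e0)) = 1"
      unfolding chain_law_def by simp
  qed
qed

text \<open>
  The path space measure is a projective limit. Its marginal on the first \<open>k + 1\<close> coordinates extends
  the marginal on the first \<open>k\<close> by one draw from the transition function.
\<close>

lemma nn_integral_chain_law_Suc:
  fixes f :: "(nat \<Rightarrow> real) \<Rightarrow> ennreal"
  assumes e0: "e0 \<in> E" and f: "f \<in> borel_measurable (hist (Suc k))"
  shows "(\<integral>\<^sup>+\<omega>. f (restrict \<omega> {0..<Suc k}) \<partial>chain_law E Q e0)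
    = (\<integral>\<^sup>+\<omega>. (\<integral>\<^sup>+y. f (fun_upd (restrict \<omega> {0..<k}) k y)
        \<partial>chain_step E Q e0 k (restrict \<omega> {0..<k})) \<partial>chain_law E Q e0)"
proof -
  interpret IT: Ionescu_Tulcea "chain_step E Q e0" "\<lambda>_. S"
    by (rule Ionescu_Tulcea_chain_step[OF tf e0])
  let ?P = "chain_law E Q e0"
  let ?u = "\<lambda>_. undefined"
  have u: "?u \<in> space (PiM {0..<0::nat} (\<lambda>_. S))" by (simp add: space_PiM)
  have marginal: "distr ?P (hist k) (\<lambda>\<omega>. restrict \<omega> {0..<k}) = IT.C 0 k ?u" for k
  proof (rule measure_eqI)
    show "sets (distr ?P (hist k) (\<lambda>\<omega>. restrict \<omega> {0..<k})) = sets (IT.C 0 k ?u)"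
      using IT.sets_C[OF u, of k] by simp
    fix A assume "A \<in> sets (distr ?P (hist k) (\<lambda>\<omega>. restrict \<omega> {0..<k}))"
    then have A: "A \<in> sets (hist k)" by simp
    have "emeasure (distr ?P (hist k) (\<lambda>\<omega>. restrict \<omega> {0..<k})) A
        = emeasure ?P ((\<lambda>\<omega>. restrict \<omega> {0..<k}) -` A \<inter> space ?P)"
      by (rule emeasure_distr[OF restrict_measurable[OF e0] A])
    also have "(\<lambda>\<omega>. restrict \<omega> {0..<k}) -` A \<inter> space ?P = IT.PF.emb UNIV {0..<k} A"
      by (auto simp: space_chain_law[OF e0] prod_emb_def space_PiM)
    also have "emeasure ?P \<dots> = emeasure (IT.CI {0..<k}) A"
      unfolding chain_law_def by (rule IT.lim[OF _ A]) simp
    also have "\<dots> = emeasure (IT.C 0 k ?u) (IT.PF.emb {0..<k} {0..<k} A)"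
      by (rule IT.emeasure_CI[OF _ A]) simp
    also have "IT.PF.emb {0..<k} {0..<k} A = A"
      using sets.sets_into_space[OF A] by (auto simp: prod_emb_def space_PiM)
    finally show "emeasure (distr ?P (hist k) (\<lambda>\<omega>. restrict \<omega> {0..<k})) A = emeasure (IT.C 0 k ?u) A" .
  qed
  have via: "(\<integral>\<^sup>+\<omega>. f (restrict \<omega> {0..<k}) \<partial>?P) = (\<integral>\<^sup>+\<omega>. f \<omega> \<partial>IT.C 0 k ?u)"
    if "f \<in> borel_measurable (hist k)" for f k
    unfolding marginal[symmetric]
    by (rule nn_integral_distr[symmetric, OF restrict_measurable[OF e0]]) (simp add: that)
  define h where "h \<omega> = (\<integral>\<^sup>+\<omega>'. f \<omega>' \<partial>IT.eP k \<omega>)" for \<omega>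
  have h: "h \<in> borel_measurable (hist k)"
    unfolding h_def
    by (rule measurable_compose[OF IT.measurable_eP nn_integral_measurable_subprob_algebra[OF f]])
  have "(\<integral>\<^sup>+\<omega>. f (restrict \<omega> {0..<Suc k}) \<partial>?P) = (\<integral>\<^sup>+\<omega>. f \<omega> \<partial>IT.C 0 (Suc k) ?u)"
    by (rule via[OF f])
  also have "\<dots> = (\<integral>\<^sup>+\<omega>. h \<omega> \<partial>IT.C 0 k ?u)"
    unfolding IT.C.simps add_0 h_def
    by (rule nn_integral_bind[OF f])
       (use IT.measurable_eP[of k] in \<open>simp add: measurable_cong_sets[OF IT.sets_C[OF u, of k] refl]\<close>)
  also have "\<dots> = (\<integral>\<^sup>+\<omega>. h (restrict \<omega> {0..<k}) \<partial>?P)"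
    by (rule via[OF h, symmetric])
  also have "\<dots> = (\<integral>\<^sup>+\<omega>. (\<integral>\<^sup>+y. f (fun_upd (restrict \<omega> {0..<k}) k y)
        \<partial>chain_step E Q e0 k (restrict \<omega> {0..<k})) \<partial>?P)"
    unfolding h_def
    by (intro nn_integral_cong IT.nn_integral_eP[OF _ f] measurable_space[OF restrict_measurable[OF e0]])
  finally show ?thesis .
qed

lemma nn_integral_chain_initial:
  assumes e0: "e0 \<in> E" and f: "f \<in> borel_measurable S"
  shows "(\<integral>\<^sup>+\<omega>. f (\<omega> 0) \<partial>chain_law E Q e0) = f e0"
proof -
  interpret prob_space "chain_law E Q e0" by (rule prob_space_chain_law[OF e0])
  have m: "(\<lambda>\<omega>. f (\<omega> 0)) \<in> borel_measurable (hist (Suc 0))"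
    by (rule measurable_compose[OF _ f], rule measurable_component_singleton) simp
  show ?thesis
    using nn_integral_chain_law_Suc[OF e0 m] e0 f
    by (simp add: chain_step_def nn_integral_return space_S emeasure_space_1)
qed

lemma nn_integral_chain_markov:
  fixes \<psi> :: "(nat \<Rightarrow> real) \<Rightarrow> real \<Rightarrow> ennreal"
  assumes e0: "e0 \<in> E"
    and \<psi>: "(\<lambda>(\<omega>, y). \<psi> \<omega> y) \<in> borel_measurable (hist (Suc n) \<Otimes>\<^sub>M S)"
  shows "(\<integral>\<^sup>+\<omega>. \<psi> (restrict \<omega> {0..<Suc n}) (\<omega> (Suc n)) \<partial>chain_law E Q e0)
    = (\<integral>\<^sup>+\<omega>. (\<integral>\<^sup>+y. \<psi> (restrict \<omega> {0..<Suc n}) y \<partial>Q (\<omega> n)) \<partial>chain_law E Q e0)"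
proof -
  define f where "f \<omega> = \<psi> (restrict \<omega> {0..<Suc n}) (\<omega> (Suc n))" for \<omega>
  have f: "f \<in> borel_measurable (hist (Suc (Suc n)))"
  proof -
    have "(\<lambda>\<omega>. (restrict \<omega> {0..<Suc n}, \<omega> (Suc n))) \<in> hist (Suc (Suc n)) \<rightarrow>\<^sub>M hist (Suc n) \<Otimes>\<^sub>M S"
      by (intro measurable_Pair measurable_restrict_subset measurable_component_singleton) auto
    from measurable_compose[OF this \<psi>] show ?thesis by (simp add: f_def[abs_def])
  qed
  have "restrict (fun_upd (restrict \<omega> {0..<Suc n}) (Suc n) y) {0..<Suc n} = restrict \<omega> {0..<Suc n}"
    for \<omega> :: "nat \<Rightarrow> real" and y
    by (auto simp: restrict_def)
  then show ?thesis
    using nn_integral_chain_law_Suc[OF e0 f]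
    by (simp add: f_def chain_step_def Int_absorb1 del: fun_upd_apply) (simp add: fun_upd_apply)
qed

lemma nn_integral_Q:
  assumes "unit_valued S g" "e \<in> E"
  shows "(\<integral>\<^sup>+y. ennreal (g y) \<partial>Q e) = ennreal (avg g e)"
  unfolding avg_def
  by (rule nn_integral_eq_integral[OF integrable_unit])
     (use assms in \<open>auto simp: space_S unit_valued_def space_Q\<close>)

end

locale endowment_chain_with_atom = endowment_chain +
  fixes a :: real
  assumes a_in_E: "a \<in> E"
begin

sublocale kernel_with_atom S Q a
proof unfold_locales
  show "a \<in> space S" using a_in_E by (simp add: space_S)
  show "{a} \<in> sets S"
    using a_in_E by (auto simp: sets_restrict_space image_iff intro!: bexI[of _ "{a}"])
qed

text \<open>
  One transition, losing the paths that land on the atom. Powers of this operator compute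
  expectations of functions that only depend on the last coordinate and on avoiding the atom, and
  they can be unfolded at the last period, as the path space measure is built, or at the first, as
  the recursions for \<open>taboo\<close> and \<open>excursion\<close> are.
\<close>

definition killed :: "(real \<Rightarrow> real) \<Rightarrow> real \<Rightarrow> real" where
  "killed g e = avg (\<lambda>y. off y * g y) e"

lemma unit_valued_killed: "unit_valued S g \<Longrightarrow> unit_valued S (killed g)"
  unfolding killed_def[abs_def] by (intro unit_valued_avg unit_valued_mult unit_valued_off)

lemma nn_integral_killed:
  assumes e0: "e0 \<in> E" and h: "unit_valued S h"
  shows "unit_valued S g \<Longrightarrow>
    (\<integral>\<^sup>+\<omega>. ennreal (h (\<omega> 0) * (\<Prod>i\<in>{1..n}. off (\<omega> i)) * g (\<omega> n)) \<partial>chain_law E Q e0)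
      = ennreal (h e0 * (killed ^^ n) g e0)"
proof (induction n arbitrary: g)
  case 0
  have "(\<lambda>e. ennreal (h e * g e)) \<in> borel_measurable S"
    using h 0 by (auto simp: unit_valued_def)
  from nn_integral_chain_initial[OF e0 this] show ?case by simp
next
  case (Suc n)
  define w where "w \<omega> = h (\<omega> 0) * (\<Prod>i\<in>{1..n}. off (\<omega> i))" for \<omega> :: "nat \<Rightarrow> real"
  define \<psi> where "\<psi> \<omega> y = ennreal (w \<omega> * (off y * g y))" for \<omega> :: "nat \<Rightarrow> real" and y
  have og: "unit_valued S (\<lambda>y. off y * g y)" by (rule unit_valued_mult[OF unit_valued_off Suc.prems])
  have wr: "w (restrict \<omega> {0..<Suc n}) = w \<omega>" for \<omega>
    unfolding w_def by (auto intro!: arg_cong2[where f="(*)"] prod.cong)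
  have coord: "(\<lambda>\<omega>. \<omega> i) \<in> hist (Suc n) \<rightarrow>\<^sub>M S" if "i \<le> n" for i
    by (rule measurable_component_singleton) (use that in auto)
  have w_meas: "w \<in> borel_measurable (hist (Suc n))"
    unfolding w_def
    by (intro borel_measurable_times borel_measurable_prod measurable_compose[OF coord])
       (use h unit_valued_off in \<open>auto simp: unit_valued_def\<close>)
  have \<psi>_meas: "(\<lambda>(\<omega>, y). \<psi> \<omega> y) \<in> borel_measurable (hist (Suc n) \<Otimes>\<^sub>M S)"
  proof -
    have "(\<lambda>y. off y * g y) \<in> borel_measurable S" using og by (simp add: unit_valued_def)
    then have "(\<lambda>p. w (fst p) * (off (snd p) * g (snd p))) \<in> borel_measurable (hist (Suc n) \<Otimes>\<^sub>M S)"
      by (intro borel_measurable_times[OF measurable_compose[OF measurable_fst w_meas]])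
         (rule measurable_compose[OF measurable_snd])
    from measurable_compose[OF this measurable_ennreal] show ?thesis
      by (simp add: \<psi>_def case_prod_beta)
  qed
  have w_nn: "0 \<le> w \<omega>" if "\<omega> \<in> space (chain_law E Q e0)" for \<omega>
    unfolding w_def using path_in_E[OF e0 that] h unit_valued_off
    by (intro mult_nonneg_nonneg prod_nonneg) (auto simp: unit_valued_def space_S)
  have "(\<integral>\<^sup>+\<omega>. ennreal (h (\<omega> 0) * (\<Prod>i\<in>{1..Suc n}. off (\<omega> i)) * g (\<omega> (Suc n))) \<partial>chain_law E Q e0)
    = (\<integral>\<^sup>+\<omega>. \<psi> (restrict \<omega> {0..<Suc n}) (\<omega> (Suc n)) \<partial>chain_law E Q e0)"
    by (simp add: \<psi>_def wr) (simp add: w_def ac_simps)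
  also have "\<dots> = (\<integral>\<^sup>+\<omega>. (\<integral>\<^sup>+y. \<psi> (restrict \<omega> {0..<Suc n}) y \<partial>Q (\<omega> n)) \<partial>chain_law E Q e0)"
    by (rule nn_integral_chain_markov[OF e0 \<psi>_meas])
  also have "\<dots> = (\<integral>\<^sup>+\<omega>. ennreal (w \<omega> * killed g (\<omega> n)) \<partial>chain_law E Q e0)"
  proof (rule nn_integral_cong)
    fix \<omega> assume \<omega>: "\<omega> \<in> space (chain_law E Q e0)"
    have \<omega>n: "\<omega> n \<in> E" by (rule path_in_E[OF e0 \<omega>])
    have nn: "0 \<le> off y * g y" if "y \<in> E" for y
      using og that by (simp add: unit_valued_def space_S)
    have "(\<integral>\<^sup>+y. \<psi> (restrict \<omega> {0..<Suc n}) y \<partial>Q (\<omega> n)) = (\<integral>\<^sup>+y. ennreal (w \<omega>) * ennreal (off y * g y) \<partial>Q (\<omega> n))"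
      by (rule nn_integral_cong)
         (use \<omega>n w_nn[OF \<omega>] nn in \<open>auto simp: \<psi>_def wr space_Q space_S simp flip: ennreal_mult\<close>)
    also have "\<dots> = ennreal (w \<omega>) * (\<integral>\<^sup>+y. ennreal (off y * g y) \<partial>Q (\<omega> n))"
      by (rule nn_integral_cmult)
         (use og \<omega>n in \<open>auto simp: unit_valued_def measurable_cong_sets[OF sets_Q refl] space_S\<close>)
    also have "\<dots> = ennreal (w \<omega>) * ennreal (killed g (\<omega> n))"
      by (simp add: nn_integral_Q[OF og \<omega>n] killed_def)
    also have "\<dots> = ennreal (w \<omega> * killed g (\<omega> n))"
      using w_nn[OF \<omega>] unit_valued_killed[OF Suc.prems] \<omega>n
      by (simp add: ennreal_mult unit_valued_def space_S)
    finally show "(\<integral>\<^sup>+y. \<psi> (restrict \<omega> {0..<Suc n}) y \<partial>Q (\<omega> n)) = ennreal (w \<omega> * killed g (\<omega> n))" .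
  qed
  also have "\<dots> = ennreal (h e0 * (killed ^^ n) (killed g) e0)"
    unfolding w_def by (rule Suc.IH[OF unit_valued_killed[OF Suc.prems]])
  finally show ?case by (simp add: funpow_swap1)
qed

lemma taboo_killed: "taboo n g e = off e * (killed ^^ n) g e"
proof (induction n arbitrary: e)
  case (Suc n)
  have "taboo n g = (\<lambda>e. off e * (killed ^^ n) g e)" by (intro ext Suc.IH)
  then show ?case by (simp add: killed_def[of "(killed ^^ n) g"])
qed simp

lemma excursion_killed: "excursion g n = (killed ^^ n) g a"
proof (cases n)
  case (Suc k)
  have "taboo k g = (\<lambda>e. off e * (killed ^^ k) g e)" by (intro ext taboo_killed)
  then show ?thesis using Suc by (simp add: excursion_def killed_def)
qed (simp add: excursion_def)

lemma prod_off: "finite I \<Longrightarrow> (\<Prod>i\<in>I. off (\<omega> i)) = of_bool (\<forall>i\<in>I. \<omega> i \<noteq> a)"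
  by (induction I rule: finite_induct) (auto simp: off_def)

lemma sets_coord: "e0 \<in> E \<Longrightarrow> {\<omega> \<in> space (chain_law E Q e0). \<omega> i = a} \<in> sets (chain_law E Q e0)"
  using measurable_sets[OF coord_measurable a_sets, of e0 i] by (simp add: vimage_def Int_def conj_commute)

lemma sets_avoid: "e0 \<in> E \<Longrightarrow> finite I \<Longrightarrow>
    {\<omega> \<in> space (chain_law E Q e0). \<forall>i\<in>I. \<omega> i \<noteq> a} \<in> sets (chain_law E Q e0)"
  by (intro sets.sets_Collect_finite_All sets.sets_Collect_neg sets_coord) auto

lemma taboo_eq_prob:
  assumes e0: "e0 \<in> E"
  shows "taboo n (\<lambda>_. 1) e0 = measure (chain_law E Q e0) {\<omega> \<in> space (chain_law E Q e0). \<forall>i\<in>{..n}. \<omega> i \<noteq> a}"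
proof -
  interpret prob_space "chain_law E Q e0" by (rule prob_space_chain_law[OF e0])
  let ?A = "{\<omega> \<in> space (chain_law E Q e0). \<forall>i\<in>{..n}. \<omega> i \<noteq> a}"
  have 1: "unit_valued S (\<lambda>_. 1)" by (simp add: unit_valued_const)
  have "ennreal (taboo n (\<lambda>_. 1) e0)
      = (\<integral>\<^sup>+\<omega>. ennreal (off (\<omega> 0) * (\<Prod>i\<in>{1..n}. off (\<omega> i)) * 1) \<partial>chain_law E Q e0)"
    unfolding taboo_killed by (rule nn_integral_killed[OF e0 unit_valued_off 1, symmetric])
  also have "\<dots> = (\<integral>\<^sup>+\<omega>. indicator ?A \<omega> \<partial>chain_law E Q e0)"
  proof (rule nn_integral_cong)
    fix \<omega> assume \<omega>: "\<omega> \<in> space (chain_law E Q e0)"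
    have "off (\<omega> 0) * (\<Prod>i\<in>{1..n}. off (\<omega> i)) = (\<Prod>i\<in>{..n}. off (\<omega> i))"
      by (subst prod.atMost_shift) (simp add: prod.atLeast1_atMost_eq lessThan_Suc_atMost)
    then show "ennreal (off (\<omega> 0) * (\<Prod>i\<in>{1..n}. off (\<omega> i)) * 1) = indicator ?A \<omega>"
      using \<omega> by (simp add: prod_off indicator_def)
  qed
  also have "\<dots> = ennreal (prob ?A)"
    using sets_avoid[OF e0, of "{..n}"] by (simp add: emeasure_eq_measure)
  finally show ?thesis
    using unit_valued_taboo[OF 1, of n] e0 by (simp add: unit_valued_def space_S)
qed

lemma ret_tail_eq_prob:
  "ret_tail n = measure (chain_law E Q a) {\<omega> \<in> space (chain_law E Q a). \<forall>i\<in>{1..n}. \<omega> i \<noteq> a}"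
proof -
  interpret prob_space "chain_law E Q a" by (rule prob_space_chain_law[OF a_in_E])
  let ?A = "{\<omega> \<in> space (chain_law E Q a). \<forall>i\<in>{1..n}. \<omega> i \<noteq> a}"
  have 1: "unit_valued S (\<lambda>_. 1)" by (simp add: unit_valued_const)
  have "ennreal (ret_tail n) = (\<integral>\<^sup>+\<omega>. ennreal (1 * (\<Prod>i\<in>{1..n}. off (\<omega> i)) * 1) \<partial>chain_law E Q a)"
    using nn_integral_killed[OF a_in_E 1 1, of n] by (simp add: ret_tail_def excursion_killed)
  also have "\<dots> = (\<integral>\<^sup>+\<omega>. indicator ?A \<omega> \<partial>chain_law E Q a)"
    by (rule nn_integral_cong) (simp add: prod_off indicator_def)
  also have "\<dots> = ennreal (prob ?A)"
    using sets_avoid[OF a_in_E, of "{1..n}"] by (simp add: emeasure_eq_measure)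
  finally show ?thesis using ret_tail_nonneg[of n] by simp
qed

lemma ret_prob_eq_prob:
  "ret_prob (Suc n) = measure (chain_law E Q a)
     {\<omega> \<in> space (chain_law E Q a). (\<forall>i\<in>{1..n}. \<omega> i \<noteq> a) \<and> \<omega> (Suc n) = a}"
proof -
  interpret prob_space "chain_law E Q a" by (rule prob_space_chain_law[OF a_in_E])
  let ?A = "{\<omega> \<in> space (chain_law E Q a). (\<forall>i\<in>{1..n}. \<omega> i \<noteq> a) \<and> \<omega> (Suc n) = a}"
  let ?B = "{\<omega> \<in> space (chain_law E Q a). \<forall>i\<in>{1..n}. \<omega> i \<noteq> a}"
  let ?C = "{\<omega> \<in> space (chain_law E Q a). \<forall>i\<in>{1..Suc n}. \<omega> i \<noteq> a}"
  have ret: "ret_tail n = ret_prob (Suc n) + ret_tail (Suc n)"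
  proof -
    have 1: "unit_valued S (\<lambda>_. 1)" by (simp add: unit_valued_const)
    have "(\<Sum>j\<le>k. ret_prob j) = 1 - ret_tail k" for k
      using avg_pow_renewal[OF 1, of k] a_in_E by (simp add: avg_pow_one space_S ret_tail_def)
    from this[of n] this[of "Suc n"] show ?thesis by simp
  qed
  have "?B = ?A \<union> ?C"
    by (auto simp: atLeastAtMostSuc_conv)
  moreover have "?A \<inter> ?C = {}" by auto
  moreover have "?A \<in> events"
    using sets.Int[OF sets_avoid[OF a_in_E, of "{1..n}"] sets_coord[OF a_in_E, of "Suc n"]]
    by (simp add: Collect_conj_eq Int_assoc Int_left_commute)
  ultimately have "prob ?B = prob ?A + prob ?C"
    using sets_avoid[OF a_in_E, of "{1..Suc n}"] by (simp add: finite_measure_Union)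
  then show ?thesis using ret unfolding ret_tail_eq_prob by simp
qed

lemma return_time_gt: "enat n < return_time a \<omega> \<longleftrightarrow> (\<forall>i\<in>{1..n}. \<omega> i \<noteq> a)"
proof -
  have "return_time a \<omega> \<le> enat n \<longleftrightarrow> (\<exists>i\<in>{1..n}. \<omega> i = a)"
  proof
    assume le: "return_time a \<omega> \<le> enat n"
    have "enat ` {t. 1 \<le> t \<and> \<omega> t = a} \<noteq> {}"
    proof
      assume "enat ` {t. 1 \<le> t \<and> \<omega> t = a} = {}"
      then have "return_time a \<omega> = Inf {}" by (simp only: return_time_def)
      then show False using le by (simp add: top_enat_def)
    qed
    then have "return_time a \<omega> \<in> enat ` {t. 1 \<le> t \<and> \<omega> t = a}"
      unfolding return_time_def by (metis ex_in_conv wellorder_InfI)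
    then show "\<exists>i\<in>{1..n}. \<omega> i = a" using le by auto
  next
    assume "\<exists>i\<in>{1..n}. \<omega> i = a"
    then obtain i where i: "1 \<le> i" "i \<le> n" "\<omega> i = a" by auto
    then have "return_time a \<omega> \<le> enat i" unfolding return_time_def by (intro Inf_lower) auto
    also have "\<dots> \<le> enat n" using i by simp
    finally show "return_time a \<omega> \<le> enat n" .
  qed
  then show ?thesis by (auto simp: not_le[symmetric])
qed

lemma return_time_eq: "return_time a \<omega> = enat (Suc n) \<longleftrightarrow> (\<forall>i\<in>{1..n}. \<omega> i \<noteq> a) \<and> \<omega> (Suc n) = a"
proof -
  have "return_time a \<omega> = enat (Suc n) \<longleftrightarrow> enat n < return_time a \<omega> \<and> \<not> enat (Suc n) < return_time a \<omega>"
    by (cases "return_time a \<omega>") auto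
  then show ?thesis unfolding return_time_gt by (auto simp: atLeastAtMostSuc_conv)
qed

lemma return_time_pos: "return_time a \<omega> \<noteq> enat 0"
  using return_time_gt[of 0 \<omega>] by auto

text \<open>
  The hypotheses on hitting and return times speak of the path space; the three conditions of the
  kernel formulation follow from the path space meaning of \<open>taboo\<close>, \<open>ret_tail\<close> and \<open>ret_prob\<close>.
  The mean return time is the sum of the tail probabilities.
\<close>

lemma ergodic:
  assumes "aperiodic_positive_recurrent_atom E Q a"
  shows "ergodic_kernel S Q a"
proof unfold_locales
  fix e assume "e \<in> space S"
  then have e: "e \<in> E" by (simp add: space_S)
  interpret prob_space "chain_law E Q e" by (rule prob_space_chain_law[OF e])
  define A where "A n = {\<omega> \<in> space (chain_law E Q e). \<forall>i\<in>{..n}. \<omega> i \<noteq> a}" for n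
  have A: "A n \<in> events" for n unfolding A_def by (rule sets_avoid[OF e]) simp
  have "AE \<omega> in chain_law E Q e. hitting_time a \<omega> < \<infinity>"
    using assms e by (simp add: aperiodic_positive_recurrent_atom_def)
  then have "AE \<omega> in chain_law E Q e. \<omega> \<notin> (\<Inter>n. A n)"
  proof eventually_elim
    case (elim \<omega>)
    have "{t. \<omega> t = a} \<noteq> {}"
    proof
      assume "{t. \<omega> t = a} = {}"
      then have "hitting_time a \<omega> = Inf {}" by (simp only: hitting_time_def image_empty)
      then show False using elim by (simp add: top_enat_def)
    qed
    then show ?case by (auto simp: A_def)
  qed
  then have "prob (\<Inter>n. A n) = 0"
    using A by (intro prob_eq_0[THEN iffD2]) auto
  moreover have "(\<lambda>n. prob (A n)) \<longlonglongrightarrow> prob (\<Inter>n. A n)"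
    by (rule finite_Lim_measure_decseq) (use A in \<open>auto simp: decseq_def A_def\<close>)
  ultimately show "(\<lambda>n. taboo n (\<lambda>_. 1) e) \<longlonglongrightarrow> 0"
    by (simp only: taboo_eq_prob[OF e] A_def)
next
  interpret prob_space "chain_law E Q a" by (rule prob_space_chain_law[OF a_in_E])
  define A where "A n = {\<omega> \<in> space (chain_law E Q a). \<forall>i\<in>{1..n}. \<omega> i \<noteq> a}" for n
  have A: "A n \<in> events" for n unfolding A_def by (rule sets_avoid[OF a_in_E]) simp
  define I where "I = (\<integral>\<^sup>+\<omega>. ennreal_of_enat (return_time a \<omega>) \<partial>chain_law E Q a)"
  have I: "I < \<infinity>" using assms by (simp add: aperiodic_positive_recurrent_atom_def I_def)
  have bound: "(\<Sum>n<N. ret_tail n) \<le> enn2real I" for N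
  proof -
    have "ennreal (\<Sum>n<N. ret_tail n) = (\<Sum>n<N. emeasure (chain_law E Q a) (A n))"
      by (simp add: ret_tail_eq_prob A_def emeasure_eq_measure)
    also have "\<dots> = (\<integral>\<^sup>+\<omega>. (\<Sum>n<N. indicator (A n) \<omega>) \<partial>chain_law E Q a)"
      using A by (subst nn_integral_sum) auto
    also have "\<dots> \<le> I"
      unfolding I_def
    proof (rule nn_integral_mono)
      fix \<omega> assume \<omega>: "\<omega> \<in> space (chain_law E Q a)"
      have ind: "indicator (A n) \<omega> = (if enat n < return_time a \<omega> then 1 else 0 :: ennreal)" for n
        using \<omega> return_time_gt[of n \<omega>] by (auto simp: A_def)
      show "(\<Sum>n<N. indicator (A n) \<omega>) \<le> ennreal_of_enat (return_time a \<omega>)"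
      proof (cases "return_time a \<omega>")
        case (enat k)
        have "(\<Sum>n<N. indicator (A n) \<omega> :: ennreal) = of_nat (card {n. n < N \<and> n < k})"
          unfolding ind enat by (simp add: sum.If_cases Int_def lessThan_def)
        also have "\<dots> \<le> of_nat (card {..<k})"
          by (intro of_nat_mono card_mono) auto
        finally show ?thesis using enat by simp
      next
        case infinity
        then show ?thesis by simp
      qed
    qed
    finally have "ennreal (\<Sum>n<N. ret_tail n) \<le> I" .
    then show ?thesis
      using I by (simp add: ennreal_le_iff[symmetric] less_top del: ennreal_le_iff)
  qed
  show "summable ret_tail"
    by (rule summableI_nonneg_bounded[OF ret_tail_nonneg bound])
  have "{n. ret_prob n > 0} = {n. measure (chain_law E Q a)
           {\<omega> \<in> space (chain_law E Q a). return_time a \<omega> = enat n} > 0}"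
  proof -
    have "ret_prob n = measure (chain_law E Q a) {\<omega> \<in> space (chain_law E Q a). return_time a \<omega> = enat n}" for n
    proof (cases n)
      case 0
      then show ?thesis by (simp add: ret_prob_def return_time_pos)
    next
      case (Suc k)
      then show ?thesis by (simp add: ret_prob_eq_prob return_time_eq)
    qed
    then show ?thesis by simp
  qed
  then show "Gcd {n. ret_prob n > 0} = 1"
    using assms by (simp add: aperiodic_positive_recurrent_atom_def)
qed

end

locale chain_assets = endowment_chain E Q + monotone_recursion "restrict_space borel E" Q a F lo hi
  for E :: "real set" and Q a F lo hi
begin

lemma assets_measurable_hist:
  assumes x0: "x0 \<in> X"
  shows "t \<le> m \<Longrightarrow> assets F x0 t \<in> hist m \<rightarrow>\<^sub>M asset_space lo hi"
proof (induction t)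
  case 0
  then show ?case using x0 by (simp add: assets.simps(1)[abs_def] space_restrict_space)
next
  case (Suc t)
  have "(\<lambda>\<omega>. (assets F x0 t \<omega>, \<omega> t)) \<in> hist m \<rightarrow>\<^sub>M asset_space lo hi \<Otimes>\<^sub>M S"
    by (intro measurable_Pair Suc.IH measurable_component_singleton) (use Suc.prems in auto)
  from measurable_compose[OF this F_meas] show ?case
    by (simp add: assets.simps(2)[abs_def])
qed

lemma assets_restrict: "t \<le> m \<Longrightarrow> assets F x0 t (restrict \<omega> {0..<m}) = assets F x0 t \<omega>"
  by (induction t) auto

lemma assets_in_X: "e0 \<in> E \<Longrightarrow> x0 \<in> X \<Longrightarrow> \<omega> \<in> space (chain_law E Q e0) \<Longrightarrow> assets F x0 t \<omega> \<in> X"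
  using path_in_E[of e0 \<omega>] F_range by (induction t) (auto simp: space_S)

lemma assets_measurable:
  assumes e0: "e0 \<in> E" and x0: "x0 \<in> X"
  shows "assets F x0 t \<in> chain_law E Q e0 \<rightarrow>\<^sub>M asset_space lo hi"
  using measurable_compose[OF restrict_measurable[OF e0] assets_measurable_hist[OF x0 order_refl], of t]
  by (simp add: assets_restrict)

lemma nn_integral_assets:
  assumes e0: "e0 \<in> E" and x0: "x0 \<in> X"
  shows "unit2 g \<Longrightarrow> (\<integral>\<^sup>+\<omega>. ennreal (g (assets F x0 t \<omega>) (\<omega> t)) \<partial>chain_law E Q e0)
      = ennreal ((step ^^ t) g x0 e0)"
proof (induction t arbitrary: g)
  case 0
  have "(\<lambda>e. ennreal (g x0 e)) \<in> borel_measurable S"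
    using unit2_section[OF 0 x0] by (simp add: unit_valued_def)
  from nn_integral_chain_initial[OF e0 this] show ?case by simp
next
  case (Suc t)
  define \<psi> where "\<psi> \<omega> y = ennreal (g (assets F x0 (Suc t) \<omega>) y)" for \<omega> :: "nat \<Rightarrow> real" and y
  have \<psi>_meas: "(\<lambda>(\<omega>, y). \<psi> \<omega> y) \<in> borel_measurable (hist (Suc t) \<Otimes>\<^sub>M S)"
  proof -
    have m: "(\<lambda>(x, e). g x e) \<in> borel_measurable (asset_space lo hi \<Otimes>\<^sub>M S)"
      using Suc.prems by (simp add: unit_valued2_def unit_valued_def)
    have "(\<lambda>p. (assets F x0 (Suc t) (fst p), snd p)) \<in> hist (Suc t) \<Otimes>\<^sub>M S \<rightarrow>\<^sub>M asset_space lo hi \<Otimes>\<^sub>M S"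
      by (intro measurable_Pair measurable_compose[OF measurable_fst assets_measurable_hist[OF x0]] measurable_snd) simp
    from measurable_compose[OF this m] show ?thesis
      unfolding \<psi>_def case_prod_beta by (intro measurable_compose[OF _ measurable_ennreal]) simp
  qed
  have "(\<integral>\<^sup>+\<omega>. ennreal (g (assets F x0 (Suc t) \<omega>) (\<omega> (Suc t))) \<partial>chain_law E Q e0)
    = (\<integral>\<^sup>+\<omega>. \<psi> (restrict \<omega> {0..<Suc t}) (\<omega> (Suc t)) \<partial>chain_law E Q e0)"
    unfolding \<psi>_def assets_restrict[OF order_refl] ..
  also have "\<dots> = (\<integral>\<^sup>+\<omega>. (\<integral>\<^sup>+y. \<psi> (restrict \<omega> {0..<Suc t}) y \<partial>Q (\<omega> t)) \<partial>chain_law E Q e0)"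
    by (rule nn_integral_chain_markov[OF e0 \<psi>_meas])
  also have "\<dots> = (\<integral>\<^sup>+\<omega>. ennreal (step g (assets F x0 t \<omega>) (\<omega> t)) \<partial>chain_law E Q e0)"
  proof (rule nn_integral_cong)
    fix \<omega> assume \<omega>: "\<omega> \<in> space (chain_law E Q e0)"
    have "assets F x0 (Suc t) \<omega> \<in> X" by (rule assets_in_X[OF e0 x0 \<omega>])
    then have "unit_valued S (g (assets F x0 (Suc t) \<omega>))"
      by (rule unit2_section[OF Suc.prems])
    from nn_integral_Q[OF this path_in_E[OF e0 \<omega>, of t]]
    show "(\<integral>\<^sup>+y. \<psi> (restrict \<omega> {0..<Suc t}) y \<partial>Q (\<omega> t)) = ennreal (step g (assets F x0 t \<omega>) (\<omega> t))"
      unfolding \<psi>_def assets_restrict[OF order_refl] by (simp add: step_def)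
  qed
  also have "\<dots> = ennreal ((step ^^ t) (step g) x0 e0)"
    by (rule Suc.IH[OF unit2_step[OF Suc.prems]])
  finally show ?case by (simp add: funpow_swap1)
qed

lemma unit2_le: "unit2 (\<lambda>x e. of_bool (x \<le> z))"
proof (rule unit2_fst)
  have "(\<lambda>x. of_bool (x \<le> z) :: real) = indicator {..z}" by (auto simp: indicator_def)
  then show "(\<lambda>x. of_bool (x \<le> z) :: real) \<in> borel_measurable (asset_space lo hi)"
    by (auto intro: measurable_restrict_space1)
qed auto

lemma assets_borel: "e0 \<in> E \<Longrightarrow> x0 \<in> X \<Longrightarrow> assets F x0 t \<in> borel_measurable (chain_law E Q e0)"
  using assets_measurable by (simp add: measurable_restrict_space2_iff)

lemma real_distribution_assets:
  assumes "e0 \<in> E" "x0 \<in> X"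
  shows "real_distribution (asset_distribution E Q F x0 e0 t)"
  unfolding asset_distribution_def
  by (intro prob_space.real_distribution_distr prob_space_chain_law assets_borel assms)

lemma cdf_assets:
  assumes e0: "e0 \<in> E" and x0: "x0 \<in> X"
  shows "cdf (asset_distribution E Q F x0 e0 t) z = (step ^^ t) (\<lambda>x e. of_bool (x \<le> z)) x0 e0"
proof -
  interpret prob_space "chain_law E Q e0" by (rule prob_space_chain_law[OF e0])
  note X = assets_borel[OF e0 x0, of t]
  let ?A = "assets F x0 t -` {..z} \<inter> space (chain_law E Q e0)"
  have A: "?A \<in> events" by (rule measurable_sets[OF X]) simp
  have "ennreal (prob ?A) = (\<integral>\<^sup>+\<omega>. indicator ?A \<omega> \<partial>chain_law E Q e0)"
    using A by (simp add: emeasure_eq_measure)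
  also have "\<dots> = (\<integral>\<^sup>+\<omega>. ennreal (of_bool (assets F x0 t \<omega> \<le> z)) \<partial>chain_law E Q e0)"
    by (rule nn_integral_cong) (auto simp: indicator_def)
  also have "\<dots> = ennreal ((step ^^ t) (\<lambda>x e. of_bool (x \<le> z)) x0 e0)"
    by (rule nn_integral_assets[OF e0 x0 unit2_le])
  finally have "prob ?A = (step ^^ t) (\<lambda>x e. of_bool (x \<le> z)) x0 e0"
    using unit2_bounds[OF unit2_step_pow[OF unit2_le] x0, of e0 t z] e0 by (simp add: space_S)
  then show ?thesis
    by (simp add: cdf_def asset_distribution_def measure_distr[OF X])
qed

lemma cdf_assets_prob:
  assumes "e0 \<in> E" "x0 \<in> X"
  shows "cdf (asset_distribution E Q F x0 e0 t) z
    = measure (chain_law E Q e0) {\<omega> \<in> space (chain_law E Q e0). assets F x0 t \<omega> \<le> z}"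
  by (simp add: cdf_def asset_distribution_def measure_distr[OF assets_borel[OF assms]]
      vimage_def Int_def conj_commute)

lemma cdf_assets_below:
  assumes "e0 \<in> E" "x0 \<in> X" "z < lo"
  shows "cdf (asset_distribution E Q F x0 e0 t) z = 0"
proof -
  have bounds: "lo \<le> assets F x0 t \<omega>" "assets F x0 t \<omega> \<le> hi"
    if "\<omega> \<in> space (chain_law E Q e0)" for \<omega>
    using assets_in_X[OF assms(1,2) that, of t] by auto
  have "{\<omega> \<in> space (chain_law E Q e0). assets F x0 t \<omega> \<le> z} = {}"
    using assms(3) bounds by fastforce
  then show ?thesis unfolding cdf_assets_prob[OF assms(1,2)] by (simp only: measure_empty)
qed

lemma cdf_assets_above:
  assumes "e0 \<in> E" "x0 \<in> X" "z \<ge> hi"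
  shows "cdf (asset_distribution E Q F x0 e0 t) z = 1"
proof -
  have bounds: "lo \<le> assets F x0 t \<omega>" "assets F x0 t \<omega> \<le> hi"
    if "\<omega> \<in> space (chain_law E Q e0)" for \<omega>
    using assets_in_X[OF assms(1,2) that, of t] by auto
  have "{\<omega> \<in> space (chain_law E Q e0). assets F x0 t \<omega> \<le> z} = space (chain_law E Q e0)"
    using assms(3) bounds by fastforce
  then show ?thesis
    using cdf_assets_prob[OF assms(1,2)] prob_space.prob_space[OF prob_space_chain_law[OF assms(1)]] by simp
qed

end

section \<open>Constant relative risk aversion utility\<close>

definition crra :: "real \<Rightarrow> real \<Rightarrow> real" where
  "crra \<gamma> c = c powr (1 - \<gamma>) / (1 - \<gamma>)"

lemma crra_strict_mono:
  assumes "\<gamma> > 1" "0 < a" "a < b" shows "crra \<gamma> a < crra \<gamma> b"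
  using powr_less_mono2_neg[of "1 - \<gamma>" a b] assms by (simp add: crra_def divide_less_cancel)

lemma crra_deriv:
  assumes "\<gamma> > 1" "x > 0" shows "(crra \<gamma> has_real_derivative x powr (- \<gamma>)) (at x)"
proof -
  have "((\<lambda>x. x powr (1 - \<gamma>) / (1 - \<gamma>)) has_real_derivative (1 - \<gamma>) * x powr (1 - \<gamma> - 1) / (1 - \<gamma>)) (at x)"
    using assms by (intro DERIV_cdivide has_real_derivative_powr)
  then show ?thesis using assms by (simp add: crra_def[abs_def])
qed

lemma crra_tangent:
  assumes \<gamma>: "\<gamma> > 1" and a: "a > 0" and b: "b > 0" and ne: "a \<noteq> b"
  shows "crra \<gamma> b - crra \<gamma> a < a powr (- \<gamma>) * (b - a)"
proof (cases "a < b")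
  case True
  obtain z where z: "a < z" "z < b" "crra \<gamma> b - crra \<gamma> a = (b - a) * z powr (- \<gamma>)"
    using MVT2[of a b "crra \<gamma>" "\<lambda>z. z powr (- \<gamma>)"] True a crra_deriv[OF \<gamma>] by fastforce
  have "z powr (- \<gamma>) < a powr (- \<gamma>)"
    using powr_less_mono2_neg[of "- \<gamma>" a z] z a \<gamma> by simp
  then show ?thesis using z True by (simp add: mult.commute)
next
  case False
  then have ba: "b < a" using ne by simp
  obtain z where z: "b < z" "z < a" "crra \<gamma> a - crra \<gamma> b = (a - b) * z powr (- \<gamma>)"
    using MVT2[of b a "crra \<gamma>" "\<lambda>z. z powr (- \<gamma>)"] ba b crra_deriv[OF \<gamma>] by fastforce
  have "a powr (- \<gamma>) < z powr (- \<gamma>)"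
    using powr_less_mono2_neg[of "- \<gamma>" z a] z b \<gamma> by simp
  then have "(a - b) * a powr (- \<gamma>) < (a - b) * z powr (- \<gamma>)" using ba by simp
  then show ?thesis using z by (simp add: algebra_simps)
qed

text \<open>
  Strict concavity as aversion to a spread: the outer pair \<open>c1, c2\<close> has the same sum as the inner
  pair \<open>d1, d2\<close>. It follows by comparing marginal utilities at the inner points.
\<close>

lemma crra_spread:
  assumes \<gamma>: "\<gamma> > 1" and c: "0 < c1" "c1 < d1" "c1 < d2" "c1 + c2 = d1 + d2"
  shows "crra \<gamma> c1 + crra \<gamma> c2 < crra \<gamma> d1 + crra \<gamma> d2"
proof -
  have aux: "crra \<gamma> c1 + crra \<gamma> c2 < crra \<gamma> d1 + crra \<gamma> d2"
    if c: "0 < c1" "c1 < d1" "c1 < d2" "c1 + c2 = d1 + d2" and le: "d1 \<le> d2" for c1 c2 d1 d2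
  proof -
    define \<delta> where "\<delta> = d1 - c1"
    have \<delta>: "\<delta> > 0" "c1 = d1 - \<delta>" "c2 = d2 + \<delta>" using c by (auto simp: \<delta>_def)
    have "crra \<gamma> c1 - crra \<gamma> d1 < d1 powr (- \<gamma>) * (c1 - d1)"
      by (rule crra_tangent) (use \<gamma> c in auto)
    moreover have "crra \<gamma> c2 - crra \<gamma> d2 < d2 powr (- \<gamma>) * (c2 - d2)"
      by (rule crra_tangent) (use \<gamma> c in auto)
    moreover have "d2 powr (- \<gamma>) * \<delta> \<le> d1 powr (- \<gamma>) * \<delta>"
      using le c \<gamma> \<delta> by (intro mult_right_mono powr_mono2') auto
    moreover have "c1 - d1 = - \<delta>" "c2 - d2 = \<delta>" using \<delta> by auto
    ultimately show ?thesis by simp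
  qed
  show ?thesis
    using aux[of c1 d1 d2 c2] aux[of c1 d2 d1 c2] c by (cases "d1 \<le> d2") (auto simp: add.commute)
qed

lemma crra_midpoint:
  assumes \<gamma>: "\<gamma> > 1" and pos: "0 < a" "0 < b" and ne: "a \<noteq> b"
  shows "(crra \<gamma> a + crra \<gamma> b) / 2 < crra \<gamma> ((a + b) / 2)"
  using crra_spread[OF \<gamma>, of a "(a + b) / 2" "(a + b) / 2" b]
    crra_spread[OF \<gamma>, of b "(a + b) / 2" "(a + b) / 2" a] pos ne
  by (cases a b rule: linorder_cases) auto

lemma midpoint_budget:
  fixes q :: real
  assumes "c1 + q * y1 \<le> x1 + e" "c2 + q * y2 \<le> x2 + e"
  shows "(c1 + c2) / 2 + q * ((y1 + y2) / 2) \<le> (x1 + x2) / 2 + e"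
  using assms by (simp add: field_simps)

section \<open>The savings problem\<close>

locale income_fluctuation = endowment_chain E Q for E :: "real set" and Q +
  fixes \<gamma> \<beta> R xlow xhat elow ehigh :: real and v c f :: "real \<Rightarrow> real \<Rightarrow> real"
  assumes \<gamma>: "\<gamma> > 1" and \<beta>: "0 < \<beta>" "\<beta> < 1" and R: "inverse R > \<beta>"
    and E: "E = {elow..ehigh}" and fel: "feller E Q"
    and vf: "value_function \<gamma> \<beta> R xlow E Q v"
    and pf: "policy_functions \<gamma> \<beta> R xlow E Q v c f"
    and xhat: "xhat \<ge> xlow" and down: "\<And>x e. x > xhat \<Longrightarrow> e \<in> E \<Longrightarrow> f x e < x"
begin

abbreviation "p \<equiv> inverse R"
abbreviation "U \<equiv> crra \<gamma>"

definition expected_value :: "real \<Rightarrow> real \<Rightarrow> real" where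
  "expected_value y e = (\<integral>e'. v y e' \<partial>Q e)"

lemma p_pos: "p > 0" using R \<beta> by linarith

lemma continuous_on_v: "continuous_on ({xlow..} \<times> E) (\<lambda>(x, e). v x e)"
  using vf by (simp add: value_function_def)

lemma continuous_on_v_section: "y \<ge> xlow \<Longrightarrow> continuous_on E (v y)"
proof -
  assume y: "y \<ge> xlow"
  have "continuous_on E (\<lambda>e. (\<lambda>(x, e). v x e) (y, e))"
    by (rule continuous_on_compose2[OF continuous_on_v], intro continuous_on_Pair continuous_on_const continuous_on_id)
       (use y in auto)
  then show ?thesis by simp
qed

definition value_bound :: real where
  "value_bound = (SOME b. \<forall>x\<ge>xlow. \<forall>e\<in>E. \<bar>v x e\<bar> \<le> b)"

lemma v_bound: "x \<ge> xlow \<Longrightarrow> e \<in> E \<Longrightarrow> \<bar>v x e\<bar> \<le> value_bound"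
proof -
  obtain b where b: "\<forall>z\<in>(\<lambda>(x, e). v x e) ` ({xlow..} \<times> E). norm z \<le> b"
    using vf unfolding value_function_def bounded_iff by blast
  have "\<forall>x\<ge>xlow. \<forall>e\<in>E. \<bar>v x e\<bar> \<le> b" using b by force
  then have "\<forall>x\<ge>xlow. \<forall>e\<in>E. \<bar>v x e\<bar> \<le> value_bound" unfolding value_bound_def by (rule someI)
  then show "x \<ge> xlow \<Longrightarrow> e \<in> E \<Longrightarrow> \<bar>v x e\<bar> \<le> value_bound" by blast
qed

lemma integrable_bounded:
  assumes "g \<in> borel_measurable S" "\<And>e. e \<in> E \<Longrightarrow> \<bar>g e\<bar> \<le> (K::real)" "e \<in> E"
  shows "integrable (Q e) g"
proof -
  have e: "e \<in> space S" using assms(3) by (simp add: space_S)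
  interpret prob_space "Q e" by (rule prob_space_Q[OF e])
  show ?thesis
    by (rule integrable_const_bound[where B = K])
       (use assms e in \<open>auto simp: space_Q space_S measurable_cong_sets[OF sets_Q refl]\<close>)
qed

lemma integrable_v: "y \<ge> xlow \<Longrightarrow> e \<in> E \<Longrightarrow> integrable (Q e) (v y)"
  by (rule integrable_bounded[where K = value_bound])
     (auto intro: borel_measurable_continuous_on_restrict continuous_on_v_section v_bound)

lemma integral_Q_const: "e \<in> E \<Longrightarrow> (\<integral>e'. (k::real) \<partial>Q e) = k"
  using prob_space.prob_space[OF prob_space_Q, of e] by (simp add: space_S)

lemma expected_value_bound: assumes "y \<ge> xlow" "e \<in> E" shows "\<bar>expected_value y e\<bar> \<le> value_bound"
proof -
  have e: "e \<in> space S" using assms by (simp add: space_S)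
  interpret prob_space "Q e" by (rule prob_space_Q[OF e])
  have "\<bar>expected_value y e\<bar> \<le> (\<integral>e'. \<bar>v y e'\<bar> \<partial>Q e)" unfolding expected_value_def by (rule integral_abs_bound)
  also have "\<dots> \<le> (\<integral>e'. value_bound \<partial>Q e)"
    by (rule integral_mono) (use integrable_v assms v_bound e in \<open>auto simp: space_Q space_S\<close>)
  also have "\<dots> = value_bound" by (rule integral_Q_const[OF assms(2)])
  finally show ?thesis .
qed

lemma objective_pos: "k > 0 \<Longrightarrow> objective \<gamma> \<beta> Q v e (k, y) = ereal (U k + \<beta> * expected_value y e)"
  by (simp add: objective_def utility_def crra_def expected_value_def)

lemma objective_nonpos: "k \<le> 0 \<Longrightarrow> objective \<gamma> \<beta> Q v e (k, y) = -\<infinity>"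
  by (simp add: objective_def utility_def)

lemma bellman:
  assumes x: "x \<ge> xlow" and e: "e \<in> E"
  shows policy_feasible: "f x e \<ge> xlow" "c x e + p * f x e \<le> x + e"
    and c_pos: "c x e > 0"
    and v_policy: "v x e = U (c x e) + \<beta> * expected_value (f x e) e"
    and v_ge: "\<lbrakk>k > 0; y \<ge> xlow; k + p * y \<le> x + e\<rbrakk> \<Longrightarrow> U k + \<beta> * expected_value y e \<le> v x e"
proof -
  let ?obj = "objective \<gamma> \<beta> Q v e" and ?p = "(c x e, f x e)"
  obtain q where q: "is_arg_max ?obj (\<lambda>q. q \<in> feasible R xlow x e) q" "ereal (v x e) = ?obj q"
    using vf x e unfolding value_function_def optimal_choice_def by blast
  have am: "is_arg_max ?obj (\<lambda>q. q \<in> feasible R xlow x e) ?p"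
    using pf x e unfolding policy_functions_def optimal_choice_def by blast
  have pfeas: "?p \<in> feasible R xlow x e" using am by (simp add: is_arg_max_def)
  then show "f x e \<ge> xlow" "c x e + p * f x e \<le> x + e" by (auto simp: feasible_def)
  have le: "?obj q' \<le> ereal (v x e)" if "q' \<in> feasible R xlow x e" for q'
  proof -
    have "\<not> ?obj q < ?obj q'" using q(1) that unfolding is_arg_max_def by blast
    then show ?thesis by (simp add: q(2))
  qed
  have eq: "?obj ?p = ereal (v x e)"
  proof (rule antisym[OF le[OF pfeas]])
    have "q \<in> feasible R xlow x e" using q(1) by (simp add: is_arg_max_def)
    then have "\<not> ?obj ?p < ?obj q" using am unfolding is_arg_max_def by blast
    then show "ereal (v x e) \<le> ?obj ?p" by (simp add: q(2))
  qed
  show pos: "c x e > 0"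
    using eq objective_nonpos[of "c x e" e "f x e"] by (cases "c x e > 0") auto
  show "v x e = U (c x e) + \<beta> * expected_value (f x e) e"
    using eq objective_pos[OF pos] by simp
  show "U k + \<beta> * expected_value y e \<le> v x e" if "k > 0" "y \<ge> xlow" "k + p * y \<le> x + e"
    using le[of "(k, y)"] objective_pos[OF that(1)] that by (auto simp: feasible_def)
qed

lemma budget_binds:
  assumes x: "x \<ge> xlow" and e: "e \<in> E" shows "c x e = x + e - p * f x e"
proof (rule ccontr)
  assume "c x e \<noteq> x + e - p * f x e"
  then have lt: "c x e < x + e - p * f x e" using policy_feasible(2)[OF x e] by simp
  have "U (x + e - p * f x e) + \<beta> * expected_value (f x e) e \<le> v x e"
    by (rule v_ge[OF x e]) (use lt c_pos[OF x e] policy_feasible[OF x e] in auto)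
  moreover have "U (c x e) < U (x + e - p * f x e)"
    by (rule crra_strict_mono[OF \<gamma> c_pos[OF x e] lt])
  ultimately show False using v_policy[OF x e] by simp
qed

text \<open>
  If the richer agent saved less, let the two agents swap their savings. The continuation values are
  only exchanged, whereas the two consumption levels move strictly towards each other with
  unchanged sum, so one of the agents would gain.
\<close>

lemma f_mono:
  assumes x: "xlow \<le> x" "x \<le> x'" and e: "e \<in> E" shows "f x e \<le> f x' e"
proof (rule ccontr)
  assume "\<not> f x e \<le> f x' e"
  then have gt: "f x' e < f x e" by simp
  then have lt: "x < x'" using x by (cases "x = x'") auto
  have x': "xlow \<le> x'" using x by simp
  let ?y = "f x e" and ?y' = "f x' e"
  have py: "p * ?y' < p * ?y" using gt p_pos by simp
  have c: "c x e = x + e - p * ?y" "c x' e = x' + e - p * ?y'"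
    using budget_binds x x' e by auto
  have cpos: "0 < c x e" by (rule c_pos[OF x(1) e])
  have "U (x + e - p * ?y') + \<beta> * expected_value ?y' e \<le> v x e"
    by (rule v_ge[OF x(1) e]) (use py c cpos policy_feasible[OF x' e] in auto)
  moreover have "U (x' + e - p * ?y) + \<beta> * expected_value ?y e \<le> v x' e"
    by (rule v_ge[OF x' e]) (use lt c cpos policy_feasible[OF x(1) e] in auto)
  moreover have "U (c x e) + U (c x' e) < U (x + e - p * ?y') + U (x' + e - p * ?y)"
    by (rule crra_spread[OF \<gamma> cpos]) (use c py lt in auto)
  ultimately show False using v_policy[OF x(1) e] v_policy[OF x' e] by simp
qed

text \<open>
  The failure of midpoint concavity of \<open>v\<close> is at most \<open>2 * value_bound\<close>. Each use of the Bellman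
  equation, with the average of the two optimal choices as candidate, shrinks it by the factor \<open>\<beta>\<close>.
\<close>

lemma v_midpoint_gap:
  "\<lbrakk>x1 \<ge> xlow; x2 \<ge> xlow; e \<in> E\<rbrakk> \<Longrightarrow>
    (v x1 e + v x2 e) / 2 - v ((x1 + x2) / 2) e \<le> \<beta> ^ n * (2 * value_bound)"
proof (induction n arbitrary: x1 x2 e)
  case 0
  then have "xlow \<le> (x1 + x2) / 2" by simp
  have "(v x1 e + v x2 e) / 2 \<le> value_bound"
    using abs_le_D1[OF v_bound[OF 0(1,3)]] abs_le_D1[OF v_bound[OF 0(2,3)]] by simp
  from add_mono[OF this abs_le_D2[OF v_bound[OF \<open>xlow \<le> (x1 + x2) / 2\<close> 0(3)]]]
  show ?case by simp
next
  case (Suc n)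
  note e = Suc.prems(3)
  let ?x = "(x1 + x2) / 2" and ?y = "(f x1 e + f x2 e) / 2" and ?c = "(c x1 e + c x2 e) / 2"
  have x: "?x \<ge> xlow" using Suc.prems by simp
  note f1 = policy_feasible[OF Suc.prems(1) e] and f2 = policy_feasible[OF Suc.prems(2) e]
  have y: "?y \<ge> xlow" using f1 f2 by simp
  have cp: "c x1 e > 0" "c x2 e > 0" using c_pos Suc.prems by auto
  have "U ?c + \<beta> * expected_value ?y e \<le> v ?x e"
    by (rule v_ge[OF x e _ y midpoint_budget[OF f1(2) f2(2)]]) (use cp in auto)
  moreover have "(U (c x1 e) + U (c x2 e)) / 2 \<le> U ?c"
    using crra_midpoint[OF \<gamma> cp] by (cases "c x1 e = c x2 e") auto
  moreover have "(expected_value (f x1 e) e + expected_value (f x2 e) e) / 2 - \<beta> ^ n * (2 * value_bound) \<le> expected_value ?y e"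
  proof -
    have "(expected_value (f x1 e) e + expected_value (f x2 e) e) / 2 - \<beta> ^ n * (2 * value_bound)
        = (\<integral>e'. (v (f x1 e) e' + v (f x2 e) e') / 2 - \<beta> ^ n * (2 * value_bound) \<partial>Q e)"
      using integrable_v[OF f1(1) e] integrable_v[OF f2(1) e] prob_space.prob_space[OF prob_space_Q, of e]
        prob_space.finite_measure[OF prob_space_Q, of e] e
      by (simp add: expected_value_def space_S finite_measure.integrable_const)
    also have "\<dots> \<le> expected_value ?y e"
      unfolding expected_value_def
    proof (rule integral_mono)
      show "integrable (Q e) (v ?y)" by (rule integrable_v[OF y e])
      show "integrable (Q e) (\<lambda>e'. (v (f x1 e) e' + v (f x2 e) e') / 2 - \<beta> ^ n * (2 * value_bound))"
        using integrable_v[OF f1(1) e] integrable_v[OF f2(1) e]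
          prob_space.finite_measure[OF prob_space_Q, of e] e
        by (simp add: space_S finite_measure.integrable_const)
      fix e' assume "e' \<in> space (Q e)"
      then have "e' \<in> E" using e by (simp add: space_Q space_S)
      from Suc.IH[OF f1(1) f2(1) this]
      show "(v (f x1 e) e' + v (f x2 e) e') / 2 - \<beta> ^ n * (2 * value_bound) \<le> v ?y e'" by simp
    qed
    finally show ?thesis .
  qed
  then have "\<beta> * ((expected_value (f x1 e) e + expected_value (f x2 e) e) / 2 - \<beta> ^ n * (2 * value_bound)) \<le> \<beta> * expected_value ?y e"
    using \<beta> by simp
  ultimately show ?case
    using v_policy[OF Suc.prems(1) e] v_policy[OF Suc.prems(2) e]
    by (simp add: field_simps)
qed

lemma v_midpoint_concave:
  assumes "x1 \<ge> xlow" "x2 \<ge> xlow" "e \<in> E"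
  shows "(v x1 e + v x2 e) / 2 \<le> v ((x1 + x2) / 2) e"
proof -
  have "(\<lambda>n. \<beta> ^ n * (2 * value_bound)) \<longlonglongrightarrow> 0 * (2 * value_bound)"
    using \<beta> by (intro tendsto_intros LIMSEQ_realpow_zero) auto
  from LIMSEQ_le_const[OF this, of "(v x1 e + v x2 e) / 2 - v ((x1 + x2) / 2) e"]
  show ?thesis using v_midpoint_gap[OF assms] by auto
qed

lemma expected_value_midpoint_concave:
  assumes y: "y1 \<ge> xlow" "y2 \<ge> xlow" and e: "e \<in> E"
  shows "(expected_value y1 e + expected_value y2 e) / 2 \<le> expected_value ((y1 + y2) / 2) e"
proof -
  have y': "xlow \<le> (y1 + y2) / 2" using y by simp
  have "(expected_value y1 e + expected_value y2 e) / 2 = (\<integral>e'. (v y1 e' + v y2 e') / 2 \<partial>Q e)"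
    using integrable_v[OF y(1) e] integrable_v[OF y(2) e] by (simp add: expected_value_def)
  also have "\<dots> \<le> expected_value ((y1 + y2) / 2) e"
    unfolding expected_value_def
    by (rule integral_mono)
       (use integrable_v[OF y(1) e] integrable_v[OF y(2) e] integrable_v[OF y' e] v_midpoint_concave[OF y] e
         in \<open>auto simp: space_Q space_S\<close>)
  finally show ?thesis .
qed

text \<open>
  Two different optimal savings levels would imply different consumption, and their average would
  be strictly better.
\<close>

lemma policy_unique:
  assumes x: "x \<ge> xlow" and e: "e \<in> E" and y: "y \<ge> xlow"
    and pos: "x + e - p * y > 0" and eq: "v x e = U (x + e - p * y) + \<beta> * expected_value y e"
  shows "y = f x e"
proof (rule ccontr)
  assume ne: "y \<noteq> f x e"
  let ?y = "(y + f x e) / 2" and ?c = "x + e - p * y" and ?d = "x + e - p * f x e"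
  let ?m = "(?c + ?d) / 2"
  have d: "?d > 0" using c_pos[OF x e] budget_binds[OF x e] by simp
  have f: "f x e \<ge> xlow" by (rule policy_feasible[OF x e])
  have "?c \<noteq> ?d" using ne p_pos by simp
  then have "(U ?c + U ?d) / 2 < U ?m"
    by (rule crra_midpoint[OF \<gamma> pos d])
  moreover have "U ?m + \<beta> * expected_value ?y e \<le> v x e"
  proof (rule v_ge[OF x e])
    show "0 < ?m" using pos d by simp
    show "xlow \<le> ?y" using y f by simp
    have "?m + p * ?y \<le> (x + x) / 2 + e" by (rule midpoint_budget) simp_all
    moreover have "(x + x) / 2 = x" by simp
    ultimately show "?m + p * ?y \<le> x + e" by (simp only:)
  qed
  moreover have "\<beta> * ((expected_value y e + expected_value (f x e) e) / 2) \<le> \<beta> * expected_value ?y e"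
    using expected_value_midpoint_concave[OF y f e] \<beta> by simp
  ultimately show False
    using eq v_policy[OF x e] unfolding budget_binds[OF x e] distrib_left add_divide_distrib
    by linarith
qed

text \<open>
  Chosen so that its utility lies below \<open>- (1 + \<beta>) * value_bound\<close>, which by the Bellman equation is a
  lower bound for the utility of optimal consumption.
\<close>

definition cmin :: real where
  "cmin = ((\<gamma> - 1) * ((1 + \<beta>) * value_bound) + 1) powr (1 / (1 - \<gamma>))"

lemma c_ge_cmin: "x \<ge> xlow \<Longrightarrow> e \<in> E \<Longrightarrow> cmin \<le> c x e" and cmin_pos: "E \<noteq> {} \<Longrightarrow> cmin > 0"
proof -
  show "cmin > 0" if ne: "E \<noteq> {}"
  proof -
    obtain e where "e \<in> E" using ne by blast
    then have "0 \<le> value_bound" using v_bound[of xlow e] by simp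
    then have "(\<gamma> - 1) * ((1 + \<beta>) * value_bound) + 1 > 0"
      using \<gamma> \<beta> by (intro add_nonneg_pos mult_nonneg_nonneg) auto
    then show ?thesis by (simp add: cmin_def)
  qed
  then show "cmin \<le> c x e" if x: "x \<ge> xlow" and e: "e \<in> E"
  proof -
    let ?A = "(1 + \<beta>) * value_bound"
    have "0 \<le> value_bound" using v_bound[OF x e] by simp
    then have pos: "(\<gamma> - 1) * ?A + 1 > 0"
      using \<gamma> \<beta> by (intro add_nonneg_pos mult_nonneg_nonneg) auto
    have "U cmin = ((\<gamma> - 1) * ?A + 1) / (1 - \<gamma>)"
      using \<gamma> pos by (simp add: crra_def cmin_def powr_powr)
    also have "\<dots> < - ?A"
      using \<gamma> by (simp add: divide_less_eq) (simp add: algebra_simps)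
    finally have "U cmin < - ?A" .
    moreover have "- ?A \<le> U (c x e)"
    proof -
      have "\<bar>\<beta> * expected_value (f x e) e\<bar> \<le> \<beta> * value_bound"
        using expected_value_bound[OF policy_feasible(1)[OF x e] e] \<beta> by (simp add: abs_mult)
      then show ?thesis using v_policy[OF x e] v_bound[OF x e] by (simp add: algebra_simps)
    qed
    ultimately have "\<not> c x e < cmin"
      using crra_strict_mono[OF \<gamma> c_pos[OF x e], of cmin] by auto
    then show ?thesis by simp
  qed
qed

lemma f_le_xhat:
  assumes x: "xlow \<le> x" "x \<le> xhat" and e: "e \<in> E" shows "f x e \<le> xhat"
proof (rule dense_ge)
  fix z assume z: "xhat < z"
  have "f x e \<le> f z e" by (rule f_mono) (use x z e in auto)
  also have "\<dots> < z" by (rule down[OF z e])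
  finally show "f x e \<le> z" by simp
qed

text \<open>
  The Feller property gives continuity in \<open>e\<close> for each \<open>y\<close>. Joint continuity needs that \<open>v\<close> is
  uniformly continuous on the compact set of states, so that changing \<open>y\<close> changes the integrand
  uniformly.
\<close>

lemma continuous_on_expected_value: "continuous_on ({xlow..xhat} \<times> E) (\<lambda>(y, e). expected_value y e)"
proof (unfold continuous_on_iff, intro ballI allI impI)
  fix z :: "real \<times> real" and \<epsilon> :: real
  assume z: "z \<in> {xlow..xhat} \<times> E" and \<epsilon>: "\<epsilon> > 0"
  obtain y e where ye: "z = (y, e)" "y \<in> {xlow..xhat}" "e \<in> E" using z by auto
  have "compact ({xlow..xhat} \<times> E)" by (simp add: E compact_Times)
  moreover have "continuous_on ({xlow..xhat} \<times> E) (\<lambda>(x, e). v x e)"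
    by (rule continuous_on_subset[OF continuous_on_v]) auto
  ultimately have "uniformly_continuous_on ({xlow..xhat} \<times> E) (\<lambda>(x, e). v x e)"
    by (rule compact_uniformly_continuous[rotated])
  then obtain d1 where d1: "d1 > 0"
    "\<And>w w'. \<lbrakk>w \<in> {xlow..xhat} \<times> E; w' \<in> {xlow..xhat} \<times> E; dist w' w < d1\<rbrakk>
      \<Longrightarrow> dist ((\<lambda>(x, e). v x e) w') ((\<lambda>(x, e). v x e) w) < \<epsilon> / 2"
    unfolding uniformly_continuous_on_def using \<epsilon> by (meson half_gt_zero)
  have "bounded (v y ` E)"
    unfolding bounded_iff using v_bound[of y] ye by auto
  then have "continuous_on E (\<lambda>e. expected_value y e)"
    using fel continuous_on_v_section[of y] ye unfolding feller_def expected_value_def by auto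
  then obtain d2 where d2: "d2 > 0" "\<And>e'. e' \<in> E \<Longrightarrow> dist e' e < d2 \<Longrightarrow> dist (expected_value y e') (expected_value y e) < \<epsilon> / 2"
    unfolding continuous_on_iff using \<epsilon> ye by (meson half_gt_zero)
  show "\<exists>d>0. \<forall>x'\<in>{xlow..xhat} \<times> E. dist x' z < d \<longrightarrow>
      dist ((\<lambda>(y, e). expected_value y e) x') ((\<lambda>(y, e). expected_value y e) z) < \<epsilon>"
  proof (intro exI[of _ "min d1 d2"] conjI ballI impI)
    fix x' :: "real \<times> real" assume x': "x' \<in> {xlow..xhat} \<times> E" "dist x' z < min d1 d2"
    obtain y' e' where ye': "x' = (y', e')" "y' \<in> {xlow..xhat}" "e' \<in> E" using x' by auto
    have dy: "dist y' y < d1" and de: "dist e' e < d2"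
      using x'(2) dist_fst_le[of x' z] dist_snd_le[of x' z] ye ye' by auto
    have "\<bar>expected_value y' e' - expected_value y e'\<bar> \<le> \<epsilon> / 2"
    proof -
      have "expected_value y' e' - expected_value y e' = (\<integral>e''. v y' e'' - v y e'' \<partial>Q e')"
        unfolding expected_value_def by (rule Bochner_Integration.integral_diff[symmetric]) (use integrable_v ye ye' in auto)
      then have "\<bar>expected_value y' e' - expected_value y e'\<bar> \<le> (\<integral>e''. \<bar>v y' e'' - v y e''\<bar> \<partial>Q e')"
        using integral_abs_bound by metis
      also have "\<dots> \<le> (\<integral>e''. \<epsilon> / 2 \<partial>Q e')"
      proof (rule integral_mono)
        show "integrable (Q e') (\<lambda>e''. \<bar>v y' e'' - v y e''\<bar>)"
          using integrable_v ye ye' by auto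
        show "integrable (Q e') (\<lambda>e''. \<epsilon> / 2)"
          using prob_space.finite_measure[OF prob_space_Q, of e'] ye' by (simp add: space_S finite_measure.integrable_const)
        fix e'' assume "e'' \<in> space (Q e')"
        then have "e'' \<in> E" using ye' by (simp add: space_Q space_S)
        then show "\<bar>v y' e'' - v y e''\<bar> \<le> \<epsilon> / 2"
          using d1(2)[of "(y, e'')" "(y', e'')"] ye ye' dy by (simp add: dist_Pair_Pair dist_real_def)
      qed
      also have "\<dots> = \<epsilon> / 2" by (rule integral_Q_const[OF ye'(3)])
      finally show ?thesis .
    qed
    moreover have "\<bar>expected_value y e' - expected_value y e\<bar> < \<epsilon> / 2" using d2(2)[OF ye'(3) de] by (simp add: dist_real_def)
    ultimately have "\<bar>expected_value y' e' - expected_value y e\<bar> < \<epsilon>" by linarith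
    then show "dist ((\<lambda>(y, e). expected_value y e) x') ((\<lambda>(y, e). expected_value y e) z) < \<epsilon>"
      using ye ye' by (simp add: dist_real_def)
  qed (use d1 d2 in auto)
qed

text \<open>
  The optimal choice is the only one that attains \<open>v\<close>, so the graph of \<open>f\<close> is the zero set of a
  continuous function. A function into a compact set with closed graph is continuous.
\<close>

lemma continuous_on_f: "continuous_on ({xlow..xhat} \<times> E) (\<lambda>z. f (fst z) (snd z))"
proof (cases "E = {}")
  case False
  let ?X = "{xlow..xhat}" and ?F = "\<lambda>z. f (fst z) (snd z)"
  let ?h = "\<lambda>q. (fst (fst q) + snd (fst q) - p * snd q,
     v (fst (fst q)) (snd (fst q)) - U (max cmin (fst (fst q) + snd (fst q) - p * snd q)) - \<beta> * expected_value (snd q) (snd (fst q)))"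
  have cm: "cmin > 0" by (rule cmin_pos[OF False])
  show ?thesis
  proof (rule continuous_from_closed_graph[where T = ?X])
    show "?F \<in> ?X \<times> E \<rightarrow> ?X"
      using policy_feasible(1) f_le_xhat by auto
    let ?D = "(?X \<times> E) \<times> ?X"
    have v_cont: "continuous_on ?D (\<lambda>q. v (fst (fst q)) (snd (fst q)))"
    proof -
      have "continuous_on ?D (\<lambda>q. (\<lambda>(x, e). v x e) (fst q))"
        by (rule continuous_on_compose2[OF continuous_on_v], intro continuous_on_fst continuous_on_id) auto
      then show ?thesis by (simp add: case_prod_beta)
    qed
    have expected_value_cont: "continuous_on ?D (\<lambda>q. expected_value (snd q) (snd (fst q)))"
    proof -
      have "continuous_on ?D (\<lambda>q. (\<lambda>(y, e). expected_value y e) (snd q, snd (fst q)))"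
        by (rule continuous_on_compose2[OF continuous_on_expected_value],
            intro continuous_on_Pair continuous_on_snd continuous_on_fst continuous_on_id) auto
      then show ?thesis by simp
    qed
    have U_cont: "continuous_on ?D (\<lambda>q. U (max cmin (fst (fst q) + snd (fst q) - p * snd q)))"
      unfolding crra_def using cm \<gamma> by (intro continuous_intros) auto
    have c_cont: "continuous_on ?D (\<lambda>q. fst (fst q) + snd (fst q) - p * snd q)"
      by (intro continuous_intros)
    have cont: "continuous_on ?D ?h"
      by (intro c_cont U_cont v_cont expected_value_cont continuous_on_Pair continuous_on_diff continuous_on_mult_left)
    \<comment> \<open>the first component of \<open>?h\<close> keeps consumption at least \<open>cmin\<close>; there the truncation by \<open>max\<close>,
      which makes \<open>?h\<close> continuous everywhere, has no effect\<close>
    have "(\<lambda>z. (z, ?F z)) ` (?X \<times> E) = ((?X \<times> E) \<times> ?X) \<inter> ?h -` ({cmin..} \<times> {0})"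
    proof (intro equalityI subsetI)
      fix q assume "q \<in> (\<lambda>z. (z, ?F z)) ` (?X \<times> E)"
      then obtain x e where q: "q = ((x, e), f x e)" "x \<in> ?X" "e \<in> E" by auto
      have "cmin \<le> x + e - p * f x e"
        using c_ge_cmin[of x e] budget_binds[of x e] q by simp
      moreover have "v x e = U (x + e - p * f x e) + \<beta> * expected_value (f x e) e"
        using v_policy[of x e] budget_binds[of x e] q by simp
      ultimately show "q \<in> ((?X \<times> E) \<times> ?X) \<inter> ?h -` ({cmin..} \<times> {0})"
        using q policy_feasible(1)[of x e] f_le_xhat[of x e] by (simp add: max_absorb2)
    next
      fix q assume "q \<in> ((?X \<times> E) \<times> ?X) \<inter> ?h -` ({cmin..} \<times> {0})"
      then obtain x e y where q: "q = ((x, e), y)" "x \<in> ?X" "e \<in> E" "y \<in> ?X"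
        "cmin \<le> x + e - p * y" "v x e - U (max cmin (x + e - p * y)) - \<beta> * expected_value y e = 0" by auto
      have "y = f x e"
        by (rule policy_unique) (use q cm in \<open>auto simp: max_absorb2\<close>)
      then show "q \<in> (\<lambda>z. (z, ?F z)) ` (?X \<times> E)" using q by auto
    qed
    moreover have "closed (?D \<inter> ?h -` ({cmin..} \<times> {0}))"
      by (rule continuous_closed_preimage[OF cont])
         (auto simp: E intro!: closed_Times)
    ultimately show "closed ((\<lambda>z. (z, ?F z)) ` (?X \<times> E))" by simp
  qed simp
qed simp

lemma f_measurable:
  "(\<lambda>(x, e). f x e) \<in> asset_space xlow xhat \<Otimes>\<^sub>M S \<rightarrow>\<^sub>M asset_space xlow xhat"
proof (rule measurable_restrict_space2)
  let ?N = "asset_space xlow xhat \<Otimes>\<^sub>M S"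
  have sp: "space ?N = {xlow..xhat} \<times> E"
    by (simp add: space_pair_measure space_restrict_space)
  show "(\<lambda>(x, e). f x e) \<in> space ?N \<rightarrow> {xlow..xhat}"
    unfolding sp using policy_feasible(1) f_le_xhat by auto
  have "(\<lambda>z. z) \<in> ?N \<rightarrow>\<^sub>M restrict_space borel ({xlow..xhat} \<times> E)"
  proof (rule measurable_restrict_space2)
    have "(\<lambda>z. (fst z, snd z)) \<in> ?N \<rightarrow>\<^sub>M borel \<Otimes>\<^sub>M borel"
      by (intro measurable_Pair measurable_compose[OF measurable_fst measurable_restrict_space1]
            measurable_compose[OF measurable_snd measurable_restrict_space1] measurable_ident_sets refl)
    then show "(\<lambda>z. z) \<in> ?N \<rightarrow>\<^sub>M borel" by (simp add: borel_prod)
  qed (simp add: sp)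
  from measurable_compose[OF this borel_measurable_continuous_on_restrict[OF continuous_on_f]]
  show "(\<lambda>(x, e). f x e) \<in> borel_measurable ?N" by (simp add: case_prod_beta)
qed

definition marginal_utility :: "real \<Rightarrow> real \<Rightarrow> real" where
  "marginal_utility x e = c x e powr (- \<gamma>)"

lemma marginal_utility_bounds:
  assumes "x \<ge> xlow" "e \<in> E" shows "0 < marginal_utility x e" "marginal_utility x e \<le> cmin powr (- \<gamma>)"
proof -
  show "0 < marginal_utility x e" using c_pos[OF assms] by (simp add: marginal_utility_def)
  show "marginal_utility x e \<le> cmin powr (- \<gamma>)"
    unfolding marginal_utility_def using \<gamma> cmin_pos c_ge_cmin[OF assms] assms by (intro powr_mono2') auto
qed

lemma marginal_utility_measurable:
  assumes y: "y \<in> {xlow..xhat}" shows "marginal_utility y \<in> borel_measurable S"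
proof -
  have "(\<lambda>e. (\<lambda>z. f (fst z) (snd z)) (y, e)) \<in> borel_measurable S"
    by (intro borel_measurable_continuous_on_restrict continuous_on_compose2[OF continuous_on_f])
       (use y in \<open>auto intro: continuous_intros\<close>)
  then have "(\<lambda>e. f y e) \<in> borel_measurable S" by simp
  moreover have "(\<lambda>e. e) \<in> borel_measurable S" by (intro measurable_restrict_space1) simp
  ultimately have "(\<lambda>e. (y + e - p * f y e) powr (- \<gamma>)) \<in> borel_measurable S"
    by measurable
  then show ?thesis
    by (rule measurable_cong[THEN iffD1, rotated]) (use y budget_binds in \<open>auto simp: marginal_utility_def space_S\<close>)
qed

lemma integrable_marginal_utility: "y \<in> {xlow..xhat} \<Longrightarrow> e \<in> E \<Longrightarrow> integrable (Q e) (marginal_utility y)"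
  by (rule integrable_bounded[where K = "cmin powr (- \<gamma>)"])
     (use marginal_utility_measurable marginal_utility_bounds in \<open>auto simp: abs_of_pos\<close>)

text \<open>
  A variational argument: saving \<open>h\<close> less adds \<open>p * h\<close> to
  consumption today; tomorrow the agent can keep the planned savings and consume \<open>h\<close> less. Optimality
  bounds the gain by the loss, and \<open>h \<longlonglongrightarrow> 0\<close> gives the inequality between marginal utilities.
\<close>

lemma euler:
  assumes x: "x \<in> {xlow..xhat}" and e: "e \<in> E" and free: "f x e > xlow"
  shows "marginal_utility x e \<le> \<beta> / p * (\<integral>e'. marginal_utility (f x e) e' \<partial>Q e)"
proof -
  define y where "y = f x e"
  have x': "xlow \<le> x" using x by simp
  have y: "y \<in> {xlow..xhat}" using free f_le_xhat[of x e] x e by (simp add: y_def)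
  have cm: "cmin > 0" using cmin_pos e by blast
  have cp: "c x e > 0" by (rule c_pos[OF x' e])
  let ?I = "\<integral>e'. marginal_utility y e' \<partial>Q e"
  have var: "(c x e + p * h) powr (- \<gamma>) \<le> \<beta> / p * ((1 - h / cmin) powr (- \<gamma>) * ?I)"
    if h: "0 < h" "h < y - xlow" "h < cmin" for h
  proof -
    let ?q = "(1 - h / cmin) powr (- \<gamma>)"
    have q: "1 - h / cmin > 0" using h cm by simp
    \<comment> \<open>the factor \<open>?q\<close> absorbs that marginal utility is evaluated at \<open>c y e' - h\<close>; it is uniform in
      \<open>e'\<close> because consumption is at least \<open>cmin\<close>\<close>
    have pt: "v y e' - v (y - h) e' \<le> h * ?q * marginal_utility y e'" if e': "e' \<in> E" for e'
    proof -
      have y': "y \<ge> xlow" "y - h \<ge> xlow" using h y by auto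
      let ?d = "c y e'"
      have d: "?d \<ge> cmin" by (rule c_ge_cmin[OF y'(1) e'])
      have "U (?d - h) + \<beta> * expected_value (f y e') e' \<le> v (y - h) e'"
        by (rule v_ge[OF y'(2) e'])
           (use d h policy_feasible[OF y'(1) e'] in auto)
      then have "v y e' - v (y - h) e' \<le> U ?d - U (?d - h)"
        using v_policy[OF y'(1) e'] by simp
      also have "\<dots> \<le> (?d - h) powr (- \<gamma>) * h"
        using crra_tangent[OF \<gamma>, of "?d - h" ?d] d h by simp
      also have "(?d - h) powr (- \<gamma>) \<le> (?d * (1 - h / cmin)) powr (- \<gamma>)"
      proof (rule powr_mono2')
        show "0 < ?d * (1 - h / cmin)" using d cm q by simp
        have "h * 1 \<le> h * (?d / cmin)" using d cm h by (intro mult_left_mono) auto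
        then show "?d * (1 - h / cmin) \<le> ?d - h" by (simp add: algebra_simps)
      qed (use \<gamma> in simp)
      also have "\<dots> = marginal_utility y e' * ?q"
        using d cm q by (simp add: marginal_utility_def powr_mult)
      finally show ?thesis using h by (simp add: mult_right_mono ac_simps)
    qed
    have "expected_value y e - expected_value (y - h) e = (\<integral>e'. v y e' - v (y - h) e' \<partial>Q e)"
      unfolding expected_value_def by (rule Bochner_Integration.integral_diff[symmetric]) (use integrable_v y h e in auto)
    also have "\<dots> \<le> (\<integral>e'. h * ?q * marginal_utility y e' \<partial>Q e)"
      by (rule integral_mono)
         (use integrable_v y h e integrable_marginal_utility[OF y e] pt in \<open>auto simp: space_Q space_S\<close>)
    also have "\<dots> = h * ?q * ?I" by simp
    finally have Wd: "expected_value y e - expected_value (y - h) e \<le> h * ?q * ?I" .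
    have "U (c x e + p * h) + \<beta> * expected_value (y - h) e \<le> v x e"
      by (rule v_ge[OF x' e])
         (use cp p_pos h policy_feasible[OF x' e] in \<open>auto simp: y_def algebra_simps add_pos_pos\<close>)
    then have "U (c x e + p * h) - U (c x e) \<le> \<beta> * (expected_value y e - expected_value (y - h) e)"
      using v_policy[OF x' e] by (simp add: y_def algebra_simps)
    also have "\<dots> \<le> \<beta> * (h * ?q * ?I)" using Wd \<beta> by simp
    finally have up: "U (c x e + p * h) - U (c x e) \<le> \<beta> * (h * ?q * ?I)" .
    have ph: "p * h > 0" using p_pos h by simp
    have "U (c x e) - U (c x e + p * h) < (c x e + p * h) powr (- \<gamma>) * (c x e - (c x e + p * h))"
      by (rule crra_tangent[OF \<gamma>]) (use cp ph in auto)
    then have "(c x e + p * h) powr (- \<gamma>) * (p * h) \<le> \<beta> * (h * ?q * ?I)"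
      using up by simp
    then have "(c x e + p * h) powr (- \<gamma>) * p * h \<le> \<beta> * (?q * ?I) * h"
      by (simp add: ac_simps)
    then have "(c x e + p * h) powr (- \<gamma>) * p \<le> \<beta> * (?q * ?I)"
      using h(1) by (rule mult_right_le_imp_le)
    then show ?thesis using p_pos by (simp add: pos_le_divide_eq)
  qed
  have "((\<lambda>h. (c x e + p * h) powr (- \<gamma>)) \<longlongrightarrow> (c x e + p * 0) powr (- \<gamma>)) (at_right 0)"
    by (intro tendsto_intros) (use cp in auto)
  moreover have "((\<lambda>h. \<beta> / p * ((1 - h / cmin) powr (- \<gamma>) * ?I)) \<longlongrightarrow> \<beta> / p * ((1 - 0 / cmin) powr (- \<gamma>) * ?I)) (at_right 0)"
    by (intro tendsto_intros) (use cm in auto)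
  moreover have "\<forall>\<^sub>F h in at_right 0. (c x e + p * h) powr (- \<gamma>) \<le> \<beta> / p * ((1 - h / cmin) powr (- \<gamma>) * ?I)"
  proof -
    have "\<forall>\<^sub>F h in at_right 0. h \<in> {0<..<min (y - xlow) cmin}"
      by (rule eventually_at_right_real) (use free cm in \<open>simp add: y_def\<close>)
    then show ?thesis by eventually_elim (use var in auto)
  qed
  ultimately have "(c x e + p * 0) powr (- \<gamma>) \<le> \<beta> / p * ((1 - 0 / cmin) powr (- \<gamma>) * ?I)"
    by (intro tendsto_le[OF trivial_limit_at_right_real])
  then show ?thesis by (simp add: marginal_utility_def y_def)
qed

end

section \<open>Uniform limits of distribution functions\<close>

lemma abs_cdf_diff_le_1:
  assumes "real_distribution \<mu>" "real_distribution \<nu>"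
  shows "\<bar>cdf \<mu> z - cdf \<nu> z\<bar> \<le> 1"
proof -
  interpret \<mu>: real_distribution \<mu> by fact
  interpret \<nu>: real_distribution \<nu> by fact
  show ?thesis
    using \<mu>.cdf_nonneg[of z] \<nu>.cdf_nonneg[of z] \<mu>.cdf_bounded_prob[of z] \<nu>.cdf_bounded_prob[of z] by linarith
qed

lemma uniform_metric_upper:
  assumes "real_distribution \<mu>" "real_distribution \<nu>"
  shows "\<bar>cdf \<mu> z - cdf \<nu> z\<bar> \<le> uniform_metric \<mu> \<nu>"
  unfolding uniform_metric_def
  by (rule cSUP_upper) (use abs_cdf_diff_le_1[OF assms] in \<open>auto intro!: bdd_aboveI2\<close>)

lemma uniform_metric_least:
  "(\<And>z. \<bar>cdf \<mu> z - cdf \<nu> z\<bar> \<le> \<epsilon>) \<Longrightarrow> uniform_metric \<mu> \<nu> \<le> \<epsilon>"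
  unfolding uniform_metric_def by (rule cSUP_least) auto

text \<open>
  Right continuity passes to uniform limits, so the limit of the distribution functions is itself a
  distribution function, and its Stieltjes measure is the limit distribution. The comparison
  function \<open>\<Lambda>\<close> may depend on \<open>\<epsilon>\<close> and need not be a distribution function.
\<close>

lemma uniform_limit_distribution:
  fixes \<mu> :: "'i \<Rightarrow> nat \<Rightarrow> real measure"
  assumes ne: "I \<noteq> {}" and le: "lo \<le> hi"
    and rd: "\<And>i n. i \<in> I \<Longrightarrow> real_distribution (\<mu> i n)"
    and below: "\<And>i n z. i \<in> I \<Longrightarrow> z < lo \<Longrightarrow> cdf (\<mu> i n) z = 0"
    and above: "\<And>i n z. i \<in> I \<Longrightarrow> z \<ge> hi \<Longrightarrow> cdf (\<mu> i n) z = 1"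
    and cauchy: "\<And>\<epsilon>. \<epsilon> > 0 \<Longrightarrow> \<exists>\<Lambda>. \<forall>i\<in>I. \<exists>N. \<forall>n\<ge>N. \<forall>z. \<bar>cdf (\<mu> i n) z - \<Lambda> z\<bar> < \<epsilon>"
  shows "\<exists>!\<pi>. real_distribution \<pi> \<and> measure \<pi> {lo..hi} = 1 \<and>
    (\<forall>i\<in>I. (\<lambda>n. uniform_metric (\<mu> i n) \<pi>) \<longlonglongrightarrow> 0)"
proof -
  obtain j where j: "j \<in> I" using ne by blast
  define F where "F n = cdf (\<mu> j n)" for n
  have "uniformly_Cauchy_on UNIV F"
    unfolding uniformly_Cauchy_on_def
  proof (intro allI impI)
    fix \<epsilon> :: real assume "\<epsilon> > 0"
    then obtain \<Lambda> where "\<forall>i\<in>I. \<exists>N. \<forall>n\<ge>N. \<forall>z. \<bar>cdf (\<mu> i n) z - \<Lambda> z\<bar> < \<epsilon> / 2"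
      using cauchy[of "\<epsilon> / 2"] by auto
    then obtain N where N: "\<And>n z. n \<ge> N \<Longrightarrow> \<bar>F n z - \<Lambda> z\<bar> < \<epsilon> / 2"
      using j unfolding F_def by blast
    have "dist (F m z) (F n z) < \<epsilon>" if "m \<ge> N" "n \<ge> N" for m n z
      using N[OF that(1), of z] N[OF that(2), of z] unfolding dist_real_def by linarith
    then show "\<exists>M. \<forall>x\<in>UNIV. \<forall>m\<ge>M. \<forall>n\<ge>M. dist (F m x) (F n x) < \<epsilon>" by blast
  qed
  then have "uniformly_convergent_on UNIV F" by (rule Cauchy_uniformly_convergent)
  then obtain G where G: "uniform_limit UNIV F G sequentially"
    by (auto simp: uniformly_convergent_on_def)
  have pt: "(\<lambda>n. F n z) \<longlonglongrightarrow> G z" for z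
    by (rule tendsto_uniform_limitI[OF G]) simp
  have "mono G"
  proof (rule monoI)
    fix x y :: real assume "x \<le> y"
    then have "F n x \<le> F n y" for n
      using finite_borel_measure.cdf_nondecreasing[OF real_distribution.finite_borel_measure_M[OF rd[OF j]]]
      by (simp add: F_def)
    then show "G x \<le> G y" by (intro LIMSEQ_le[OF pt pt]) auto
  qed
  then have mono: "G x \<le> G y" if "x \<le> y" for x y using that by (simp add: monoD)
  have rc: "continuous (at_right z) G" for z
    unfolding continuous_within
  proof (rule swap_uniform_limit[where f = F and S = "{z<..}"])
    show "\<forall>\<^sub>F n in sequentially. (F n \<longlongrightarrow> F n z) (at z within {z<..})"
      using finite_borel_measure.cdf_is_right_cont[OF real_distribution.finite_borel_measure_M[OF rd[OF j]]]
      by (simp add: F_def continuous_within)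
    show "(\<lambda>n. F n z) \<longlonglongrightarrow> G z" by (rule pt)
    show "uniform_limit {z<..} F G sequentially" by (rule uniform_limit_on_subset[OF G]) simp
  qed simp
  have G0: "G z = 0" if "z < lo" for z
    using pt[of z] below[OF j that] by (simp add: F_def LIMSEQ_const_iff)
  have G1: "G z = 1" if "z \<ge> hi" for z
    using pt[of z] above[OF j that] by (simp add: F_def LIMSEQ_const_iff)
  have bot: "(G \<longlongrightarrow> 0) at_bot"
  proof (rule tendsto_eventually)
    show "\<forall>\<^sub>F z in at_bot. G z = 0"
      using eventually_gt_at_bot[of lo] eventually_at_bot_dense G0 by blast
  qed
  have top: "(G \<longlongrightarrow> 1) at_top"
  proof (rule tendsto_eventually)
    show "\<forall>\<^sub>F z in at_top. G z = 1"
      using eventually_ge_at_top[of hi] by eventually_elim (rule G1)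
  qed
  define \<pi> where "\<pi> = interval_measure G"
  have \<pi>: "real_distribution \<pi>" and cdf\<pi>: "cdf \<pi> = G"
    unfolding \<pi>_def using mono rc bot top
    by (auto intro: real_distribution_interval_measure cdf_interval_measure)
  interpret \<pi>: real_distribution \<pi> by (rule \<pi>)
  have close: "(\<lambda>n. uniform_metric (\<mu> i n) \<pi>) \<longlonglongrightarrow> 0" if i: "i \<in> I" for i
  proof (rule LIMSEQ_I)
    fix \<epsilon> :: real assume "\<epsilon> > 0"
    then obtain \<Lambda> where \<Lambda>: "\<forall>i\<in>I. \<exists>N. \<forall>n\<ge>N. \<forall>z. \<bar>cdf (\<mu> i n) z - \<Lambda> z\<bar> < \<epsilon> / 3"
      using cauchy[of "\<epsilon> / 3"] by auto
    then obtain N where N: "\<And>n z. n \<ge> N \<Longrightarrow> \<bar>F n z - \<Lambda> z\<bar> < \<epsilon> / 3"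
      using j unfolding F_def by blast
    from \<Lambda> i obtain N' where N': "\<And>n z. n \<ge> N' \<Longrightarrow> \<bar>cdf (\<mu> i n) z - \<Lambda> z\<bar> < \<epsilon> / 3"
      by blast
    have lim: "\<bar>G z - \<Lambda> z\<bar> \<le> \<epsilon> / 3" for z
    proof (rule LIMSEQ_le_const2)
      show "(\<lambda>n. \<bar>F n z - \<Lambda> z\<bar>) \<longlonglongrightarrow> \<bar>G z - \<Lambda> z\<bar>" by (intro tendsto_intros pt)
      show "\<exists>N. \<forall>n\<ge>N. \<bar>F n z - \<Lambda> z\<bar> \<le> \<epsilon> / 3" using N less_imp_le by blast
    qed
    have "norm (uniform_metric (\<mu> i n) \<pi> - 0) < \<epsilon>" if n: "n \<ge> N'" for n
    proof -
      have "uniform_metric (\<mu> i n) \<pi> \<le> 2 * \<epsilon> / 3"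
      proof (rule uniform_metric_least)
        fix z show "\<bar>cdf (\<mu> i n) z - cdf \<pi> z\<bar> \<le> 2 * \<epsilon> / 3"
          using N'[OF n, of z] lim[of z] unfolding cdf\<pi> by linarith
      qed
      moreover have "0 \<le> uniform_metric (\<mu> i n) \<pi>"
        using uniform_metric_upper[OF rd[OF i] \<pi>, of n 0] by linarith
      ultimately show ?thesis using \<open>\<epsilon> > 0\<close> by simp
    qed
    then show "\<exists>no. \<forall>n\<ge>no. norm (uniform_metric (\<mu> i n) \<pi> - 0) < \<epsilon>" by blast
  qed
  have supp: "measure \<pi> {lo..hi} = 1"
  proof -
    have "(cdf \<pi> \<longlongrightarrow> 0) (at_left lo)"
      by (rule tendsto_eventually) (use G0 cdf\<pi> in \<open>auto simp: eventually_at_filter\<close>)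
    then have "measure \<pi> {..<lo} = 0"
      using tendsto_unique[OF trivial_limit_at_left_real \<pi>.cdf_at_left] by blast
    moreover have "measure \<pi> {..hi} = 1" using G1[of hi] fun_cong[OF cdf\<pi>, of hi] by (simp add: cdf_def)
    moreover have "{lo..hi} = {..hi} - {..<lo}" by auto
    moreover have "measure \<pi> ({..hi} - {..<lo}) = measure \<pi> {..hi} - measure \<pi> {..<lo}"
      by (rule \<pi>.finite_measure_Diff) (use le in auto)
    ultimately show ?thesis by simp
  qed
  show ?thesis
  proof (rule ex1I[of _ \<pi>])
    fix \<pi>' assume "real_distribution \<pi>' \<and> measure \<pi>' {lo..hi} = 1 \<and>
      (\<forall>i\<in>I. (\<lambda>n. uniform_metric (\<mu> i n) \<pi>') \<longlonglongrightarrow> 0)"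
    then have \<pi>': "real_distribution \<pi>'" and lim': "(\<lambda>n. uniform_metric (\<mu> j n) \<pi>') \<longlonglongrightarrow> 0"
      using j by auto
    have "cdf \<pi>' = cdf \<pi>"
    proof
      fix z
      have "(\<lambda>n. F n z - cdf \<pi>' z) \<longlonglongrightarrow> 0"
        by (rule Lim_null_comparison[OF _ lim'])
           (use uniform_metric_upper[OF rd[OF j] \<pi>'] in \<open>simp add: F_def\<close>)
      then have "(\<lambda>n. F n z) \<longlonglongrightarrow> cdf \<pi>' z" by (rule LIM_zero_cancel)
      then show "cdf \<pi>' z = cdf \<pi> z" using LIMSEQ_unique[OF pt] unfolding cdf\<pi> by simp
    qed
    then show "\<pi>' = \<pi>" by (rule cdf_unique[OF \<pi>' \<pi>])
  qed (use \<pi> supp close in blast)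
qed

section \<open>The asset process\<close>

locale income_dynamics = income_fluctuation +
  fixes a :: real
  assumes atom: "aperiodic_positive_recurrent_atom E Q a"
begin

sublocale chain_assets E Q a f xlow xhat
proof -
  interpret A: endowment_chain_with_atom E Q a
    by unfold_locales (use atom in \<open>simp add: aperiodic_positive_recurrent_atom_def\<close>)
  interpret E: ergodic_kernel S Q a by (rule A.ergodic[OF atom])
  show "chain_assets E Q a f xlow xhat"
    by unfold_locales (use f_measurable f_mono xhat in \<open>auto simp: space_S\<close>)
qed

text \<open>
  Iterating the Euler inequality up to the first time at the borrowing limit: along paths still away
  from it marginal utility is discounted by \<open>(\<beta> / p) ^ t\<close>, and on the others it is merely bounded.
\<close>

lemma marginal_utility_le_away:
  "\<lbrakk>x \<in> {xlow..xhat}; e \<in> E\<rbrakk> \<Longrightarrow>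
    marginal_utility x e \<le> cmin powr (- \<gamma>) * (\<beta> / p) ^ t + cmin powr (- \<gamma>) * (1 - away t x e)"
proof (induction t arbitrary: x e)
  case 0
  then show ?case using marginal_utility_bounds[of x e] by auto
next
  case (Suc t)
  let ?K = "cmin powr (- \<gamma>)" and ?r = "\<beta> / p"
  have K: "0 \<le> ?K" by simp
  have r: "0 \<le> ?r" "?r < 1" using \<beta> R p_pos by auto
  have e: "e \<in> space S" using Suc.prems by (simp add: space_S)
  have muK: "marginal_utility x e \<le> ?K" using marginal_utility_bounds Suc.prems by auto
  have rK: "0 \<le> ?K * ?r ^ Suc t" by (intro mult_nonneg_nonneg zero_le_power K r)
  show ?case
  proof (cases "x = xlow \<or> f x e = xlow")
    case True
    have away0: "away t xlow = (\<lambda>_. 0)" by (intro ext) (cases t; simp)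
    have "step (away t) x e = 0" if "f x e = xlow"
      by (simp add: step_def that away0 avg_def)
    then have "away (Suc t) x e = 0" using True by auto
    moreover have "marginal_utility x e \<le> ?K * ?r ^ Suc t + ?K" using muK rK by linarith
    ultimately show ?thesis by (simp only: diff_zero mult_1_right)
  next
    case False
    let ?y = "f x e"
    have y: "?y \<in> {xlow..xhat}" using F_range[OF Suc.prems(1) e] .
    have free: "?y > xlow" using False y by auto
    have st: "0 \<le> step (away t) x e" "step (away t) x e \<le> 1"
      using unit2_bounds[OF unit2_step[OF unit2_away] Suc.prems(1) e] by auto
    have ia: "integrable (Q e) (away t ?y)"
      by (rule integrable_unit[OF unit2_section[OF unit2_away y] e])
    have ic: "integrable (Q e) (\<lambda>_. k :: real)" for k
      using prob_space.finite_measure[OF prob_space_Q[OF e]] by (simp add: finite_measure.integrable_const)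
    have "(\<integral>e'. marginal_utility ?y e' \<partial>Q e) \<le> (\<integral>e'. ?K * ?r ^ t + ?K * (1 - away t ?y e') \<partial>Q e)"
      by (rule integral_mono[OF integrable_marginal_utility[OF y Suc.prems(2)]])
         (use ia ic Suc.IH[OF y] e in \<open>auto simp: space_Q space_S\<close>)
    also have "\<dots> = ?K * ?r ^ t + ?K * (1 - step (away t) x e)"
      using ia ic prob_space.prob_space[OF prob_space_Q[OF e]] by (simp add: step_def avg_def)
    finally have IH: "(\<integral>e'. marginal_utility ?y e' \<partial>Q e) \<le> ?K * ?r ^ t + ?K * (1 - step (away t) x e)" .
    have "marginal_utility x e \<le> ?r * (\<integral>e'. marginal_utility ?y e' \<partial>Q e)"
      by (rule euler[OF Suc.prems free])
    also have "\<dots> \<le> ?r * (?K * ?r ^ t + ?K * (1 - step (away t) x e))"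
      by (rule mult_left_mono[OF IH r(1)])
    also have "\<dots> \<le> ?K * ?r ^ Suc t + ?K * (1 - step (away t) x e)"
    proof -
      have "?r * (?K * (1 - step (away t) x e)) \<le> 1 * (?K * (1 - step (away t) x e))"
        using r K st by (intro mult_right_mono mult_nonneg_nonneg) auto
      then show ?thesis by (simp add: distrib_left ac_simps)
    qed
    finally show ?thesis using False by simp
  qed
qed

sublocale resetting_recursion S Q a f xlow xhat
proof unfold_locales
  show "\<exists>n. away n xhat a < 1"
  proof (rule ccontr)
    assume "\<not> (\<exists>n. away n xhat a < 1)"
    then have one: "away n xhat a = 1" for n
      using away_bounds[of xhat a n] lo_hi a_space by (auto simp: not_less intro: antisym)
    have x: "xhat \<in> {xlow..xhat}" and a: "a \<in> E" using lo_hi a_space by (auto simp: space_S)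
    have "(\<lambda>t. cmin powr (- \<gamma>) * (\<beta> / p) ^ t) \<longlonglongrightarrow> cmin powr (- \<gamma>) * 0"
      using \<beta> R p_pos by (intro tendsto_intros LIMSEQ_realpow_zero) auto
    from LIMSEQ_le_const[OF this, of "marginal_utility xhat a"] have "marginal_utility xhat a \<le> 0"
      using marginal_utility_le_away[OF x a] one by auto
    then show False using marginal_utility_bounds[of xhat a] x a by auto
  qed
qed

theorem stationary_asset_distribution:
  "\<exists>!\<pi>. real_distribution \<pi> \<and> measure \<pi> {xlow..xhat} = 1 \<and>
     (\<forall>i\<in>E \<times> {xlow..xhat}. (\<lambda>t. uniform_metric (asset_distribution E Q f (snd i) (fst i) t) \<pi>) \<longlonglongrightarrow> 0)"
proof (rule uniform_limit_distribution)
  show "E \<times> {xlow..xhat} \<noteq> {}" using a_space lo_hi by (auto simp: space_S)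
  show "xlow \<le> xhat" by (rule lo_hi)
  fix i assume i: "i \<in> E \<times> {xlow..xhat}"
  then have i': "fst i \<in> E" "snd i \<in> {xlow..xhat}" by auto
  then have sp: "fst i \<in> space S" by (simp add: space_S)
  fix n
  show "real_distribution (asset_distribution E Q f (snd i) (fst i) n)"
    by (rule real_distribution_assets[OF i'])
  show "cdf (asset_distribution E Q f (snd i) (fst i) n) z = 0" if "z < xlow" for z
    by (rule cdf_assets_below[OF i' that])
  show "cdf (asset_distribution E Q f (snd i) (fst i) n) z = 1" if "z \<ge> xhat" for z
    by (rule cdf_assets_above[OF i' that])
next
  fix \<epsilon> :: real assume \<epsilon>: "\<epsilon> > 0"
  obtain \<Lambda> where \<Lambda>: "\<forall>x\<in>{xlow..xhat}. \<forall>e\<in>space S. \<exists>N. \<forall>n\<ge>N. \<forall>g. unit2 g \<longrightarrow> \<bar>(step ^^ n) g x e - \<Lambda> g\<bar> < \<epsilon>"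
    using step_pow_uniform_limit[OF \<epsilon>] by blast
  show "\<exists>\<Lambda>. \<forall>i\<in>E \<times> {xlow..xhat}. \<exists>N. \<forall>n\<ge>N. \<forall>z.
      \<bar>cdf (asset_distribution E Q f (snd i) (fst i) n) z - \<Lambda> z\<bar> < \<epsilon>"
  proof (intro exI[of _ "\<lambda>z. \<Lambda> (\<lambda>x e. of_bool (x \<le> z))"] ballI)
    fix i assume i: "i \<in> E \<times> {xlow..xhat}"
    then have i': "fst i \<in> E" "snd i \<in> {xlow..xhat}" by auto
    then have "fst i \<in> space S" by (simp add: space_S)
    with \<Lambda> i'(2) obtain N where "\<forall>n\<ge>N. \<forall>g. unit2 g \<longrightarrow> \<bar>(step ^^ n) g (snd i) (fst i) - \<Lambda> g\<bar> < \<epsilon>"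
      by blast
    then show "\<exists>N. \<forall>n\<ge>N. \<forall>z. \<bar>cdf (asset_distribution E Q f (snd i) (fst i) n) z
        - \<Lambda> (\<lambda>x e. of_bool (x \<le> z))\<bar> < \<epsilon>"
      using unit2_le by (auto simp: cdf_assets[OF i'])
  qed
qed

end

theorem mainTheorem3:
  fixes \<gamma> \<beta> R xlow elow ehigh xhat a :: real
    and Q :: "real \<Rightarrow> real measure"
    and v c f :: "real \<Rightarrow> real \<Rightarrow> real"
    and E :: "real set"
  assumes "\<gamma> > 1"
    and "0 < \<beta>" and "\<beta> < 1"
    and "inverse R > \<beta>"
    and "0 < elow" and "elow < ehigh"
    and "E = {elow..ehigh}"
    and "transition_function E Q"
    and "feller E Q"
    and "aperiodic_positive_recurrent_atom E Q a"
    and "xlow < 0" and "xlow + elow - xlow * inverse R > 0"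
    and "value_function \<gamma> \<beta> R xlow E Q v"
    and "policy_functions \<gamma> \<beta> R xlow E Q v c f"
    and "xhat \<ge> xlow"
    and "\<And>x e. x > xhat \<Longrightarrow> e \<in> E \<Longrightarrow> f x e < x"
  shows "\<exists>!\<pi> :: real measure.
           real_distribution \<pi> \<and> measure \<pi> {xlow..xhat} = 1 \<and>
           (\<forall>e0\<in>E. \<forall>x0\<in>{xlow..xhat}.
              (\<lambda>t. uniform_metric (asset_distribution E Q f x0 e0 t) \<pi>) \<longlonglongrightarrow> 0)"
proof -
  interpret income_dynamics E Q \<gamma> \<beta> R xlow xhat elow ehigh v c f a
    by unfold_locales (use assms in auto)
  show ?thesis using stationary_asset_distribution by simp
qed

end
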